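(* Assume that the period lattice $\mathcal{L}_f$ is rectangular. Let $m=q_1\cdots q_{r(m)}$ be a product of $r(m)\ge 1$ distinct odd primes with $\gcd(m,N)=1$. (i) If $q_i\in\mathcal{S}_0\cup\mathcal{S}_1\cup\mathcal{S}_2$ for all $i$, then $$v_2\left(\frac{L(f,\chi_m,1)}{\Omega_f^{\mathrm{sgn}(\chi_m)}}\right)\ \ge\ \mathfrak{w}_m\cdot r(m)+\min\left\{\delta_{\mathfrak{v}_m,0},\ v_2\left(\frac{L(f,1)}{\Omega_f^+}\right)\right\}.$$ (ii) If $q_i\in\mathcal{S}_0^+\cup\mathcal{S}_1^+\cup\mathcal{S}_2^+$ for all $i$, then $$v_2\left(\frac{L(f,\chi_m,1)}{\Omega_f^{\mathrm{sgn}(\chi_m)}}\right)\ \ge\ \mathfrak{w}_m\cdot r(m)+\min\left\{1+\delta_{\mathfrak{v}_m,0},\ v_2\left(\frac{L(f,1)}{\Omega_f^+}\right)+\delta_{\mathfrak{v}_m,2}\right\}.$$ Moreover, if $v_2(L(f,1)/\Omega_f^+)=1$ and $q_i\in\mathcal{S}_0^+$ for all $i$, or if $v_2(L(f,1)/\Omega_f^+)<1$ and $q_i\in\mathcal{S}_1^+$ for all $i$, then equality holds in the inequality of (ii).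
   Context: Let $f=\sum_{n\ge1}a_nq^n\in S_2(\Gamma_0(N))^{\mathrm{new}}$ be a normalized Hecke eigenform of weight 2 with all Fourier coefficients $a_n\in\mathbb{Q}$. Let $E$ be the optimal elliptic curve over $\mathbb{Q}$ in the isogeny class attached to $f$, with modular parametrization $\Phi:X_0(N)\to E$ and Néron differential $\omega_E$ of a global minimal model; assume the Manin constant is $1$, i.e. $f(q)\,dq/q=\Phi^*\omega_E$. Then the period lattice $\mathcal{L}_f=\{\int_\gamma f(q)\,dq/q:\gamma\in H_1(X_0(N)(\mathbb{C}),\mathbb{Z})\}$ equals the period lattice of $\omega_E$, and there are real numbers $\Omega_f^{\pm}>0$ such that either $\mathcal{L}_f=\Omega_f^+\mathbb{Z}+i\Omega_f^-\mathbb{Z}$ (called rectangular; the case $\Delta(E)<0$) or $\mathcal{L}_f=\Omega_f^+\mathbb{Z}+\frac{\Omega_f^++i\Omega_f^-}{2}\mathbb{Z}$ (non-rectangular; the case $\Delta(E)>0$). For an odd squarefree $d$, $\chi_d$ is the primitive quadratic Dirichlet character of conductor $d$ (product of Legendre symbols $(\cdot/q)$ over primes $q\mid d$; $\chi_1$ trivial), and $\mathrm{sgn}(\chi)=\chi(-1)$. $L(f,\chi,s)$ is the analytic continuation of $\sum_n\chi(n)a_nn^{-s}$; the ratios $L(f,\chi_m,1)/\Omega_f^{\mathrm{sgn}(\chi_m)}$ are algebraic. $v_2$ is a 2-adic valuation on $\overline{\mathbb{Q}}$ with $v_2(2)=1$ and $v_2(0)=+\infty$. For an integer $i$, $\mathcal{S}_i^{\pm}$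 is the set of odd primes $q\nmid N$ with $\chi_q(-1)=\pm1$ (i.e. $q\equiv\pm1\bmod 4$) and $v_2(a_q-2)=i$; $\mathcal{S}_i=\mathcal{S}_i^+\cup\mathcal{S}_i^-$. Set $\mathfrak{v}_m=\min_{q\mid m\text{ prime}}v_2(a_q-2)$, and $\mathfrak{w}_m=0$ if $\mathfrak{v}_m=0$, $\mathfrak{w}_m=1$ if $\mathfrak{v}_m\ge1$. $\delta_{i,j}$ is the Kronecker delta. *)

theory Defs
  imports
    "HOL-Complex_Analysis.Complex_Analysis"
    "HOL-Homology.Homology"
    "HOL-Number_Theory.Number_Theory"
begin

section \<open>Cusp forms of weight 2 and newforms\<close>

text \<open>With formal power series loaded, the infix \<open>$\<close> is ambiguous.\<close>

abbreviation ent :: "int^2^2 \<Rightarrow> 2 \<Rightarrow> 2 \<Rightarrow> int" where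
  "ent A i j \<equiv> vec_nth (vec_nth A i) j"

definition SL2Z :: "(int^2^2) set" where
  "SL2Z = {A. det A = 1}"

definition Gamma0 :: "nat \<Rightarrow> (int^2^2) set" where
  "Gamma0 N = {A \<in> SL2Z. int N dvd ent A 2 1}"

definition act :: "int^2^2 \<Rightarrow> complex \<Rightarrow> complex" where
  "act A z = moebius (of_int (ent A 1 1)) (of_int (ent A 1 2)) (of_int (ent A 2 1)) (of_int (ent A 2 2)) z"

definition slash2 :: "(complex \<Rightarrow> complex) \<Rightarrow> int^2^2 \<Rightarrow> complex \<Rightarrow> complex" where
  "slash2 f A z = f (act A z) / (of_int (ent A 2 1) * z + of_int (ent A 2 2)) ^ 2"

text \<open>Forms are functions on \<open>complex\<close> of which only the values on the upper half plane matter.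
  Since every \<open>f|A\<close> is holomorphic and periodic, tending to 0 as \<open>Im z\<close> tends to infinity says that
  its expansion in \<open>exp(2 pi i z/h)\<close> has only positive exponents.\<close>

definition cusp_form :: "nat \<Rightarrow> (complex \<Rightarrow> complex) \<Rightarrow> bool" where
  "cusp_form N f \<longleftrightarrow>
     f holomorphic_on {z. Im z > 0} \<and>
     (\<forall>A\<in>Gamma0 N. \<forall>z. Im z > 0 \<longrightarrow> slash2 f A z = f z) \<and>
     (\<forall>A\<in>SL2Z. filterlim (slash2 f A) (nhds 0) (filtercomap Im at_top))"

definition q_expansion :: "(complex \<Rightarrow> complex) \<Rightarrow> (nat \<Rightarrow> complex) \<Rightarrow> bool" where
  "q_expansion f a \<longleftrightarrow>
     (\<forall>z. Im z > 0 \<longrightarrow>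
        (\<lambda>n. a (Suc n) * exp (2 * of_real pi * \<i> * of_nat (Suc n) * z)) sums f z)"

text \<open>Weight 2, level \<open>N\<close>, including the operators usually written \<open>U_p\<close> for primes \<open>p\<close> dividing
  \<open>N\<close>.\<close>

definition hecke :: "nat \<Rightarrow> nat \<Rightarrow> (complex \<Rightarrow> complex) \<Rightarrow> complex \<Rightarrow> complex" where
  "hecke N n f z =
     of_nat n * (\<Sum>a | a dvd n \<and> coprime a N. \<Sum>b<n div a.
        f ((of_nat a * z + of_nat b) / of_nat (n div a)) / of_nat (n div a) ^ 2)"

definition hecke_eigenform :: "nat \<Rightarrow> (complex \<Rightarrow> complex) \<Rightarrow> bool" where
  "hecke_eigenform N f \<longleftrightarrow>
     cusp_form N f \<and> (\<forall>n\<ge>1. \<exists>c. \<forall>z. Im z > 0 \<longrightarrow> hecke N n f z = c * f z)"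

definition right_cosets :: "nat \<Rightarrow> (int^2^2) set set" where
  "right_cosets N = (\<lambda>A. (\<lambda>B. B ** A) ` Gamma0 N) ` SL2Z"

definition std_fundamental_domain :: "complex set" where
  "std_fundamental_domain = {z. Im z > 0 \<and> \<bar>Re z\<bar> \<le> 1/2 \<and> 1 \<le> norm z}"

text \<open>In weight 2 the factor \<open>y^k\<close> cancels against the invariant measure \<open>dx dy / y^2\<close>. The
  integral does not depend on the representative of the coset.\<close>

definition petersson :: "nat \<Rightarrow> (complex \<Rightarrow> complex) \<Rightarrow> (complex \<Rightarrow> complex) \<Rightarrow> complex" where
  "petersson N f g =
     (\<Sum>C\<in>right_cosets N. let A = (SOME A. A \<in> C) in
        set_lebesgue_integral lborel std_fundamental_domain
          (\<lambda>z. slash2 f A z * cnj (slash2 g A z)))"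

text \<open>The new subspace: the orthogonal complement of the old forms, which are spanned by the
  functions \<open>g(d z)\<close> below.\<close>

definition new_form_space :: "nat \<Rightarrow> (complex \<Rightarrow> complex) \<Rightarrow> bool" where
  "new_form_space N f \<longleftrightarrow>
     cusp_form N f \<and>
     (\<forall>M d g. M dvd N \<and> M < N \<and> d dvd N div M \<and> cusp_form M g \<longrightarrow>
        petersson N f (\<lambda>z. g (of_nat d * z)) = 0)"

section \<open>The modular curve\<close>

datatype ext_upper = Pt complex | Cusp rat | Cusp_inf

definition ext_upper_points :: "ext_upper set" where
  "ext_upper_points = Pt ` {z. Im z > 0} \<union> range Cusp \<union> {Cusp_inf}"

fun ext_act :: "int^2^2 \<Rightarrow> ext_upper \<Rightarrow> ext_upper" where
  "ext_act A (Pt z) = Pt (act A z)"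
| "ext_act A (Cusp r) =
     (if of_int (ent A 2 1) * r + of_int (ent A 2 2) = 0 then Cusp_inf
      else Cusp ((of_int (ent A 1 1) * r + of_int (ent A 1 2)) / (of_int (ent A 2 1) * r + of_int (ent A 2 2))))"
| "ext_act A Cusp_inf =
     (if ent A 2 1 = 0 then Cusp_inf else Cusp (of_int (ent A 1 1) / of_int (ent A 2 1)))"

text \<open>Horocycle topology: the neighbourhoods of a rational cusp contain an open disc tangent to the
  real axis at that cusp.\<close>

definition ext_upper_open :: "ext_upper set \<Rightarrow> bool" where
  "ext_upper_open U \<longleftrightarrow>
     U \<subseteq> ext_upper_points \<and>
     open {z. Im z > 0 \<and> Pt z \<in> U} \<and>
     (Cusp_inf \<in> U \<longrightarrow> (\<exists>Y>0. \<forall>z. Im z > Y \<longrightarrow> Pt z \<in> U)) \<and>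
     (\<forall>r. Cusp r \<in> U \<longrightarrow> (\<exists>e>0. \<forall>z\<in>ball (Complex (of_rat r) e) e. Pt z \<in> U))"

definition ext_upper_top :: "ext_upper topology" where
  "ext_upper_top = topology ext_upper_open"

definition orbit0 :: "nat \<Rightarrow> ext_upper \<Rightarrow> ext_upper set" where
  "orbit0 N p = (\<lambda>A. ext_act A p) ` Gamma0 N"

definition X0_open :: "nat \<Rightarrow> ext_upper set set \<Rightarrow> bool" where
  "X0_open N V \<longleftrightarrow>
     V \<subseteq> orbit0 N ` ext_upper_points \<and>
     openin ext_upper_top {p \<in> ext_upper_points. orbit0 N p \<in> V}"

definition X0_top :: "nat \<Rightarrow> ext_upper set topology" where
  "X0_top N = topology (X0_open N)"

lemma ball_Complex_mono:
  assumes "0 < e'" "e' \<le> e"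
  shows "ball (Complex x e') e' \<subseteq> ball (Complex x e) e"
proof
  fix z assume z: "z \<in> ball (Complex x e') e'"
  have "Complex x e - Complex x e' = \<i> * of_real (e - e')"
    by (simp add: complex_eq_iff)
  then have "dist (Complex x e) (Complex x e') = e - e'"
    using assms by (simp add: dist_norm norm_mult del: of_real_diff)
  with z show "z \<in> ball (Complex x e) e"
    using dist_triangle[of "Complex x e" z "Complex x e'"] by simp
qed

lemma istopology_ext_upper_open: "istopology ext_upper_open"
  unfolding istopology_def
proof (intro conjI allI impI)
  fix S T assume S: "ext_upper_open S" and T: "ext_upper_open T"
  have eq: "{z. Im z > 0 \<and> Pt z \<in> S \<inter> T} = {z. Im z > 0 \<and> Pt z \<in> S} \<inter> {z. Im z > 0 \<and> Pt z \<in> T}"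
    by auto
  show "ext_upper_open (S \<inter> T)"
    unfolding ext_upper_open_def
  proof (intro conjI impI allI)
    show "S \<inter> T \<subseteq> ext_upper_points" using S by (auto simp: ext_upper_open_def)
    show "open {z. Im z > 0 \<and> Pt z \<in> S \<inter> T}"
      unfolding eq using S T by (auto simp: ext_upper_open_def)
  next
    assume inf: "Cusp_inf \<in> S \<inter> T"
    obtain Y where "Y > 0" "\<forall>z. Im z > Y \<longrightarrow> Pt z \<in> S"
      using inf S by (auto simp: ext_upper_open_def)
    moreover obtain Y' where "Y' > 0" "\<forall>z. Im z > Y' \<longrightarrow> Pt z \<in> T"
      using inf T by (auto simp: ext_upper_open_def)
    ultimately show "\<exists>Y>0. \<forall>z. Im z > Y \<longrightarrow> Pt z \<in> S \<inter> T"
      by (intro exI[of _ "max Y Y'"]) auto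
  next
    fix r assume r: "Cusp r \<in> S \<inter> T"
    obtain e where e: "e > 0" "\<forall>z\<in>ball (Complex (of_rat r) e) e. Pt z \<in> S"
      using r S unfolding ext_upper_open_def by (metis IntD1)
    obtain e' where e': "e' > 0" "\<forall>z\<in>ball (Complex (of_rat r) e') e'. Pt z \<in> T"
      using r T unfolding ext_upper_open_def by (metis IntD2)
    have "ball (Complex (of_rat r) (min e e')) (min e e') \<subseteq> ball (Complex (of_rat r) e) e"
      "ball (Complex (of_rat r) (min e e')) (min e e') \<subseteq> ball (Complex (of_rat r) e') e'"
      using e(1) e'(1) by (simp_all add: ball_Complex_mono)
    then have "\<forall>z\<in>ball (Complex (of_rat r) (min e e')) (min e e'). Pt z \<in> S \<inter> T"
      using e(2) e'(2) by blast
    then show "\<exists>e>0. \<forall>z\<in>ball (Complex (of_rat r) e) e. Pt z \<in> S \<inter> T"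
      using e(1) e'(1) by (intro exI[of _ "min e e'"]) simp
  qed
next
  fix K assume K: "\<forall>S\<in>K. ext_upper_open S"
  have eq: "{z. Im z > 0 \<and> Pt z \<in> \<Union>K} = (\<Union>S\<in>K. {z. Im z > 0 \<and> Pt z \<in> S})"
    by auto
  have "open {z. Im z > 0 \<and> Pt z \<in> \<Union>K}"
    unfolding eq using K by (intro open_UN) (auto simp: ext_upper_open_def)
  moreover have "\<exists>Y>0. \<forall>z. Im z > Y \<longrightarrow> Pt z \<in> \<Union>K" if "Cusp_inf \<in> \<Union>K"
  proof -
    from that obtain S where S: "S \<in> K" "Cusp_inf \<in> S" by blast
    then have "ext_upper_open S" using K by blast
    with S obtain Y where "Y > 0" "\<forall>z. Im z > Y \<longrightarrow> Pt z \<in> S"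
      by (auto simp: ext_upper_open_def)
    with S show ?thesis by blast
  qed
  moreover have "\<exists>e>0. \<forall>z\<in>ball (Complex (of_rat r) e) e. Pt z \<in> \<Union>K" if "Cusp r \<in> \<Union>K" for r
  proof -
    from that obtain S where S: "S \<in> K" "Cusp r \<in> S" by blast
    then have "ext_upper_open S" using K by blast
    with S obtain e where "e > 0" "\<forall>z\<in>ball (Complex (of_rat r) e) e. Pt z \<in> S"
      unfolding ext_upper_open_def by metis
    with S show ?thesis by blast
  qed
  moreover have "\<Union>K \<subseteq> ext_upper_points"
    using K by (auto simp: ext_upper_open_def)
  ultimately show "ext_upper_open (\<Union>K)"
    unfolding ext_upper_open_def by (intro conjI allI impI)
qed

lemma openin_ext_upper_top: "openin ext_upper_top = ext_upper_open"
  by (simp add: ext_upper_top_def istopology_ext_upper_open)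

lemma topspace_ext_upper_top: "topspace ext_upper_top = ext_upper_points"
proof -
  have "open {z. Im z > 0 \<and> Pt z \<in> ext_upper_points}"
    by (auto simp: ext_upper_points_def open_halfspace_Im_gt cong: conj_cong)
  moreover have "Pt z \<in> ext_upper_points" if "e > 0" "z \<in> ball (Complex (of_rat r) e) e" for e r z
  proof -
    have "\<bar>Im (Complex (of_rat r) e - z)\<bar> < e"
      using that abs_Im_le_cmod[of "Complex (of_rat r) e - z"] by (simp add: dist_norm)
    then show ?thesis by (auto simp: ext_upper_points_def)
  qed
  moreover have "\<exists>Y>0. \<forall>z. Im z > Y \<longrightarrow> Pt z \<in> ext_upper_points"
    by (intro exI[of _ 1]) (auto simp: ext_upper_points_def)
  moreover have "\<exists>e>0. \<forall>z\<in>ball (Complex (of_rat r) e) e. Pt z \<in> ext_upper_points" for r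
    using calculation(2)[of 1 _ r] by (intro exI[of _ 1]) simp
  ultimately have "ext_upper_open ext_upper_points"
    unfolding ext_upper_open_def by (intro conjI allI impI order_refl)
  moreover have "S \<subseteq> ext_upper_points" if "ext_upper_open S" for S
    using that by (simp add: ext_upper_open_def)
  ultimately show ?thesis
    unfolding topspace_def openin_ext_upper_top by (intro equalityI Union_least Union_upper) auto
qed

lemma istopology_X0_open: "istopology (X0_open N)"
  unfolding istopology_def
proof (intro conjI allI impI)
  fix S T assume "X0_open N S" "X0_open N T"
  moreover have "{p \<in> ext_upper_points. orbit0 N p \<in> S \<inter> T} =
      {p \<in> ext_upper_points. orbit0 N p \<in> S} \<inter> {p \<in> ext_upper_points. orbit0 N p \<in> T}"
    by auto
  ultimately show "X0_open N (S \<inter> T)"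
    unfolding X0_open_def by (simp add: openin_Int le_infI1)
next
  fix K assume K: "\<forall>S\<in>K. X0_open N S"
  have eq: "{p \<in> ext_upper_points. orbit0 N p \<in> \<Union>K} =
      (\<Union>S\<in>K. {p \<in> ext_upper_points. orbit0 N p \<in> S})"
    by auto
  have "openin ext_upper_top {p \<in> ext_upper_points. orbit0 N p \<in> \<Union>K}"
    unfolding eq using K by (intro openin_Union) (auto simp: X0_open_def)
  moreover have "\<Union>K \<subseteq> orbit0 N ` ext_upper_points"
    using K by (auto simp: X0_open_def)
  ultimately show "X0_open N (\<Union>K)"
    unfolding X0_open_def by (rule conjI[rotated])
qed

lemma openin_X0_top: "openin (X0_top N) = X0_open N"
  by (simp add: X0_top_def istopology_X0_open)

lemma topspace_X0_top: "topspace (X0_top N) = orbit0 N ` ext_upper_points"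
proof -
  have "{p \<in> ext_upper_points. orbit0 N p \<in> orbit0 N ` ext_upper_points} = ext_upper_points"
    by auto
  then have "X0_open N (orbit0 N ` ext_upper_points)"
    unfolding X0_open_def by (metis openin_topspace order_refl topspace_ext_upper_top)
  then show ?thesis
    unfolding topspace_def openin_X0_top
    by (intro equalityI Union_least Union_upper) (auto simp: X0_open_def)
qed

section \<open>Integrating \<open>f(q) dq/q = 2 pi i f(z) dz\<close> over homology classes\<close>

text \<open>\<open>F\<close> is a holomorphic function on the open subset \<open>U\<close> of the Riemann surface \<open>X_0(N)\<close> with
  \<open>dF = f(q) dq/q\<close>; at the cusps continuity suffices because singularities there are removable.\<close>

definition local_primitive ::
    "nat \<Rightarrow> (complex \<Rightarrow> complex) \<Rightarrow> ext_upper set set \<Rightarrow> (ext_upper set \<Rightarrow> complex) \<Rightarrow> bool" where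
  "local_primitive N f U F \<longleftrightarrow>
     openin (X0_top N) U \<and>
     continuous_map (subtopology (X0_top N) U) euclidean F \<and>
     (\<forall>z. Im z > 0 \<and> orbit0 N (Pt z) \<in> U \<longrightarrow>
        ((\<lambda>w. F (orbit0 N (Pt w))) has_field_derivative 2 * of_real pi * \<i> * f z) (at z))"

text \<open>The integral of a closed form along a merely continuous path: the increment of a
  primitive along the path.\<close>

definition has_path_integral ::
    "nat \<Rightarrow> (complex \<Rightarrow> complex) \<Rightarrow> (real \<Rightarrow> ext_upper set) \<Rightarrow> complex \<Rightarrow> bool" where
  "has_path_integral N f p I \<longleftrightarrow>
     (\<exists>\<phi>. I = \<phi> 1 - \<phi> 0 \<and>
       (\<forall>t\<in>{0..1::real}. \<exists>U F. local_primitive N f U F \<and> p t \<in> U \<and>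
         (\<forall>\<^sub>F s in at t within {0..1}. p s \<in> U \<and> \<phi> s - \<phi> t = F (p s) - F (p t))))"

definition simplex_path :: "((nat \<Rightarrow> real) \<Rightarrow> 'a) \<Rightarrow> real \<Rightarrow> 'a" where
  "simplex_path \<sigma> t = \<sigma> (\<lambda>i. if i = 0 then 1 - t else if i = 1 then t else 0)"

definition has_chain_integral ::
    "nat \<Rightarrow> (complex \<Rightarrow> complex) \<Rightarrow> ext_upper set chain \<Rightarrow> complex \<Rightarrow> bool" where
  "has_chain_integral N f c I \<longleftrightarrow>
     (\<exists>J. (\<forall>\<sigma>\<in>Poly_Mapping.keys c. has_path_integral N f (simplex_path \<sigma>) (J \<sigma>)) \<and>
          I = (\<Sum>\<sigma>\<in>Poly_Mapping.keys c. of_int (Poly_Mapping.lookup c \<sigma>) * J \<sigma>))"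

text \<open>Elements of \<open>homology_group\<close> are classes of cycles, regarded as sets.\<close>

definition period_lattice :: "nat \<Rightarrow> (complex \<Rightarrow> complex) \<Rightarrow> complex set" where
  "period_lattice N f =
     {I. \<exists>\<gamma>\<in>carrier (homology_group 1 (X0_top N)). \<exists>c\<in>\<gamma>. has_chain_integral N f c I}"

definition rectangular_lattice :: "real \<Rightarrow> real \<Rightarrow> complex set" where
  "rectangular_lattice \<Omega>p \<Omega>m =
     {of_int k * of_real \<Omega>p + of_int l * (\<i> * of_real \<Omega>m) | k l. True}"

section \<open>Elliptic curves and modular parametrizations\<close>

record weierstrass =
  wa1 :: int
  wa2 :: int
  wa3 :: int
  wa4 :: int
  wa6 :: int

definition wdisc :: "weierstrass \<Rightarrow> int" where
  "wdisc E =
    (let b2 = wa1 E ^ 2 + 4 * wa2 E;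
         b4 = 2 * wa4 E + wa1 E * wa3 E;
         b6 = wa3 E ^ 2 + 4 * wa6 E;
         b8 = wa1 E ^ 2 * wa6 E + 4 * wa2 E * wa6 E - wa1 E * wa3 E * wa4 E
              + wa2 E * wa3 E ^ 2 - wa4 E ^ 2
     in - (b2 ^ 2) * b8 - 8 * b4 ^ 3 - 27 * b6 ^ 2 + 9 * b2 * b4 * b6)"

text \<open>\<open>E'\<close> arises from \<open>E\<close> by \<open>x = u^2 x' + r\<close>, \<open>y = u^3 y' + s u^2 x' + t\<close> with rational
  \<open>u, r, s, t\<close>.\<close>

definition weierstrass_iso :: "weierstrass \<Rightarrow> weierstrass \<Rightarrow> bool" where
  "weierstrass_iso E E' \<longleftrightarrow>
    (\<exists>u r s t :: rat. u \<noteq> 0 \<and>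
      u * of_int (wa1 E') = of_int (wa1 E) + 2 * s \<and>
      u ^ 2 * of_int (wa2 E') = of_int (wa2 E) - s * of_int (wa1 E) + 3 * r - s ^ 2 \<and>
      u ^ 3 * of_int (wa3 E') = of_int (wa3 E) + r * of_int (wa1 E) + 2 * t \<and>
      u ^ 4 * of_int (wa4 E') = of_int (wa4 E) - s * of_int (wa3 E) + 2 * r * of_int (wa2 E)
         - (t + r * s) * of_int (wa1 E) + 3 * r ^ 2 - 2 * s * t \<and>
      u ^ 6 * of_int (wa6 E') = of_int (wa6 E) + r * of_int (wa4 E) + r ^ 2 * of_int (wa2 E) + r ^ 3
         - t * of_int (wa3 E) - t ^ 2 - r * t * of_int (wa1 E))"

definition global_minimal_model :: "weierstrass \<Rightarrow> bool" where
  "global_minimal_model E \<longleftrightarrow>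
     wdisc E \<noteq> 0 \<and> (\<forall>E'. weierstrass_iso E E' \<longrightarrow> \<bar>wdisc E\<bar> \<le> \<bar>wdisc E'\<bar>)"

definition affine_points :: "weierstrass \<Rightarrow> (complex \<times> complex) set" where
  "affine_points E =
     {(x, y). y ^ 2 + of_int (wa1 E) * x * y + of_int (wa3 E) * y
            = x ^ 3 + of_int (wa2 E) * x ^ 2 + of_int (wa4 E) * x + of_int (wa6 E)}"

text \<open>\<open>E(C)\<close> is compact Hausdorff, hence the one-point compactification of its affine part; the
  point at infinity is \<open>None\<close>.\<close>

definition curve_top :: "weierstrass \<Rightarrow> (complex \<times> complex) option topology" where
  "curve_top E = Alexandroff_compactification (subtopology euclidean (affine_points E))"

type_synonym parametrization = "ext_upper set \<Rightarrow> (complex \<times> complex) option"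

definition x_pull :: "nat \<Rightarrow> parametrization \<Rightarrow> complex \<Rightarrow> complex" where
  "x_pull N \<Phi> z = fst (the (\<Phi> (orbit0 N (Pt z))))"

definition y_pull :: "nat \<Rightarrow> parametrization \<Rightarrow> complex \<Rightarrow> complex" where
  "y_pull N \<Phi> z = snd (the (\<Phi> (orbit0 N (Pt z))))"

text \<open>A nonconstant morphism from \<open>X_0(N)\<close> to \<open>E\<close> over the rationals, sending the cusp at infinity to
  the origin. A continuous map whose coordinate functions are holomorphic wherever they are finite
  and away from the cusps is holomorphic. A morphism is defined over the rationals iff the
  \<open>q\<close>-expansions of its coordinate functions are rational, the function field of the canonical model
  being the field of modular functions with rational \<open>q\<close>-expansion.\<close>

definition modular_parametrization :: "nat \<Rightarrow> weierstrass \<Rightarrow> parametrization \<Rightarrow> bool" where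
  "modular_parametrization N E \<Phi> \<longleftrightarrow>
     continuous_map (X0_top N) (curve_top E) \<Phi> \<and>
     \<Phi> (orbit0 N Cusp_inf) = None \<and>
     (\<exists>P\<in>topspace (X0_top N). \<Phi> P \<noteq> None) \<and>
     (\<forall>z. Im z > 0 \<and> \<Phi> (orbit0 N (Pt z)) \<noteq> None \<longrightarrow>
        x_pull N \<Phi> field_differentiable at z \<and> y_pull N \<Phi> field_differentiable at z) \<and>
     (\<exists>(k::nat) (b::nat \<Rightarrow> rat) (c::nat \<Rightarrow> rat). \<forall>\<^sub>F z in filtercomap Im at_top.
        \<Phi> (orbit0 N (Pt z)) \<noteq> None \<and>
        (\<lambda>n. of_rat (b n) * exp (2 * of_real pi * \<i> * of_int (int n - int k) * z)) sums x_pull N \<Phi> z \<and>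
        (\<lambda>n. of_rat (c n) * exp (2 * of_real pi * \<i> * of_int (int n - int k) * z)) sums y_pull N \<Phi> z)"

text \<open>Optimality, i.e. connectedness of the kernel of \<open>J_0(N) \<rightarrow> E\<close>, or that \<open>\<Phi>\<close> does not factor
  through a nontrivial isogeny, in its standard homological form.\<close>

definition optimal_parametrization :: "nat \<Rightarrow> weierstrass \<Rightarrow> parametrization \<Rightarrow> bool" where
  "optimal_parametrization N E \<Phi> \<longleftrightarrow>
     modular_parametrization N E \<Phi> \<and>
     hom_induced 1 (X0_top N) {} (curve_top E) {} \<Phi> ` carrier (homology_group 1 (X0_top N))
       = carrier (homology_group 1 (curve_top E))"

text \<open>The pullback of \<open>dx / (2 y + a_1 x + a_3)\<close> is \<open>2 pi i f(z) dz\<close>. Together with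
  \<open>modular_parametrization\<close> this places \<open>E\<close> in the isogeny class attached to \<open>f\<close>.\<close>

definition manin_constant_one ::
    "nat \<Rightarrow> (complex \<Rightarrow> complex) \<Rightarrow> weierstrass \<Rightarrow> parametrization \<Rightarrow> bool" where
  "manin_constant_one N f E \<Phi> \<longleftrightarrow>
     (\<forall>z. Im z > 0 \<and> \<Phi> (orbit0 N (Pt z)) \<noteq> None \<longrightarrow>
        deriv (x_pull N \<Phi>) z =
          2 * of_real pi * \<i> * f z *
          (2 * y_pull N \<Phi> z + of_int (wa1 E) * x_pull N \<Phi> z + of_int (wa3 E)))"

section \<open>Twisted L-values and 2-adic valuations\<close>

definition quad_char :: "nat \<Rightarrow> int \<Rightarrow> int" where
  "quad_char d k = (\<Prod>q\<in>prime_factors d. Legendre k (int q))"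

text \<open>The analytic continuation of the Dirichlet series is entire, hence unique.\<close>

definition twisted_L :: "(nat \<Rightarrow> complex) \<Rightarrow> (int \<Rightarrow> int) \<Rightarrow> complex \<Rightarrow> complex" where
  "twisted_L a \<psi> =
     (THE L. L holomorphic_on UNIV \<and>
        (\<exists>\<sigma>. \<forall>s. Re s > \<sigma> \<longrightarrow>
           (\<lambda>n. of_int (\<psi> (int (Suc n))) * a (Suc n) * of_nat (Suc n) powr (- s)) sums L s))"

definition period_of_sign :: "real \<Rightarrow> real \<Rightarrow> int \<Rightarrow> real" where
  "period_of_sign \<Omega>p \<Omega>m \<epsilon> = (if \<epsilon> = 1 then \<Omega>p else \<Omega>m)"

definition L_ratio :: "(nat \<Rightarrow> complex) \<Rightarrow> real \<Rightarrow> real \<Rightarrow> nat \<Rightarrow> complex" where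
  "L_ratio a \<Omega>p \<Omega>m d =
     twisted_L a (quad_char d) 1 / of_real (period_of_sign \<Omega>p \<Omega>m (quad_char d (-1)))"

text \<open>A 2-adic valuation on the algebraic closure of the rationals inside \<open>complex\<close>; the values of \<open>v\<close>
  at transcendental numbers are irrelevant.\<close>

definition two_adic_valuation :: "(complex \<Rightarrow> ereal) \<Rightarrow> bool" where
  "two_adic_valuation v \<longleftrightarrow>
     v 2 = 1 \<and>
     (\<forall>x. algebraic x \<longrightarrow> v x \<noteq> -\<infinity> \<and> (v x = \<infinity> \<longleftrightarrow> x = 0)) \<and>
     (\<forall>x y. algebraic x \<and> algebraic y \<longrightarrow> v (x * y) = v x + v y \<and> min (v x) (v y) \<le> v (x + y))"

definition S_set :: "(complex \<Rightarrow> ereal) \<Rightarrow> nat \<Rightarrow> (nat \<Rightarrow> complex) \<Rightarrow> int \<Rightarrow> int \<Rightarrow> nat set" where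
  "S_set v N a \<epsilon> i =
     {q. prime q \<and> odd q \<and> \<not> q dvd N \<and> quad_char q (-1) = \<epsilon> \<and> v (a q - 2) = ereal (of_int i)}"

abbreviation S_plus where "S_plus v N a i \<equiv> S_set v N a 1 i"
abbreviation S_minus where "S_minus v N a i \<equiv> S_set v N a (-1) i"

definition S_all :: "(complex \<Rightarrow> ereal) \<Rightarrow> nat \<Rightarrow> (nat \<Rightarrow> complex) \<Rightarrow> int \<Rightarrow> nat set" where
  "S_all v N a i = S_plus v N a i \<union> S_minus v N a i"

definition v_min :: "(complex \<Rightarrow> ereal) \<Rightarrow> (nat \<Rightarrow> complex) \<Rightarrow> nat \<Rightarrow> ereal" where
  "v_min v a m = Min ((\<lambda>q. v (a q - 2)) ` prime_factors m)"

text \<open>The values \<open>a q - 2\<close> being integers, \<open>v_min\<close> is 0 or at least 1.\<close>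

definition w_ind :: "(complex \<Rightarrow> ereal) \<Rightarrow> (nat \<Rightarrow> complex) \<Rightarrow> nat \<Rightarrow> ereal" where
  "w_ind v a m = (if v_min v a m \<ge> 1 then 1 else 0)"

definition kronecker :: "ereal \<Rightarrow> ereal \<Rightarrow> ereal" where
  "kronecker i j = (if i = j then 1 else 0)"

end

theory Submission
  imports Defs
begin

text \<open>
  Let \<open>G\<close> be the primitive of \<open>2 \<pi> i f(z) dz\<close> vanishing at \<open>i\<infinity>\<close>, and write \<open>G(x)\<close> also for its vertical
  boundary value at a rational \<open>x\<close>. By the Mellin transform and Gauss sums,
  \<open>L(f, \<chi>\<^sub>m, 1) = \<tau>\<inverse> \<Sum> \<chi>\<^sub>m(k) G(k/m)\<close>, where \<open>\<tau>\<^sup>2 = \<plusminus> m\<close> has valuation 0. If \<open>k\<close> and \<open>N\<close> are coprime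
  to \<open>m\<close>, then \<open>k/m\<close> is \<open>\<Gamma>\<^sub>0(N)\<close>-equivalent to 0, so \<open>G(k/m) - G(0)\<close> is a period, and for a rectangular
  lattice its real and imaginary parts are integral multiples of \<open>\<Omega>\<^sup>+\<close> and \<open>\<Omega>\<^sup>-\<close>.

  Let \<open>T\<^sub>d = \<Sum> \<chi>\<^sub>d(k) G(k/d)\<close>. The Hecke relations give
  \<open>\<Sum> \<chi>\<^sub>d(k) G(k/m) = \<Prod> (a\<^sub>q - 2 \<chi>\<^sub>d(q)) T\<^sub>d\<close>, where \<open>k\<close> runs over the units modulo \<open>m\<close> and \<open>q\<close> over the primes
  dividing \<open>m/d\<close>. Summing over \<open>d\<close> dividing \<open>m\<close> and using that \<open>\<Sum> \<chi>\<^sub>d(k) = \<Prod> (1 + \<chi>\<^sub>q(k))\<close> is 0 or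
  \<open>2\<^sup>r\<close> expresses \<open>T\<^sub>m\<close> through the \<open>T\<^sub>d\<close> with \<open>d < m\<close> up to a multiple of \<open>2\<^sup>r\<close>, or of \<open>2 \<cdot> 2\<^sup>r\<close> when all
  \<open>\<chi>\<^sub>q\<close> are even, because then \<open>k\<close> and \<open>-k\<close> contribute equally. The bounds follow by induction on
  the number of primes; equality holds because the sum has an odd number \<open>2\<^sup>r - 1\<close> of rational terms
  of the same valuation.
\<close>

section \<open>Periodic holomorphic functions on the upper half plane\<close>


text \<open>A valuation argument needs algebraic numbers, and \<open>v\<close> is arbitrary at
  transcendental ones, so the rationality of L(f,1)/Omega^+ has to be proved first. The Hecke
  relation at the cusp 0 puts (a_q - q - 1) L(f,1)/Omega^+ in Z for every prime q not dividing N,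
  and a prime with a_q different from q + 1 exists because a_n = O(n). T_d is real or purely
  imaginary according to the sign of chi_d(-1), so real and imaginary parts split the sum over
  divisors into two recursions; L(f,1) enters only the even one. The factors a_q - 2 chi_d(q) equal
  a_q - 2 or (a_q - 2) + 4. They keep every lower bound up to 2 for the valuation of a_q - 2, and
  its exact value if that is below 2. The topology of X_0(N) enters through one fact: a segment
  between equivalent points projects to a closed singular simplex, whose integral is a difference of
  two values of G.\<close>

abbreviation upper_half :: "complex set" where
  "upper_half \<equiv> {z. Im z > 0}"

abbreviation im_top :: "complex filter" where
  "im_top \<equiv> filtercomap Im at_top"

lemma im_top_nontrivial [simp]: "im_top \<noteq> bot"
  by (rule filtercomap_neq_bot_surj) (simp, rule surjI[of Im "Complex 0"], simp)

lemma eventually_im_top: "eventually P im_top \<longleftrightarrow> (\<exists>Y. \<forall>z. Im z \<ge> Y \<longrightarrow> P z)"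
  by (rule eventually_filtercomap_at_top_linorder)

lemma eventually_im_top_gt: "eventually (\<lambda>z. Im z > Y) im_top"
  unfolding eventually_im_top by (intro exI[of _ "Y + 1"]) auto

lemma filterlim_im_top_scale:
  assumes "k > 0" "\<And>z. Im z > 0 \<Longrightarrow> Im (g z) = k * Im z"
  shows "filterlim g im_top im_top"
  unfolding filterlim_filtercomap_iff
proof -
  have "filterlim (\<lambda>z. k * Im z) at_top im_top"
    by (intro filterlim_tendsto_pos_mult_at_top[OF tendsto_const] filterlim_filtercomap assms)
  moreover have ev: "eventually (\<lambda>z. k * Im z = (Im \<circ> g) z) im_top"
    by (rule eventually_mono[OF eventually_im_top_gt[of 0]]) (simp add: assms)
  ultimately show "filterlim (Im \<circ> g) at_top im_top"
    by (simp only: filterlim_cong[OF refl refl ev])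
qed

lemma open_upper_half: "open upper_half"
  by (simp add: open_halfspace_Im_gt)

lemma convex_upper_half: "convex upper_half"
  by (simp add: convex_halfspace_Im_gt)

lemma upper_half_deriv_eq:
  assumes "\<And>z. Im z > 0 \<Longrightarrow> (F has_field_derivative f z) (at z)"
    and "\<And>z. Im z > 0 \<Longrightarrow> (G has_field_derivative f z) (at z)"
  shows "\<exists>c. \<forall>z. Im z > 0 \<longrightarrow> F z = G z + c"
proof -
  have "\<exists>c. \<forall>z\<in>upper_half. F z - G z = c"
  proof (rule has_field_derivative_zero_constant[OF convex_upper_half])
    fix z :: complex assume "z \<in> upper_half"
    then have "((\<lambda>z. F z - G z) has_field_derivative f z - f z) (at z)"
      by (intro DERIV_diff assms) auto
    then show "((\<lambda>z. F z - G z) has_field_derivative 0) (at z within upper_half)"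
      by (simp add: has_field_derivative_at_within)
  qed
  then show ?thesis by (auto simp: algebra_simps)
qed

text \<open>The symmetries and the Hecke relation of the Eichler integral come from this: both sides
  have the same derivative and the same limit at i infinity.\<close>

lemma upper_half_deriv_unique:
  assumes "\<And>z. Im z > 0 \<Longrightarrow> (F has_field_derivative f z) (at z)"
    and "\<And>z. Im z > 0 \<Longrightarrow> (G has_field_derivative f z) (at z)"
    and "(F \<longlongrightarrow> l) im_top" "(G \<longlongrightarrow> l) im_top" "Im z > 0"
  shows "F z = G z"
proof -
  obtain c where c: "\<And>z. Im z > 0 \<Longrightarrow> F z = G z + c"
    using upper_half_deriv_eq[OF assms(1,2)] by blast
  have "((\<lambda>z. F z - G z) \<longlongrightarrow> l - l) im_top"
    by (intro tendsto_diff assms)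
  moreover have ev: "eventually (\<lambda>z. F z - G z = c) im_top"
    by (rule eventually_mono[OF eventually_im_top_gt[of 0]]) (simp add: c)
  ultimately have "((\<lambda>z::complex. c) \<longlongrightarrow> 0) im_top"
    by (simp add: filterlim_cong[OF refl refl ev])
  then have "c = 0" by (simp add: tendsto_const_iff)
  with c assms(5) show ?thesis by simp
qed

text \<open>The local coordinate at a cusp of width \<open>h\<close>.\<close>

definition qq :: "real \<Rightarrow> complex \<Rightarrow> complex" where
  "qq h z = exp (2 * of_real pi * \<i> * z / of_real h)"

lemma norm_qq: "h > 0 \<Longrightarrow> norm (qq h z) = exp (- 2 * pi * Im z / h)"
  by (simp add: qq_def)

lemma qq_nz [simp]: "qq h z \<noteq> 0"
  by (simp add: qq_def)

lemma qq_in_ball: "h > 0 \<Longrightarrow> Im z > 0 \<Longrightarrow> qq h z \<in> ball 0 1"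
  by (simp add: norm_qq)

lemma has_field_derivative_qq:
  "h > 0 \<Longrightarrow> (qq h has_field_derivative qq h z * (2 * of_real pi * \<i> / of_real h)) (at z)"
  unfolding qq_def by (auto intro!: derivative_eq_intros)

lemma qq_tendsto_0: "h > 0 \<Longrightarrow> (qq h \<longlongrightarrow> 0) im_top"
proof (rule tendsto_norm_zero_cancel)
  assume h: "h > 0"
  have "((\<lambda>x. exp (- 2 * pi * x / h)) \<longlongrightarrow> 0) at_top"
    using h by real_asymp
  then have "((\<lambda>z. exp (- 2 * pi * Im z / h)) \<longlongrightarrow> 0) im_top"
    by (rule filterlim_filtercomapI)
  then show "((\<lambda>z. norm (qq h z)) \<longlongrightarrow> 0) im_top"
    using h by (simp add: norm_qq)
qed

lemma periodic_of_int:
  assumes per: "\<And>z. Im z > 0 \<Longrightarrow> g (z + of_real h) = g z" and "Im z > 0"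
  shows "g (z + of_int k * of_real h) = g z"
proof -
  have n: "g (w + of_nat n * of_real h) = g w" if "Im w > 0" for n w
  proof (induction n)
    case (Suc n)
    have "g (w + of_nat (Suc n) * of_real h) = g ((w + of_nat n * of_real h) + of_real h)"
      by (simp add: algebra_simps)
    also have "\<dots> = g (w + of_nat n * of_real h)"
      using that by (intro per) simp
    finally show ?case using Suc by simp
  qed simp
  show ?thesis
  proof (cases "k \<ge> 0")
    case True
    then show ?thesis using n[OF assms(2), of "nat k"] by simp
  next
    case False
    then have "g (z + of_int k * of_real h + of_nat (nat (-k)) * of_real h) = g (z + of_int k * of_real h)"
      using assms(2) by (intro n) simp
    moreover have "z + of_int k * of_real h + of_nat (nat (-k)) * of_real h = z"
      using False by simp
    ultimately show ?thesis by simp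
  qed
qed

text \<open>Periodicity lets \<open>g\<close> descend to the punctured unit disc through the
  logarithm. The limit 0 at i infinity makes the origin a removable singularity with value 0, so one
  factor of the coordinate can be split off.\<close>

lemma periodic_qq:
  assumes hol: "g holomorphic_on upper_half" and h: "h > 0"
    and per: "\<And>z. Im z > 0 \<Longrightarrow> g (z + of_real h) = g z"
    and lim: "(g \<longlongrightarrow> 0) im_top"
  shows "\<exists>\<psi>. \<psi> holomorphic_on ball 0 1 \<and> (\<forall>z. Im z > 0 \<longrightarrow> g z = qq h z * \<psi> (qq h z))"
proof -
  \<comment> \<open>Chosen so that \<open>qq h (lg u) = exp u\<close>.\<close>
  define lg where "lg u = of_real h * u / (2 * of_real pi * \<i>)" for u :: complex
  define \<phi> where "\<phi> w = g (lg (Ln w))" for w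
  have im: "Im (lg u) = - h * Re u / (2 * pi)" for u
    unfolding lg_def by (simp add: Im_divide field_simps power2_eq_square)
  have imp: "Im (lg u) > 0" if "norm (exp u) < 1" for u
    using that h by (simp add: im divide_neg_pos mult_pos_neg)
  have \<phi>_exp: "\<phi> (exp u) = g (lg u)" if "norm (exp u) < 1" for u
  proof -
    obtain k where k: "Ln (exp u) = u + of_int (2 * k) * (of_real pi * \<i>)"
      using exp_eq[of "Ln (exp u)" u] by auto
    have "lg (Ln (exp u)) = lg u + of_int k * of_real h"
      unfolding k lg_def by (simp add: field_simps)
    then show ?thesis
      unfolding \<phi>_def using periodic_of_int[of g h, OF per imp[OF that]] by simp
  qed
  have "\<phi> holomorphic_on ball 0 1 - {0}"
    unfolding holomorphic_on_def
  proof
    fix w0 :: complex assume w0: "w0 \<in> ball 0 1 - {0}"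
    \<comment> \<open>\<open>Ln\<close> jumps on the negative axis. On a disc about
      \<open>w0\<close> that avoids the origin, \<open>Ln (w / w0) + Ln w0\<close> is a holomorphic
      logarithm, and by periodicity it leads to the same value of \<open>\<phi>\<close>.\<close>
    define B where "B = ball w0 (norm w0) \<inter> ball 0 1"
    have B: "open B" "w0 \<in> B" using w0 by (auto simp: B_def)
    have pos: "w / w0 \<notin> \<real>\<^sub>\<le>\<^sub>0" "w \<noteq> 0" if "w \<in> B" for w
    proof -
      have "norm (w0 - w) < norm w0" using that by (simp add: B_def dist_norm)
      then have "norm (1 - w / w0) < 1"
        using w0 by (metis DiffD2 diff_divide_distrib div_self divide_less_eq_1_pos insertI1 norm_divide zero_less_norm_iff)
      then have "\<bar>Re (1 - w / w0)\<bar> < 1"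
        using abs_Re_le_cmod[of "1 - w / w0"] by linarith
      then show "w / w0 \<notin> \<real>\<^sub>\<le>\<^sub>0" by (auto simp: complex_nonpos_Reals_iff)
      then show "w \<noteq> 0" by auto
    qed
    define l where "l w = Ln (w / w0) + Ln w0" for w
    have el: "exp (l w) = w" if "w \<in> B" for w
      using pos[OF that] w0 by (simp add: l_def exp_add)
    have "l holomorphic_on B"
      unfolding l_def using pos w0 by (intro holomorphic_intros) auto
    then have "(g \<circ> (\<lambda>w. lg (l w))) holomorphic_on B"
    proof (intro holomorphic_on_compose_gen[OF _ hol])
      show "(\<lambda>w. lg (l w)) holomorphic_on B"
        unfolding lg_def using \<open>l holomorphic_on B\<close> by (intro holomorphic_intros) auto
      show "(\<lambda>w. lg (l w)) ` B \<subseteq> upper_half"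
      proof safe
        fix w assume "w \<in> B"
        then have "norm (exp (l w)) < 1" using el[of w] by (simp add: B_def)
        then show "Im (lg (l w)) > 0" by (rule imp)
      qed
    qed
    moreover have "(g \<circ> (\<lambda>w. lg (l w))) w = \<phi> w" if "w \<in> B" for w
      using \<phi>_exp[of "l w"] el[OF that] that by (simp add: B_def)
    ultimately have "\<phi> holomorphic_on B" by (rule holomorphic_transform)
    then show "\<phi> field_differentiable at w0 within ball 0 1 - {0}"
      using field_differentiable_at_within[OF holomorphic_on_imp_differentiable_at[OF _ B]] by simp
  qed
  then have hol2: "(\<lambda>w. \<phi> w / w) holomorphic_on ball 0 1 - {0}"
    by (intro holomorphic_intros) auto
  have "((\<lambda>w. g (lg (Ln w))) \<longlongrightarrow> 0) (at 0)"
  proof (rule filterlim_compose[OF lim])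
    have "filterlim (\<lambda>w. - h * ln (norm w) / (2 * pi)) at_top (at (0::complex))"
    proof -
      have "filterlim (\<lambda>x. - h * ln x / (2 * pi)) at_top (at_right 0)"
        using h by real_asymp
      moreover have "filterlim norm (at_right 0) (at (0::complex))"
        unfolding filterlim_at by (auto intro!: tendsto_norm_zero simp: eventually_at_filter)
      ultimately show ?thesis by (rule filterlim_compose)
    qed
    moreover have ev: "eventually (\<lambda>w. - h * ln (norm w) / (2 * pi) = (Im \<circ> (\<lambda>w. lg (Ln w))) w) (at 0)"
      by (auto simp: eventually_at_filter im)
    ultimately show "filterlim (\<lambda>w. lg (Ln w)) im_top (at 0)"
      unfolding filterlim_filtercomap_iff by (simp only: filterlim_cong[OF refl refl ev])
  qed
  \<comment> \<open>This is the condition for removing the singularity of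
    \<open>\<phi> w / w\<close>; the extension is the quotient \<open>\<psi>\<close>.\<close>
  then have "((\<lambda>w. (w - 0) * (\<phi> w / w)) \<longlongrightarrow> 0) (at 0)"
    unfolding \<phi>_def by (rule Lim_transform_eventually) (auto simp: eventually_at_filter)
  then obtain \<psi> where \<psi>: "\<psi> holomorphic_on ball 0 1" "\<And>w. w \<in> ball 0 1 - {0} \<Longrightarrow> \<psi> w = \<phi> w / w"
    using holomorphic_on_extend_lim[OF hol2] by auto
  show ?thesis
  proof (intro exI conjI allI impI)
    show "\<psi> holomorphic_on ball 0 1" by fact
    fix z :: complex assume z: "Im z > 0"
    have "qq h z \<in> ball 0 1 - {0}" using qq_in_ball[OF h z] by simp
    moreover have "\<phi> (qq h z) = g z"
    proof -
      have "norm (exp (2 * of_real pi * \<i> * z / of_real h)) < 1"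
        using qq_in_ball[OF h z] by (simp add: qq_def)
      from \<phi>_exp[OF this] h show ?thesis by (simp add: qq_def lg_def)
    qed
    ultimately show "g z = qq h z * \<psi> (qq h z)" by (simp add: \<psi>)
  qed
qed

text \<open>The factor \<open>qq h z\<close> supplies the exponential decay, and
  \<open>\<psi>\<close> is bounded on the compact disc into which the half plane Im z >= y is
  mapped.\<close>

lemma periodic_decay:
  assumes hol: "g holomorphic_on upper_half" and h: "h > 0"
    and per: "\<And>z. Im z > 0 \<Longrightarrow> g (z + of_real h) = g z"
    and lim: "(g \<longlongrightarrow> 0) im_top" and y: "y > 0"
  shows "\<exists>C>0. \<forall>z. Im z \<ge> y \<longrightarrow> norm (g z) \<le> C * exp (- 2 * pi * Im z / h)"
proof -
  from periodic_qq[of g h, OF hol h per lim] obtain \<psi>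
    where *: "\<psi> holomorphic_on ball 0 1 \<and> (\<forall>z. Im z > 0 \<longrightarrow> g z = qq h z * \<psi> (qq h z))" ..
  have \<psi>: "\<psi> holomorphic_on ball 0 1" "Im z > 0 \<Longrightarrow> g z = qq h z * \<psi> (qq h z)" for z
    using * by auto
  define r where "r = exp (- 2 * pi * y / h)"
  have r: "r < 1" using h y by (simp add: r_def)
  have "continuous_on (cball 0 r) \<psi>"
    by (rule holomorphic_on_imp_continuous_on[OF holomorphic_on_subset[OF \<psi>(1)]]) (use r in auto)
  then have "compact (\<psi> ` cball 0 r)" by (intro compact_continuous_image) auto
  then obtain C where C: "C > 0" "\<forall>x\<in>\<psi> ` cball 0 r. norm x \<le> C"
    using compact_imp_bounded bounded_pos by metis
  show ?thesis
  proof (intro exI conjI allI impI)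
    show "C > 0" by fact
    fix z assume z: "Im z \<ge> y"
    have "- 2 * pi * Im z / h \<le> - 2 * pi * y / h"
      using z h by (simp add: field_simps)
    then have "qq h z \<in> cball 0 r" using h by (simp add: norm_qq r_def)
    then have "norm (g z) \<le> norm (qq h z) * C"
      using \<psi>(2)[of z] z y C(2) by (simp add: norm_mult mult_left_mono del: mem_cball)
    then show "norm (g z) \<le> C * exp (- 2 * pi * Im z / h)"
      using h by (simp add: norm_qq mult.commute)
  qed
qed

text \<open>The derivative of \<open>qq h\<close> is a multiple of \<open>qq h\<close>, so a
  primitive of \<open>\<psi>\<close> on the disc composed with \<open>qq h\<close> gives a primitive
  of \<open>g\<close>. Built in this way it has a limit at i infinity.\<close>

lemma periodic_primitive:
  assumes hol: "g holomorphic_on upper_half" and h: "h > 0"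
    and per: "\<And>z. Im z > 0 \<Longrightarrow> g (z + of_real h) = g z"
    and lim: "(g \<longlongrightarrow> 0) im_top"
  shows "\<exists>P. (\<forall>z. Im z > 0 \<longrightarrow> (P has_field_derivative 2 * of_real pi * \<i> * g z) (at z)) \<and>
    (P \<longlongrightarrow> 0) im_top"
proof -
  from periodic_qq[of g h, OF hol h per lim] obtain \<psi>
    where *: "\<psi> holomorphic_on ball 0 1 \<and> (\<forall>z. Im z > 0 \<longrightarrow> g z = qq h z * \<psi> (qq h z))" ..
  have \<psi>: "\<psi> holomorphic_on ball 0 1" "Im z > 0 \<Longrightarrow> g z = qq h z * \<psi> (qq h z)" for z
    using * by auto
  obtain \<Psi> where \<Psi>: "\<And>w. w \<in> ball 0 1 \<Longrightarrow> (\<Psi> has_field_derivative \<psi> w) (at w within ball 0 1)"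
    using holomorphic_convex_primitive'[OF convex_ball open_ball \<psi>(1)] by blast
  have \<Psi>': "(\<Psi> has_field_derivative \<psi> w) (at w)" if "w \<in> ball 0 1" for w
    using \<Psi>[OF that] that at_within_open[of w "ball 0 1"] by simp
  define P where "P z = of_real h * (\<Psi> (qq h z) - \<Psi> 0)" for z
  show ?thesis
  proof (intro exI conjI allI impI)
    fix z :: complex assume z: "Im z > 0"
    have "((\<lambda>z. \<Psi> (qq h z)) has_field_derivative \<psi> (qq h z) * (qq h z * (2 * of_real pi * \<i> / of_real h))) (at z)"
      by (rule DERIV_chain2[OF \<Psi>'[OF qq_in_ball[OF h z]] has_field_derivative_qq[OF h]])
    then have "(P has_field_derivative of_real h * (\<psi> (qq h z) * (qq h z * (2 * of_real pi * \<i> / of_real h)) - 0)) (at z)"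
      unfolding P_def by (intro DERIV_cmult DERIV_diff DERIV_const)
    moreover have "of_real h * (\<psi> (qq h z) * (qq h z * (2 * of_real pi * \<i> / of_real h)) - 0) = 2 * of_real pi * \<i> * g z"
      using h \<psi>(2)[OF z] by simp
    ultimately show "(P has_field_derivative 2 * of_real pi * \<i> * g z) (at z)" by simp
  next
    have "isCont \<Psi> 0" using \<Psi>'[of 0] DERIV_isCont by auto
    then have "((\<lambda>z. \<Psi> (qq h z)) \<longlongrightarrow> \<Psi> 0) im_top"
      by (rule isCont_tendsto_compose[OF _ qq_tendsto_0[OF h]])
    then have "((\<lambda>z. of_real h * (\<Psi> (qq h z) - \<Psi> 0)) \<longlongrightarrow> of_real h * (\<Psi> 0 - \<Psi> 0)) im_top"
      by (intro tendsto_intros)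
    then show "(P \<longlongrightarrow> 0) im_top" by (simp add: P_def[abs_def])
  qed
qed

section \<open>Moebius transformations and growth of cusp forms\<close>


definition mob :: "int \<Rightarrow> int \<Rightarrow> int \<Rightarrow> int \<Rightarrow> complex \<Rightarrow> complex" where
  "mob a b c d z = (of_int a * z + of_int b) / (of_int c * z + of_int d)"

definition mk_mat :: "int \<Rightarrow> int \<Rightarrow> int \<Rightarrow> int \<Rightarrow> int^2^2" where
  "mk_mat a b c d = vector [vector [a, b], vector [c, d]]"

lemma ent_mk_mat [simp]:
  "ent (mk_mat a b c d) 1 1 = a" "ent (mk_mat a b c d) 1 2 = b"
  "ent (mk_mat a b c d) 2 1 = c" "ent (mk_mat a b c d) 2 2 = d"
  by (simp_all add: mk_mat_def)

lemma SL2Z_iff: "A \<in> SL2Z \<longleftrightarrow> ent A 1 1 * ent A 2 2 - ent A 1 2 * ent A 2 1 = 1"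
  by (simp add: SL2Z_def det_2)

lemma act_eq_mob: "act A = mob (ent A 1 1) (ent A 1 2) (ent A 2 1) (ent A 2 2)"
  by (simp add: act_def mob_def moebius_def fun_eq_iff)

lemma mob_den_nz:
  assumes "a * d - b * c = 1" "Im z > 0"
  shows "of_int c * z + of_int d \<noteq> 0"
proof
  assume *: "of_int c * z + of_int d = 0"
  then have "Im (of_int c * z + of_int d) = 0" by simp
  with assms(2) have "c = 0" by simp
  with * assms(1) show False by simp
qed

lemma Im_mob:
  assumes "a * d - b * c = 1" "Im z > 0"
  shows "Im (mob a b c d z) = Im z / (cmod (of_int c * z + of_int d))\<^sup>2"
proof -
  have "Im (mob a b c d z) = (real_of_int (a * d - b * c) * Im z) / (cmod (of_int c * z + of_int d))\<^sup>2"
    unfolding mob_def Im_divide cmod_power2 by (simp add: algebra_simps)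
  then show ?thesis using assms(1) by simp
qed

lemma Im_mob_pos:
  assumes "a * d - b * c = 1" "Im z > 0"
  shows "Im (mob a b c d z) > 0"
  using mob_den_nz[OF assms] assms by (simp add: Im_mob)

lemma has_field_derivative_mob:
  assumes "a * d - b * c = 1" "Im z > 0"
  shows "(mob a b c d has_field_derivative 1 / (of_int c * z + of_int d)\<^sup>2) (at z)"
proof -
  have nz: "of_int c * z + of_int d \<noteq> 0" by (rule mob_den_nz[OF assms])
  have "(mob a b c d has_field_derivative
      (of_int a * (of_int c * z + of_int d) - (of_int a * z + of_int b) * of_int c) /
      ((of_int c * z + of_int d) * (of_int c * z + of_int d))) (at z)"
    unfolding mob_def using nz by (auto intro!: derivative_eq_intros)
  moreover have "of_int a * (of_int c * z + of_int d) - (of_int a * z + of_int b) * of_int c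
      = (of_int (a * d - b * c) :: complex)"
    by (simp add: algebra_simps)
  ultimately show ?thesis using assms(1) by (simp add: power2_eq_square)
qed

lemma mob_mob:
  assumes "a' * d' - b' * c' = 1" "Im z > 0"
  shows "mob a b c d (mob a' b' c' d' z) =
    mob (a * a' + b * c') (a * b' + b * d') (c * a' + d * c') (c * b' + d * d') z"
proof -
  have nz: "of_int c' * z + of_int d' \<noteq> 0" by (rule mob_den_nz[OF assms])
  have eq: "of_int x * mob a' b' c' d' z + of_int y =
      (of_int (x * a' + y * c') * z + of_int (x * b' + y * d')) / (of_int c' * z + of_int d')" for x y
    using nz by (simp add: mob_def field_simps)
  show ?thesis unfolding mob_def[of a b c d] eq using nz by (simp add: mob_def)
qed

lemma mob_1 [simp]: "mob 1 0 0 1 z = z"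
  by (simp add: mob_def)

lemma mob_inverse:
  assumes "a * d - b * c = 1" "Im z > 0"
  shows "mob d (- b) (- c) a (mob a b c d z) = z"
proof -
  have "d * a + - b * c = 1" "d * b + - b * d = 0" "- c * a + a * c = 0" "- c * b + a * d = 1"
    using assms(1) by (simp_all add: algebra_simps)
  then show ?thesis using mob_mob[OF assms] by simp
qed

lemma mob_den_mob:
  assumes "a' * d' - b' * c' = 1" "Im z > 0"
  shows "(of_int c * mob a' b' c' d' z + of_int d) * (of_int c' * z + of_int d') =
    of_int (c * a' + d * c') * z + of_int (c * b' + d * d')"
proof -
  have "mob a' b' c' d' z * (of_int c' * z + of_int d') = of_int a' * z + of_int b'"
    using mob_den_nz[OF assms] by (simp add: mob_def)
  moreover have "(of_int c * mob a' b' c' d' z + of_int d) * (of_int c' * z + of_int d') =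
    of_int c * (mob a' b' c' d' z * (of_int c' * z + of_int d')) + of_int d * (of_int c' * z + of_int d')"
    by (simp only: distrib_right mult.assoc)
  ultimately show ?thesis by (simp add: algebra_simps)
qed

text \<open>The vertical line over the cusp \<open>a / c\<close> is the image of the one over
  \<open>- d / c\<close>, with the height inverted up to a factor. Approaching the cusp thus becomes
  going up to i infinity.\<close>

lemma mob_vertical:
  assumes "a * d - b * c = 1" "c \<noteq> 0" "t > 0"
  shows "mob a b c d (Complex (- of_int d / of_int c) (1 / ((of_int c)\<^sup>2 * t))) = Complex (of_int a / of_int c) t"
proof -
  define w where "w = Complex (- of_int d / of_int c) (1 / ((of_int c)\<^sup>2 * t))"
  have cw: "of_int c * w + of_int d = \<i> / (c * t)"
    using assms by (simp add: w_def complex_eq_iff power2_eq_square)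
  have "of_int c * (of_int a * w + of_int b) = of_int a * (of_int c * w + of_int d) - of_int (a * d - b * c)"
    by (simp add: algebra_simps)
  also have "\<dots> = of_int a * (of_int c * w + of_int d) - 1" using assms(1) by simp
  finally have num: "of_int a * w + of_int b = (of_int a * (of_int c * w + of_int d) - 1) / of_int c"
    using assms(2) by (simp add: field_simps)
  have "mob a b c d w = (of_int a * (\<i> / (c * t)) - 1) / of_int c / (\<i> / (c * t))"
    unfolding mob_def num cw ..
  also have "\<dots> = of_int a / of_int c + \<i> * t"
    using assms(2,3) by (simp add: field_simps)
  also have "\<dots> = Complex (a / c) t"
    by (simp add: complex_eq_iff)
  finally show ?thesis by (simp add: w_def)
qed

locale cusp_form2 =
  fixes N :: nat and f :: "complex \<Rightarrow> complex"
  assumes N_pos: "N \<ge> 1" and cusp: "cusp_form N f"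
begin

lemma hol: "f holomorphic_on upper_half"
  using cusp by (simp add: cusp_form_def)

definition sl :: "int \<Rightarrow> int \<Rightarrow> int \<Rightarrow> int \<Rightarrow> complex \<Rightarrow> complex" where
  "sl a b c d z = f (mob a b c d z) / (of_int c * z + of_int d)\<^sup>2"

lemma slash2_mk: "slash2 f (mk_mat a b c d) = sl a b c d"
  by (simp add: slash2_def sl_def act_eq_mob fun_eq_iff)

lemma f_mob:
  assumes "a * d - b * c = 1" "int N dvd c" "Im z > 0"
  shows "f (mob a b c d z) = (of_int c * z + of_int d)\<^sup>2 * f z"
proof -
  have "mk_mat a b c d \<in> Gamma0 N"
    using assms by (simp add: Gamma0_def SL2Z_iff)
  then have "sl a b c d z = f z"
    using cusp assms(3) by (metis cusp_form_def slash2_mk)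
  then show ?thesis
    using mob_den_nz[OF assms(1,3)] by (simp add: sl_def field_simps)
qed

lemma sl_tendsto_0:
  assumes "a * d - b * c = 1"
  shows "(sl a b c d \<longlongrightarrow> 0) im_top"
proof -
  have "mk_mat a b c d \<in> SL2Z" using assms by (simp add: SL2Z_iff)
  then show ?thesis using cusp by (metis cusp_form_def slash2_mk)
qed

lemma sl_holomorphic:
  assumes "a * d - b * c = 1"
  shows "sl a b c d holomorphic_on upper_half"
proof -
  have "mob a b c d holomorphic_on upper_half"
    using has_field_derivative_mob[OF assms]
    by (auto simp: holomorphic_on_def field_differentiable_def intro: has_field_derivative_at_within)
  then have "(f \<circ> mob a b c d) holomorphic_on upper_half"
    by (rule holomorphic_on_compose_gen[OF _ hol]) (use Im_mob_pos[OF assms] in auto)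
  then have "(\<lambda>z. f (mob a b c d z)) holomorphic_on upper_half" by (simp add: o_def)
  then show ?thesis
    unfolding sl_def using mob_den_nz[OF assms] by (intro holomorphic_intros) auto
qed

text \<open>The quotient of two matrices of determinant 1 whose bottom rows agree modulo
  \<open>N\<close> lies in Gamma0(N), under which f is invariant. Hence only finitely many slashed
  forms occur, and translation by \<open>N\<close> fixes each of them.\<close>

lemma sl_cong:
  assumes 1: "a * d - b * c = 1" and 2: "a' * d' - b' * c' = 1"
    and cong: "[c = c'] (mod int N)" "[d = d'] (mod int N)" and z: "Im z > 0"
  shows "sl a b c d z = sl a' b' c' d' z"
proof -
  \<comment> \<open>The matrix (a b; c d) times the inverse of (a' b'; c' d').\<close>
  define A B C D where "A = a * d' - b * c'" "B = - a * b' + b * a'"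
    "C = c * d' - d * c'" "D = - c * b' + d * a'"
  note defs = A_B_C_D_def
  have det: "A * D - B * C = 1"
  proof -
    have "A * D - B * C = (a * d - b * c) * (a' * d' - b' * c')"
      by (simp add: defs algebra_simps)
    then show ?thesis using 1 2 by simp
  qed
  have "[c * d' - d * c' = c' * d - d * c'] (mod int N)"
    by (intro cong_diff cong_mult cong cong_refl cong_sym[OF cong(2)])
  then have dvd: "int N dvd C" by (simp add: defs cong_iff_dvd_diff algebra_simps)
  have e: "A * a' + B * c' = a" "A * b' + B * d' = b" "C * a' + D * c' = c" "C * b' + D * d' = d"
  proof -
    have "A * a' + B * c' = a * (a' * d' - b' * c')" "A * b' + B * d' = b * (a' * d' - b' * c')"
      "C * a' + D * c' = c * (a' * d' - b' * c')" "C * b' + D * d' = d * (a' * d' - b' * c')"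
      by (simp_all add: defs algebra_simps)
    then show "A * a' + B * c' = a" "A * b' + B * d' = b" "C * a' + D * c' = c" "C * b' + D * d' = d"
      using 2 by simp_all
  qed
  define w where "w = mob a' b' c' d' z"
  have w: "Im w > 0" unfolding w_def by (rule Im_mob_pos[OF 2 z])
  have "mob a b c d z = mob A B C D w"
    unfolding w_def mob_mob[OF 2 z] e ..
  moreover have den: "of_int c * z + of_int d = (of_int C * w + of_int D) * (of_int c' * z + of_int d')"
    unfolding w_def mob_den_mob[OF 2 z] e ..
  moreover have "of_int C * w + of_int D \<noteq> 0" by (rule mob_den_nz[OF det w])
  ultimately show ?thesis
    unfolding sl_def w_def[symmetric] by (simp add: f_mob[OF det dvd w] power_mult_distrib den)
qed

lemma sl_periodic:
  assumes "a * d - b * c = 1" "Im z > 0"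
  shows "sl a b c d (z + of_real (real N)) = sl a b c d z"
proof -
  define w where "w = z + of_nat N"
  have w: "Im w > 0" using assms by (simp add: w_def)
  have 2: "a * (d + c * int N) - (b + a * int N) * c = 1" using assms by (simp add: algebra_simps)
  have "mob a b c d w = mob a (b + a * int N) c (d + c * int N) z"
    by (simp add: mob_def w_def algebra_simps)
  then have "sl a b c d w = sl a (b + a * int N) c (d + c * int N) z"
    by (simp add: sl_def w_def algebra_simps)
  also have "\<dots> = sl a b c d z"
    by (rule sl_cong[OF 2 assms(1) _ _ assms(2)]) (auto simp: cong_iff_dvd_diff)
  finally show ?thesis by (simp add: w_def)
qed

lemma sl_1: "sl 1 0 0 1 = f"
  by (simp add: sl_def fun_eq_iff)

lemma N_real_pos: "real N > 0"
  using N_pos by simp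

lemma sl_decay:
  assumes "a * d - b * c = 1" "y > 0"
  shows "\<exists>C>0. \<forall>z. Im z \<ge> y \<longrightarrow> norm (sl a b c d z) \<le> C * exp (- 2 * pi * Im z / real N)"
  by (rule periodic_decay[of "sl a b c d" "real N", OF sl_holomorphic[OF assms(1)] N_real_pos
        sl_periodic[OF assms(1)] sl_tendsto_0[OF assms(1)] assms(2)])

lemma sl_primitive:
  assumes "a * d - b * c = 1"
  shows "\<exists>P. (\<forall>z. Im z > 0 \<longrightarrow> (P has_field_derivative 2 * of_real pi * \<i> * sl a b c d z) (at z)) \<and>
    (P \<longlongrightarrow> 0) im_top"
  by (rule periodic_primitive[of "sl a b c d" "real N", OF sl_holomorphic[OF assms(1)] N_real_pos
        sl_periodic[OF assms(1)] sl_tendsto_0[OF assms(1)]])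

lemma sl_Im_bounded:
  assumes "a * d - b * c = 1" "y > 0"
  shows "\<exists>C>0. \<forall>z. Im z \<ge> y \<longrightarrow> norm (sl a b c d z) * Im z \<le> C"
proof -
  obtain C where C: "C > 0" "\<And>z. Im z \<ge> y \<Longrightarrow> norm (sl a b c d z) \<le> C * exp (- 2 * pi * Im z / real N)"
    using sl_decay[OF assms] by metis
  show ?thesis
  proof (intro exI[of _ "C * real N"] conjI allI impI)
    fix z assume z: "Im z \<ge> y"
    define u where "u = 2 * pi * Im z / real N"
    have "u \<ge> 0" using z assms N_pos by (simp add: u_def)
    have "Im z = real N * u / (2 * pi)" using N_pos by (simp add: u_def)
    also have "\<dots> \<le> real N * u / 1"
      using \<open>u \<ge> 0\<close> pi_ge_two by (intro divide_left_mono) auto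
    also have "\<dots> \<le> real N * exp u"
      using mult_left_mono[of u "exp u" "real N"] exp_ge_add_one_self[of u] by simp
    finally have Imz: "Im z \<le> real N * exp u" .
    have "norm (sl a b c d z) * Im z \<le> (C * exp (- u)) * (real N * exp u)"
      using C(2)[OF z] Imz z assms C(1) by (intro mult_mono) (auto simp: u_def)
    also have "\<dots> = C * real N" by (simp add: exp_minus field_simps)
    finally show "norm (sl a b c d z) * Im z \<le> C * real N" .
  qed (use C N_pos in auto)
qed

end

text \<open>A weak substitute for a fundamental domain. A matrix with bottom row (k, -h) divides Im
  z by |k z - h|^2, so it suffices to make this at most 5 Im z, which Dirichlet approximation of Re
  z by h/k achieves.\<close>

lemma exists_mob_Im_ge:
  assumes z: "Im z > 0"
  shows "\<exists>a b c d. a * d - b * c = 1 \<and> Im (mob a b c d z) \<ge> 1 / 5"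
proof (cases "Im z \<ge> 1 / 5")
  case True
  then show ?thesis by (intro exI[of _ 1] exI[of _ 0]) auto
next
  case False
  define y where "y = Im z"
  have y: "0 < y" "y < 1 / 5" using z False by (auto simp: y_def)
  \<comment> \<open>This size of the denominators balances the two parts of |k z - h|^2: 1/M^2 <= y
    and (k y)^2 <= (M y)^2 <= 4 y, together the 5 y needed.\<close>
  define M where "M = nat \<lceil>1 / sqrt y\<rceil>"
  have sy: "0 < sqrt y" "sqrt y < 1" using y by auto
  have M1: "real M \<ge> 1 / sqrt y" unfolding M_def by linarith
  have "1 / sqrt y > 1" using sy by simp
  moreover have "real M \<le> 1 / sqrt y + 1" unfolding M_def using sy by (simp add: of_nat_nat)
  ultimately have M2: "real M \<le> 2 / sqrt y" by simp
  have M0: "M > 0" using M1 sy by (metis divide_pos_pos less_le_trans of_nat_0_less_iff zero_less_one)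
  obtain h k where hk: "coprime h k" "0 < k" "k \<le> int M" "\<bar>of_int k * Re z - of_int h\<bar> < 1 / real M"
    using Dirichlet_approx_coprime[OF M0, of "Re z"] by metis
  obtain u v where uv: "u * h + v * k = 1"
    using bezout_int[of h k] hk(1) by auto
  have det: "(- u) * (- h) - (- v) * k = 1" using uv by simp
  define n where "n = (cmod (of_int k * z + of_int (- h)))\<^sup>2"
  have n_eq: "n = (of_int k * Re z - of_int h)\<^sup>2 + (of_int k * y)\<^sup>2"
    unfolding n_def cmod_power2 by (simp add: y_def)
  have "1 / real M \<le> sqrt y" using M1 M0 sy by (simp add: field_simps)
  then have "\<bar>of_int k * Re z - of_int h\<bar> \<le> sqrt y" using hk(4) by linarith
  then have "(of_int k * Re z - of_int h)\<^sup>2 \<le> y"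
    using y power_mono[of "\<bar>of_int k * Re z - of_int h\<bar>" "sqrt y" 2] by simp
  moreover have "of_int k * y \<le> 2 * sqrt y"
  proof -
    have "of_int k \<le> real M" using hk(3) by linarith
    then have "of_int k * y \<le> (2 / sqrt y) * y" using M2 y by (intro mult_right_mono) linarith+
    also have "\<dots> = 2 * sqrt y" using y by (simp add: field_simps real_div_sqrt)
    finally show ?thesis .
  qed
  then have "(of_int k * y)\<^sup>2 \<le> 4 * y"
    using y hk(2) power_mono[of "of_int k * y" "2 * sqrt y" 2] by (simp add: power_mult_distrib)
  ultimately have n: "n \<le> 5 * y" unfolding n_eq by linarith
  have "n > 0" using mob_den_nz[OF det z] by (simp add: n_def)
  have "Im (mob (-u) (-v) k (-h) z) = y / n"
    unfolding Im_mob[OF det z] by (simp add: n_def y_def)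
  also have "\<dots> \<ge> 1 / 5" using n \<open>n > 0\<close> by (simp add: field_simps)
  finally show ?thesis using det by blast
qed

section \<open>Growth of a cusp form on the upper half plane and along vertical lines\<close>

context cusp_form2
begin

text \<open>Every z is B w with Im w >= 1/5, and then |f(z)| Im z equals |(f|B)(w)| Im w, which is
  bounded since f|B decays exponentially. By \<open>sl_cong\<close> finitely many such bounds
  suffice. This estimate of Hecke is the source of a_n = O(n).\<close>

lemma f_bound: "\<exists>C>0. \<forall>z. Im z > 0 \<longrightarrow> norm (f z) * Im z \<le> C"
proof -
  define R where "R = {0..<int N} \<times> {0..<int N}"
  define P where "P p C \<longleftrightarrow> (\<forall>a b c d z. a * d - b * c = 1 \<longrightarrow> c mod int N = fst p \<longrightarrow>
      d mod int N = snd p \<longrightarrow> Im z \<ge> 1 / 5 \<longrightarrow> norm (sl a b c d z) * Im z \<le> C)" for p C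
  have "\<exists>C. C > 0 \<and> P p C" for p
  proof (cases "\<exists>a b c d. a * d - b * c = 1 \<and> c mod int N = fst p \<and> d mod int N = snd p")
    case True
    then obtain a b c d where 1: "a * d - b * c = 1" "c mod int N = fst p" "d mod int N = snd p"
      by blast
    obtain C where C: "C > 0" "\<And>z. Im z \<ge> 1/5 \<Longrightarrow> norm (sl a b c d z) * Im z \<le> C"
      using sl_Im_bounded[OF 1(1), of "1/5"] by auto
    have "P p C"
      unfolding P_def
    proof (intro allI impI)
      fix a' b' c' d' z
      assume 2: "a' * d' - b' * c' = 1" "c' mod int N = fst p" "d' mod int N = snd p" and z: "Im z \<ge> 1 / 5"
      have "sl a' b' c' d' z = sl a b c d z"
        by (rule sl_cong[OF 2(1) 1(1)]) (use 1 2 z in \<open>auto simp: cong_def\<close>)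
      then show "norm (sl a' b' c' d' z) * Im z \<le> C" using C(2)[OF z] by simp
    qed
    with C(1) show ?thesis by blast
  next
    case False
    \<comment> \<open>No matrix has this bottom row modulo N, so any constant will do.\<close>
    have "P p 1" unfolding P_def using False by blast
    then show ?thesis by (intro exI[of _ 1]) simp
  qed
  then have "\<forall>p. \<exists>C. C > 0 \<and> P p C" by blast
  from choice[OF this] obtain K where K': "\<forall>p. K p > 0 \<and> P p (K p)" ..
  have K: "K p > 0" "a * d - b * c = 1 \<Longrightarrow> c mod int N = fst p \<Longrightarrow>
      d mod int N = snd p \<Longrightarrow> Im z \<ge> 1 / 5 \<Longrightarrow> norm (sl a b c d z) * Im z \<le> K p" for p a b c d z
    using K'[rule_format, of p] unfolding P_def by blast+
  have fin: "finite R" by (simp add: R_def)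
  show ?thesis
  proof (intro exI[of _ "1 + (\<Sum>p\<in>R. K p)"] conjI allI impI)
    show "1 + (\<Sum>p\<in>R. K p) > 0" using K(1) by (simp add: add_pos_nonneg sum_nonneg less_imp_le)
  next
    fix z assume z: "Im z > 0"
    obtain a b c d where 1: "a * d - b * c = 1" and im: "Im (mob a b c d z) \<ge> 1 / 5"
      using exists_mob_Im_ge[OF z] by blast
    have 2: "d * a - (- b) * (- c) = 1" using 1 by (simp add: algebra_simps)
    define w where "w = mob a b c d z"
    have w: "Im w > 0" "Im w \<ge> 1 / 5" using im by (auto simp: w_def)
    have zw: "mob d (- b) (- c) a w = z" unfolding w_def by (rule mob_inverse[OF 1 z])
    define p where "p = ((- c) mod int N, a mod int N)"
    have p: "p \<in> R" using N_pos by (auto simp: p_def R_def)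
    have "norm (f z) * Im z = norm (sl d (-b) (-c) a w) * Im w"
      using Im_mob[OF 2 w(1)] mob_den_nz[OF 2 w(1)]
      by (simp add: sl_def zw norm_divide norm_power)
    also have "\<dots> \<le> K p" by (rule K(2)[OF 2]) (use w in \<open>auto simp: p_def\<close>)
    also have "\<dots> \<le> (\<Sum>p\<in>R. K p)" by (rule member_le_sum[OF p _ fin]) (use K(1) less_imp_le in blast)
    finally show "norm (f z) * Im z \<le> 1 + (\<Sum>p\<in>R. K p)" by simp
  qed
qed

text \<open>By \<open>mob_vertical\<close> the point over the cusp is the image of some w with Im w
  = 1/(c^2 t), where the slashed form decays like exp(-const/t). The automorphy factor |c w + d|^2 =
  1/(c t)^2 costs the 1/t^2.\<close>

lemma vertical_decay_cusp:
  assumes 1: "a * d - b * c = 1" and c: "c \<noteq> 0"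
  shows "\<exists>C>0. \<exists>\<kappa>>0. \<forall>t. 0 < t \<longrightarrow> t \<le> 1 \<longrightarrow>
    norm (f (Complex (of_int a / of_int c) t)) \<le> C / t\<^sup>2 * exp (- \<kappa> / t)"
proof -
  define k where "k = (real_of_int c)\<^sup>2"
  have c2: "k > 0" using c by (simp add: k_def)
  obtain C where C: "C > 0" "\<And>z. Im z \<ge> 1 / k \<Longrightarrow> norm (sl a b c d z) \<le> C * exp (- 2 * pi * Im z / real N)"
    using sl_decay[OF 1, of "1 / k"] c2 by auto
  show ?thesis
  proof (rule exI[of _ "C / k"], rule conjI, goal_cases)
    case 2
    show ?case
    proof (rule exI[of _ "2 * pi / (real N * k)"], intro conjI allI impI)
      fix t :: real assume t: "0 < t" "t \<le> 1"
      define w where "w = Complex (- of_int d / of_int c) (1 / ((of_int c)\<^sup>2 * t))"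
      have im: "Im w = 1 / (k * t)" by (simp add: w_def k_def)
      have imge: "Im w \<ge> 1 / k" unfolding im using t c2 by (simp add: field_simps)
      have w: "Im w > 0" unfolding im using t c2 by simp
      have cw: "of_int c * w + of_int d = \<i> / (c * t)"
        using c t by (simp add: w_def complex_eq_iff power2_eq_square)
      have e: "Complex (of_int a / of_int c) t = mob a b c d w"
        unfolding w_def by (rule mob_vertical[OF 1 c t(1), symmetric])
      have "f (mob a b c d w) = sl a b c d w * (of_int c * w + of_int d)\<^sup>2"
        using mob_den_nz[OF 1 w] by (simp add: sl_def)
      then have "norm (f (mob a b c d w)) = norm (sl a b c d w) * (1 / (k * t\<^sup>2))"
        unfolding cw by (simp add: k_def norm_mult norm_divide norm_power power_divide power_mult_distrib)
      also have "\<dots> \<le> (C * exp (- 2 * pi * Im w / real N)) * (1 / (k * t\<^sup>2))"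
        by (intro mult_right_mono C(2)[OF imge]) (use c2 in auto)
      also have "\<dots> = C / k / t\<^sup>2 * exp (- (2 * pi / (real N * k)) / t)"
        by (simp add: im field_simps)
      finally show "norm (f (Complex (of_int a / of_int c) t)) \<le> C / k / t\<^sup>2 * exp (- (2 * pi / (real N * k)) / t)"
        by (simp add: e)
    qed (use c2 N_pos in auto)
  qed (use C c2 in auto)
qed

lemma vertical_decay_inf:
  "\<exists>C>0. \<exists>\<kappa>>0. \<forall>x t. t \<ge> 1 \<longrightarrow> norm (f (Complex x t)) \<le> C * exp (- \<kappa> * t)"
proof -
  obtain C where C: "C > 0" "\<And>z. Im z \<ge> 1 \<Longrightarrow> norm (f z) \<le> C * exp (- 2 * pi * Im z / real N)"
    using sl_decay[of 1 1 0 0 1] unfolding sl_1 by auto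
  have "norm (f (Complex x t)) \<le> C * exp (- (2 * pi / real N) * t)" if "t \<ge> 1" for x t
    using C(2)[of "Complex x t"] that by simp
  moreover have "2 * pi / real N > 0" using N_pos by simp
  ultimately have "\<exists>\<kappa>>0. \<forall>x t. t \<ge> 1 \<longrightarrow> norm (f (Complex x t)) \<le> C * exp (- \<kappa> * t)" by blast
  with C(1) show ?thesis by blast
qed

end

section \<open>The Eichler integral and its boundary values\<close>


lemma exp_neg_le_powr:
  fixes \<kappa> \<rho> :: real
  assumes "\<kappa> > 0"
  shows "\<exists>C>0. \<forall>u\<ge>1. exp (- \<kappa> * u) \<le> C * u powr \<rho>"
proof -
  define n where "n = nat \<lceil>\<bar>\<rho>\<bar>\<rceil>"
  have n: "- real n \<le> \<rho>" unfolding n_def by linarith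
  have e: "x ^ n / fact n \<le> exp x" if "x \<ge> 0" for x :: real
  proof -
    have "(\<Sum>k\<in>{n}. inverse (fact k) *\<^sub>R x ^ k) \<le> suminf (\<lambda>k. inverse (fact k) *\<^sub>R x ^ k)"
      using that summable_exp_generic[of x] by (intro sum_le_suminf) auto
    then show ?thesis by (simp add: exp_def divide_inverse mult.commute)
  qed
  show ?thesis
  proof (intro exI[of _ "fact n / \<kappa> ^ n"] conjI allI impI)
    fix u :: real assume u: "u \<ge> 1"
    have p: "(\<kappa> * u) ^ n > 0" using assms u by simp
    have "exp (- \<kappa> * u) = 1 / exp (\<kappa> * u)" by (simp add: exp_minus field_simps)
    also have "\<dots> \<le> 1 / ((\<kappa> * u) ^ n / fact n)"
      using e[of "\<kappa> * u"] assms u p by (intro divide_left_mono) auto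
    also have "\<dots> = fact n / \<kappa> ^ n * u powr (- real n)"
      using u by (simp add: power_mult_distrib powr_minus powr_realpow divide_inverse)
    also have "\<dots> \<le> fact n / \<kappa> ^ n * u powr \<rho>"
      using assms u n by (intro mult_left_mono powr_mono) auto
    finally show "exp (- \<kappa> * u) \<le> fact n / \<kappa> ^ n * u powr \<rho>" .
  qed (use assms in auto)
qed

lemma Rats_as_coprime_quotient:
  assumes "x \<in> \<rat>"
  obtains a b c d :: int where "a * d - b * c = 1" "c > 0" "x = of_int a / of_int c"
proof -
  obtain r where r: "x = of_rat r" using assms by (auto elim: Rats_cases)
  obtain a c where ac: "r = Fract a c" "c > 0" "coprime a c" by (rule Rat_cases)
  obtain u v where uv: "u * a + v * c = 1" using bezout_int[of a c] ac(3) by auto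
  show thesis
  proof (rule that[of a u "- v" c])
    show "a * u - - v * c = 1" using uv by (simp add: mult.commute)
    show "x = of_int a / of_int c" using ac r by (simp add: of_rat_rat)
  qed (use ac in auto)
qed

lemma filterlim_Complex_at_top: "filterlim (Complex x) im_top at_top"
  unfolding filterlim_filtercomap_iff by (simp add: o_def filterlim_ident)

context cusp_form2
begin

definition is_prim :: "(complex \<Rightarrow> complex) \<Rightarrow> bool" where
  "is_prim P \<longleftrightarrow> (\<forall>z. Im z > 0 \<longrightarrow> (P has_field_derivative 2 * of_real pi * \<i> * f z) (at z)) \<and>
    (P \<longlongrightarrow> 0) im_top"

text \<open>The Eichler integral, that is, the integral of 2 pi i f from i infinity to z.\<close>

definition G :: "complex \<Rightarrow> complex" where
  "G = (SOME P. is_prim P)"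

lemma is_prim_G: "is_prim G"
proof -
  have "\<exists>P. is_prim P" using sl_primitive[of 1 1 0 0] unfolding sl_1 is_prim_def by simp
  then show ?thesis unfolding G_def by (rule someI_ex)
qed

lemma G_deriv: "Im z > 0 \<Longrightarrow> (G has_field_derivative 2 * of_real pi * \<i> * f z) (at z)"
  using is_prim_G by (simp add: is_prim_def)

lemma G_tendsto_0: "(G \<longlongrightarrow> 0) im_top"
  using is_prim_G by (simp add: is_prim_def)

lemma G_unique: "is_prim P \<Longrightarrow> Im z > 0 \<Longrightarrow> P z = G z"
  by (rule upper_half_deriv_unique[of P "\<lambda>z. 2 * of_real pi * \<i> * f z" G 0])
     (use is_prim_G in \<open>auto simp: is_prim_def\<close>)

lemma has_field_derivative_G_mob:
  assumes 1: "a * d - b * c = 1" and z: "Im z > 0"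
  shows "((\<lambda>z. G (mob a b c d z)) has_field_derivative 2 * of_real pi * \<i> * sl a b c d z) (at z)"
proof -
  have "((\<lambda>z. G (mob a b c d z)) has_field_derivative
      2 * of_real pi * \<i> * f (mob a b c d z) * (1 / (of_int c * z + of_int d)\<^sup>2)) (at z)"
    by (rule DERIV_chain2[OF G_deriv[OF Im_mob_pos[OF 1 z]] has_field_derivative_mob[OF 1 z]])
  then show ?thesis by (simp add: sl_def)
qed

text \<open>f(z) dz is invariant under Gamma0(N), so both sides have the same derivative. The
  constant is the period attached to the matrix.\<close>

lemma G_mob_const:
  assumes 1: "a * d - b * c = 1" and 2: "int N dvd c"
  shows "\<exists>C. \<forall>z. Im z > 0 \<longrightarrow> G (mob a b c d z) = G z + C"
proof (rule upper_half_deriv_eq)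
  fix z :: complex assume z: "Im z > 0"
  have "sl a b c d z = f z"
    using f_mob[OF 1 2 z] mob_den_nz[OF 1 z] by (simp add: sl_def)
  with has_field_derivative_G_mob[OF 1 z]
  show "((\<lambda>z. G (mob a b c d z)) has_field_derivative 2 * of_real pi * \<i> * f z) (at z)" by simp
qed (rule G_deriv)

text \<open>G composed with a matrix is, up to a constant, the primitive of the slashed form that
  vanishes at i infinity. So G has a limit at every cusp.\<close>

lemma G_mob_tendsto:
  assumes 1: "a * d - b * c = 1"
  shows "\<exists>l. ((\<lambda>z. G (mob a b c d z)) \<longlongrightarrow> l) im_top"
proof -
  from sl_primitive[OF 1] obtain P where
    *: "(\<forall>z. Im z > 0 \<longrightarrow> (P has_field_derivative 2 * of_real pi * \<i> * sl a b c d z) (at z)) \<and> (P \<longlongrightarrow> 0) im_top" ..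
  have "\<exists>C. \<forall>z. Im z > 0 \<longrightarrow> G (mob a b c d z) = P z + C"
    by (rule upper_half_deriv_eq[OF has_field_derivative_G_mob[OF 1]]) (use * in auto)
  then obtain C where C: "\<forall>z. Im z > 0 \<longrightarrow> G (mob a b c d z) = P z + C" ..
  have "((\<lambda>z. P z + C) \<longlongrightarrow> 0 + C) im_top" using * by (intro tendsto_intros) auto
  moreover have "eventually (\<lambda>z. P z + C = G (mob a b c d z)) im_top"
    by (rule eventually_mono[OF eventually_im_top_gt[of 0]]) (use C in auto)
  ultimately have "((\<lambda>z. G (mob a b c d z)) \<longlongrightarrow> 0 + C) im_top"
    by (rule Lim_transform_eventually)
  then show ?thesis ..
qed

text \<open>Extends G to the cusps along vertical lines; meaningful at rational x by
  \<open>Gc_tendsto\<close>.\<close>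

definition Gc :: "real \<Rightarrow> complex" where
  "Gc x = Lim (at_right 0) (\<lambda>t. G (Complex x t))"

lemma G_vertical_tendsto:
  assumes 1: "a * d - b * c = 1" and c: "c \<noteq> 0" and l: "((\<lambda>z. G (mob a b c d z)) \<longlongrightarrow> l) im_top"
  shows "((\<lambda>t. G (Complex (of_int a / of_int c) t)) \<longlongrightarrow> l) (at_right 0)"
proof -
  define w where "w t = Complex (- of_int d / of_int c) (1 / ((of_int c)\<^sup>2 * t))" for t
  have c2: "(real_of_int c)\<^sup>2 > 0" using c by simp
  have "filterlim (\<lambda>t. 1 / ((real_of_int c)\<^sup>2 * t)) at_top (at_right 0)"
    using c2 by real_asymp
  then have "filterlim w im_top (at_right 0)"
    unfolding filterlim_filtercomap_iff by (simp add: w_def o_def)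
  then have "((\<lambda>t. G (mob a b c d (w t))) \<longlongrightarrow> l) (at_right 0)"
    by (rule filterlim_compose[OF l])
  moreover have "eventually (\<lambda>t. G (mob a b c d (w t)) = G (Complex (of_int a / of_int c) t)) (at_right 0)"
    using eventually_at_right_less[of "0::real"]
    by eventually_elim (use mob_vertical[OF 1 c] in \<open>simp add: w_def\<close>)
  ultimately show ?thesis by (rule Lim_transform_eventually)
qed

lemma Gc_eq:
  assumes "a * d - b * c = 1" "c \<noteq> 0" "((\<lambda>z. G (mob a b c d z)) \<longlongrightarrow> l) im_top"
  shows "Gc (of_int a / of_int c) = l"
  unfolding Gc_def by (rule tendsto_Lim[OF _ G_vertical_tendsto[OF assms]]) simp

lemma Gc_tendsto:
  assumes "x \<in> \<rat>"
  shows "((\<lambda>t. G (Complex x t)) \<longlongrightarrow> Gc x) (at_right 0)"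
proof -
  obtain a b c d where 1: "a * d - b * c = 1" "c > 0" and x: "x = of_int a / of_int c"
    by (rule Rats_as_coprime_quotient[OF assms])
  obtain l where l: "((\<lambda>z. G (mob a b c d z)) \<longlongrightarrow> l) im_top"
    using G_mob_tendsto[OF 1(1)] by blast
  have c: "c \<noteq> 0" using 1 by simp
  show ?thesis
    using G_vertical_tendsto[OF 1(1) c l] Gc_eq[OF 1(1) c l] by (simp add: x)
qed

text \<open>The matrix maps the cusp 0 to \<open>b / d\<close>. To compare boundary values, 0 is
  written as the image of i infinity under S = (0 -1; 1 0); the product with S has first column (b,
  d).\<close>

lemma period_eq_Gc:
  assumes 1: "a * d - b * c = 1" and 2: "int N dvd c" and d: "d \<noteq> 0"
    and C: "\<And>z. Im z > 0 \<Longrightarrow> G (mob a b c d z) = G z + C"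
  shows "C = Gc (of_int b / of_int d) - Gc 0"
proof -
  have 3: "b * (- c) - (- a) * d = 1" using 1 by (simp add: algebra_simps)
  have S: "(0::int) * 0 - (-1) * 1 = 1" by simp
  obtain l where l: "((\<lambda>z. G (mob 0 (-1) 1 0 z)) \<longlongrightarrow> l) im_top"
    using G_mob_tendsto[OF S] by blast
  have "Gc 0 = l" using Gc_eq[OF S _ l] by simp
  have "((\<lambda>z. G (mob 0 (-1) 1 0 z) + C) \<longlongrightarrow> l + C) im_top" by (intro tendsto_intros l)
  moreover have "eventually (\<lambda>z. G (mob 0 (-1) 1 0 z) + C = G (mob b (- a) d (- c) z)) im_top"
  proof (rule eventually_mono[OF eventually_im_top_gt[of 0]])
    fix z :: complex assume z: "Im z > 0"
    have "mob a b c d (mob 0 (-1) 1 0 z) = mob b (- a) d (- c) z"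
      unfolding mob_mob[OF S z] by simp
    then show "G (mob 0 (-1) 1 0 z) + C = G (mob b (- a) d (- c) z)"
      using C[OF Im_mob_pos[OF S z]] by simp
  qed
  ultimately have "((\<lambda>z. G (mob b (- a) d (- c) z)) \<longlongrightarrow> l + C) im_top"
    by (rule Lim_transform_eventually)
  from Gc_eq[OF 3 d this] \<open>Gc 0 = l\<close> show ?thesis by simp
qed

text \<open>The exponent may have either sign, so f decays faster than any power both at the cusp
  and at i infinity. The Mellin transform then converges for every s.\<close>

lemma f_vertical_rapid_decay:
  assumes "x \<in> \<rat>"
  shows "\<exists>C>0. \<forall>t>0. norm (f (Complex x t)) \<le> C * t powr \<rho>"
proof -
  obtain a b c d where 1: "a * d - b * c = 1" "c > 0" and x: "x = of_int a / of_int c"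
    by (rule Rats_as_coprime_quotient[OF assms])
  have c: "c \<noteq> 0" using 1 by simp
  obtain C1 k1 where C1: "C1 > 0" "k1 > 0"
    "\<And>t. 0 < t \<Longrightarrow> t \<le> 1 \<Longrightarrow> norm (f (Complex x t)) \<le> C1 / t\<^sup>2 * exp (- k1 / t)"
    using vertical_decay_cusp[OF 1(1) c] x by blast
  obtain C2 k2 where C2: "C2 > 0" "k2 > 0"
    "\<And>t. t \<ge> 1 \<Longrightarrow> norm (f (Complex x t)) \<le> C2 * exp (- k2 * t)"
    using vertical_decay_inf by blast
  obtain D1 where D1: "D1 > 0" "\<And>u. u \<ge> 1 \<Longrightarrow> exp (- k1 * u) \<le> D1 * u powr (- \<rho> - 2)"
    using exp_neg_le_powr[OF C1(2)] by blast
  obtain D2 where D2: "D2 > 0" "\<And>u. u \<ge> 1 \<Longrightarrow> exp (- k2 * u) \<le> D2 * u powr \<rho>"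
    using exp_neg_le_powr[OF C2(2)] by blast
  show ?thesis
  proof (rule exI[of _ "max (C1 * D1) (C2 * D2)"], intro conjI allI impI)
    fix t :: real assume t: "t > 0"
    show "norm (f (Complex x t)) \<le> max (C1 * D1) (C2 * D2) * t powr \<rho>"
    proof (cases "t \<le> 1")
      case True
      have "norm (f (Complex x t)) \<le> C1 / t\<^sup>2 * exp (- k1 * (1 / t))" using C1(3)[OF t True] by simp
      also have "\<dots> \<le> C1 / t\<^sup>2 * (D1 * (1 / t) powr (- \<rho> - 2))"
        by (intro mult_left_mono D1(2)) (use t True C1 in auto)
      also have "(1 / t) powr (- \<rho> - 2) = t powr (\<rho> + 2)"
        using t by (simp add: powr_divide powr_minus_divide[of t "\<rho> + 2", symmetric] add.commute flip: powr_minus_divide)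
      also have "t powr (\<rho> + 2) = t powr \<rho> * t\<^sup>2" using t by (simp add: powr_add)
      also have "C1 / t\<^sup>2 * (D1 * (t powr \<rho> * t\<^sup>2)) = C1 * D1 * t powr \<rho>" using t by simp
      also have "\<dots> \<le> max (C1 * D1) (C2 * D2) * t powr \<rho>" by (intro mult_right_mono) auto
      finally show ?thesis .
    next
      case False
      have "norm (f (Complex x t)) \<le> C2 * exp (- k2 * t)" using C2(3) False by simp
      also have "\<dots> \<le> C2 * (D2 * t powr \<rho>)" by (intro mult_left_mono D2(2)) (use False C2 in auto)
      also have "\<dots> \<le> max (C1 * D1) (C2 * D2) * t powr \<rho>"
        unfolding mult.assoc[symmetric] by (intro mult_right_mono) auto
      finally show ?thesis .
    qed
  qed (use C1 D1 in \<open>simp add: less_max_iff_disj\<close>)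
qed

lemma continuous_on_vertical: "continuous_on {0<..} (\<lambda>t. f (Complex x t))"
proof -
  have "continuous_on {0<..} (\<lambda>t. Complex x t)"
    unfolding Complex_eq by (intro continuous_intros)
  then show ?thesis
    by (rule continuous_on_compose2[OF holomorphic_on_imp_continuous_on[OF hol]]) auto
qed

lemma G_vertical_deriv:
  assumes "t > 0"
  shows "((\<lambda>t. G (Complex x t)) has_vector_derivative - 2 * of_real pi * f (Complex x t)) (at t)"
proof -
  have "((\<lambda>t. Complex x t) has_vector_derivative \<i>) (at t)"
    unfolding Complex_eq by (auto intro!: derivative_eq_intros)
  moreover have "(G has_field_derivative 2 * of_real pi * \<i> * f (Complex x t)) (at (Complex x t))"
    using assms by (intro G_deriv) simp
  ultimately have "(G \<circ> Complex x has_vector_derivative \<i> * (2 * of_real pi * \<i> * f (Complex x t))) (at t)"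
    by (rule field_vector_diff_chain_at)
  then show ?thesis by (simp add: o_def algebra_simps)
qed

lemma G_vertical_at_top: "((\<lambda>t. G (Complex x t)) \<longlongrightarrow> 0) at_top"
  by (rule filterlim_compose[OF G_tendsto_0 filterlim_Complex_at_top])

end

section \<open>Hecke operators\<close>


lemma root_unity_sum:
  fixes n q :: nat
  assumes "q > 0"
  shows "(\<Sum>b<q. exp (2 * of_real pi * \<i> * of_nat n * of_nat b / of_nat q)) =
    (if q dvd n then of_nat q else (0::complex))"
proof -
  define x where "x = exp (2 * of_real pi * \<i> * of_nat n / of_nat q :: complex)"
  have e: "exp (2 * of_real pi * \<i> * of_nat n * of_nat b / of_nat q) = x ^ b" for b
    unfolding x_def exp_of_nat_mult[symmetric] by (simp add: mult_ac)
  have x1: "x = 1 \<longleftrightarrow> q dvd n"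
    using complex_root_unity_eq_1[of q n] assms unfolding x_def by simp
  have "x ^ q = exp (2 * of_real pi * \<i> * of_nat n)"
    unfolding x_def exp_of_nat_mult[symmetric] using assms by simp
  also have "\<dots> = 1"
    using exp_integer_2pi[of "of_nat n"] by (simp add: mult_ac)
  finally have "x ^ q = 1" .
  then have "(\<Sum>b<q. x ^ b) = (if x = 1 then of_nat q else 0)"
    by (simp add: geometric_sum)
  then show ?thesis by (simp add: e x1)
qed

text \<open>The nome never vanishes, so nothing is assumed at w = 0. The constant coefficient is
  found as a limit, the others by dividing the series by w.\<close>

lemma qseries_zero:
  fixes b :: "nat \<Rightarrow> complex"
  assumes "\<And>w. w \<noteq> 0 \<Longrightarrow> norm w < 1 \<Longrightarrow> (\<lambda>n. b n * w ^ n) sums 0"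
  shows "b n = 0"
  using assms
proof (induction n arbitrary: b)
  case 0
  have "((\<lambda>w::complex. 0::complex) \<longlongrightarrow> b 0) (at 0)"
    by (rule powser_limit_0_strong[of 1 b "\<lambda>_. 0"]) (use 0 in auto)
  then show ?case by (simp add: tendsto_const_iff)
next
  case (Suc n)
  have "((\<lambda>w::complex. 0::complex) \<longlongrightarrow> b 0) (at 0)"
    by (rule powser_limit_0_strong[of 1 b "\<lambda>_. 0"]) (use Suc.prems in auto)
  then have b0: "b 0 = 0" by (simp add: tendsto_const_iff)
  show ?case
  proof (rule Suc.IH[of "\<lambda>n. b (Suc n)"])
    fix w :: complex assume w: "w \<noteq> 0" "norm w < 1"
    have "(\<lambda>n. b (Suc n) * w ^ Suc n) sums 0"
      using sums_Suc_iff[of "\<lambda>n. b n * w ^ n" 0] Suc.prems[OF w] b0 by simp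
    then have "(\<lambda>n. (b (Suc n) * w ^ Suc n) / w) sums (0 / w)" by (rule sums_divide)
    then show "(\<lambda>n. b (Suc n) * w ^ n) sums 0" using w by simp
  qed
qed

lemma cnj_Rats:
  assumes "x \<in> \<rat>"
  shows "cnj x = x"
proof -
  obtain r where r: "x = of_rat r" using assms by (auto elim: Rats_cases)
  obtain p q where "r = Fract p q" "q > 0" "coprime p q" by (rule Rat_cases)
  with r show ?thesis by (simp add: of_rat_rat)
qed

lemma qq1_surj:
  assumes "w \<noteq> 0" "norm w < 1"
  obtains z where "Im z > 0" "qq 1 z = w" "Im z = - ln (norm w) / (2 * pi)"
proof
  let ?z = "Ln w / (2 * of_real pi * \<i>)"
  have im: "Im ?z = - ln (norm w) / (2 * pi)"
    using assms by (simp add: Im_divide field_simps power2_eq_square)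
  show "Im ?z = - ln (norm w) / (2 * pi)" by (rule im)
  show "Im ?z > 0" unfolding im using assms by (simp add: divide_neg_pos)
  show "qq 1 ?z = w" using assms by (simp add: qq_def)
qed

lemma qq1_power: "qq 1 z ^ n = exp (2 * of_real pi * \<i> * of_nat n * z)"
  by (simp add: qq_def exp_of_nat_mult[symmetric] mult_ac)

locale eigenform2 = cusp_form2 +
  fixes a :: "nat \<Rightarrow> complex"
  assumes eigen: "hecke_eigenform N f"
    and qexp: "q_expansion f a"
    and a_1: "a 1 = 1"
    and a_rat: "\<And>n. n \<ge> 1 \<Longrightarrow> a n \<in> \<rat>"
begin

text \<open>\<open>q_expansion\<close> does not constrain \<open>a 0\<close>, so the constant term
  is set to 0 here.\<close>

definition A :: "nat \<Rightarrow> complex" where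
  "A n = (if n = 0 then 0 else a n)"

lemma A_sums:
  assumes "Im z > 0"
  shows "(\<lambda>n. A n * qq 1 z ^ n) sums f z"
proof -
  have "(\<lambda>n. A (Suc n) * qq 1 z ^ Suc n) sums f z"
    using qexp assms unfolding q_expansion_def qq1_power by (simp add: A_def)
  then show ?thesis
    by (subst (asm) sums_Suc_iff) (simp add: A_def)
qed

lemma A_unique:
  assumes "\<And>z. Im z > 0 \<Longrightarrow> (\<lambda>n. b n * qq 1 z ^ n) sums g z"
    and "\<And>z. Im z > 0 \<Longrightarrow> (\<lambda>n. b' n * qq 1 z ^ n) sums g z"
  shows "b n = b' n"
proof -
  have "b n - b' n = 0"
  proof (rule qseries_zero)
    fix w :: complex assume "w \<noteq> 0" "norm w < 1"
    then obtain z where z: "Im z > 0" "qq 1 z = w" by (rule qq1_surj)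
    from sums_diff[OF assms(1)[OF z(1)] assms(2)[OF z(1)]]
    show "(\<lambda>n. (b n - b' n) * w ^ n) sums 0" by (simp add: z algebra_simps)
  qed
  then show ?thesis by simp
qed

lemma f_periodic: "Im z > 0 \<Longrightarrow> f (z + 1) = f z"
  using f_mob[of 1 1 1 0 z] by (simp add: mob_def)

text \<open>Rational coefficients are real, and reflecting z in the imaginary axis conjugates the
  nome.\<close>

lemma f_cnj:
  assumes "Im z > 0"
  shows "f (- cnj z) = cnj (f z)"
proof -
  have real: "cnj (A n) = A n" for n
    using cnj_Rats[OF a_rat[of n]] by (simp add: A_def)
  have "cnj (qq 1 z) = qq 1 (- cnj z)" by (simp add: qq_def exp_cnj)
  then have "(\<lambda>n. A n * qq 1 (- cnj z) ^ n) sums cnj (f z)"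
    using A_sums[OF assms, THEN sums_cnj[THEN iffD2]] by (simp add: real)
  moreover have "(\<lambda>n. A n * qq 1 (- cnj z) ^ n) sums f (- cnj z)"
    using assms by (intro A_sums) simp
  ultimately show ?thesis by (rule sums_unique2[symmetric])
qed

lemma G_periodic:
  assumes "Im z > 0"
  shows "G (z + 1) = G z"
proof (rule G_unique[OF _ assms])
  show "is_prim (\<lambda>z. G (z + 1))"
    unfolding is_prim_def
  proof (intro conjI allI impI)
    fix z :: complex assume z: "Im z > 0"
    have "((\<lambda>z. G (z + 1)) has_field_derivative 2 * of_real pi * \<i> * f (z + 1) * 1) (at z)"
      by (rule DERIV_chain2[of G]) (use z in \<open>auto intro!: G_deriv derivative_eq_intros\<close>)
    then show "((\<lambda>z. G (z + 1)) has_field_derivative 2 * of_real pi * \<i> * f z) (at z)"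
      by (simp add: f_periodic[OF z])
  next
    show "((\<lambda>z. G (z + 1)) \<longlongrightarrow> 0) im_top"
      by (rule filterlim_compose[OF G_tendsto_0 filterlim_im_top_scale[of 1]]) auto
  qed
qed

lemma G_cnj:
  assumes "Im z > 0"
  shows "G (- cnj z) = cnj (G z)"
proof -
  have "is_prim (\<lambda>z. cnj (G (- cnj z)))"
    unfolding is_prim_def
  proof (intro conjI allI impI)
    fix z :: complex assume z: "Im z > 0"
    have "((\<lambda>w. G (- w)) has_field_derivative 2 * of_real pi * \<i> * f (- cnj z) * (- 1)) (at (cnj z))"
      by (rule DERIV_chain2[of G]) (use z in \<open>auto intro!: G_deriv derivative_eq_intros\<close>)
    then have "((\<lambda>z. cnj (G (- cnj z))) has_field_derivative
        cnj (2 * of_real pi * \<i> * f (- cnj z) * (- 1))) (at z)"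
      by (drule_tac has_field_derivative_cnj_cnj) (simp add: o_def)
    then show "((\<lambda>z. cnj (G (- cnj z))) has_field_derivative 2 * of_real pi * \<i> * f z) (at z)"
      by (simp add: f_cnj[OF z])
  next
    have "((\<lambda>z. G (- cnj z)) \<longlongrightarrow> 0) im_top"
      by (rule filterlim_compose[OF G_tendsto_0 filterlim_im_top_scale[of 1]]) auto
    then show "((\<lambda>z. cnj (G (- cnj z))) \<longlongrightarrow> 0) im_top"
      using tendsto_cnj by fastforce
  qed
  from G_unique[OF this assms] show ?thesis by (metis complex_cnj_cnj)
qed

lemma hecke_prime:
  assumes q: "prime q" "\<not> q dvd N"
  shows "hecke N q f z = (\<Sum>b<q. f ((z + of_nat b) / of_nat q)) / of_nat q + of_nat q * f (of_nat q * z)"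
proof -
  have cop: "coprime q N" using q by (simp add: prime_imp_coprime)
  have q1: "q \<noteq> 1" "q > 0" using q prime_gt_0_nat by auto
  have "{a. a dvd q \<and> coprime a N} = {1, q}"
    using q cop by (auto simp: prime_nat_iff)
  then have "hecke N q f z = of_nat q * (\<Sum>a\<in>{1, q}. \<Sum>b<q div a.
        f ((of_nat a * z + of_nat b) / of_nat (q div a)) / of_nat (q div a) ^ 2)"
    by (simp add: hecke_def)
  also have "\<dots> = of_nat q * ((\<Sum>b<q. f ((z + of_nat b) / of_nat q) / of_nat q ^ 2) + f (of_nat q * z))"
    using q1 by simp
  also have "\<dots> = (\<Sum>b<q. f ((z + of_nat b) / of_nat q)) / of_nat q + of_nat q * f (of_nat q * z)"
    using q1 by (simp add: distrib_left power2_eq_square flip: sum_divide_distrib)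
  finally show ?thesis .
qed

text \<open>The translates by b multiply the n-th term by q-th roots of unity, whose sum vanishes
  unless q divides n.\<close>

lemma hecke_qexp:
  assumes q: "prime q" and z: "Im z > 0"
  shows "(\<lambda>k. (A (q * k) + of_nat q * (if q dvd k then A (k div q) else 0)) * qq 1 z ^ k) sums
    ((\<Sum>b<q. f ((z + of_nat b) / of_nat q)) / of_nat q + of_nat q * f (of_nat q * z))"
proof -
  have q0: "q > 0" using q prime_gt_0_nat by auto
  have mono: "strict_mono (\<lambda>k. q * k)" using q0 by (simp add: strict_mono_def)
  define u where "u = qq 1 (z / of_nat q)"
  have uq: "u ^ q = qq 1 z"
    unfolding u_def qq1_power using q0 by (simp add: qq_def mult_ac)
  have e: "qq 1 ((z + of_nat b) / of_nat q) ^ n =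
      u ^ n * exp (2 * of_real pi * \<i> * of_nat n * of_nat b / of_nat q)" for n b
    unfolding u_def qq1_power exp_add[symmetric] using q0 by (simp add: field_simps)
  have "(\<lambda>n. \<Sum>b<q. A n * qq 1 ((z + of_nat b) / of_nat q) ^ n) sums (\<Sum>b<q. f ((z + of_nat b) / of_nat q))"
    using z q0 by (intro sums_sum A_sums) simp
  also have "(\<lambda>n. \<Sum>b<q. A n * qq 1 ((z + of_nat b) / of_nat q) ^ n) =
      (\<lambda>n. A n * u ^ n * (if q dvd n then of_nat q else 0))"
    unfolding e root_unity_sum[OF q0, symmetric] by (simp add: sum_distrib_left mult_ac)
  finally have "(\<lambda>k. A (q * k) * u ^ (q * k) * of_nat q) sums (\<Sum>b<q. f ((z + of_nat b) / of_nat q))"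
    by (subst (asm) sums_mono_reindex[OF mono, symmetric]) (auto simp: dvd_def)
  then have "(\<lambda>k. A (q * k) * u ^ (q * k) * of_nat q / of_nat q) sums
      ((\<Sum>b<q. f ((z + of_nat b) / of_nat q)) / of_nat q)"
    by (rule sums_divide)
  then have 1: "(\<lambda>k. A (q * k) * qq 1 z ^ k) sums ((\<Sum>b<q. f ((z + of_nat b) / of_nat q)) / of_nat q)"
    using q0 by (simp add: power_mult uq)
  have "(\<lambda>n. A n * qq 1 (of_nat q * z) ^ n) sums f (of_nat q * z)"
    using z q0 by (intro A_sums) simp
  also have "(\<lambda>n. A n * qq 1 (of_nat q * z) ^ n) =
      (\<lambda>n. (if q dvd q * n then A (q * n div q) else 0) * qq 1 z ^ (q * n))"
    unfolding qq1_power using q0 by (simp add: mult_ac)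
  finally have "(\<lambda>k. (if q dvd k then A (k div q) else 0) * qq 1 z ^ k) sums f (of_nat q * z)"
    by (subst (asm) sums_mono_reindex[OF mono]) (auto simp: dvd_def)
  from sums_add[OF 1 sums_mult[OF this, of "of_nat q"]]
  show ?thesis by (simp add: algebra_simps)
qed

lemma hecke_eigenvalue:
  assumes q: "prime q" "\<not> q dvd N" and z: "Im z > 0"
  shows "(\<Sum>b<q. f ((z + of_nat b) / of_nat q)) / of_nat q + of_nat q * f (of_nat q * z) = a q * f z"
    and "A (q * k) + of_nat q * (if q dvd k then A (k div q) else 0) = a q * A k"
proof -
  have q1: "q \<ge> 1" "q \<noteq> 1" using q prime_gt_0_nat[of q] by auto
  obtain c where c: "\<And>z. Im z > 0 \<Longrightarrow> hecke N q f z = c * f z"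
    using eigen q1 unfolding hecke_eigenform_def by blast
  have eq: "A (q * k) + of_nat q * (if q dvd k then A (k div q) else 0) = c * A k" for k
  proof (rule A_unique[where g = "hecke N q f"])
    fix z :: complex assume z: "Im z > 0"
    show "(\<lambda>k. (A (q * k) + of_nat q * (if q dvd k then A (k div q) else 0)) * qq 1 z ^ k) sums hecke N q f z"
      unfolding hecke_prime[OF q] by (rule hecke_qexp[OF q(1) z])
    show "(\<lambda>n. c * A n * qq 1 z ^ n) sums hecke N q f z"
      using sums_mult[OF A_sums[OF z], of c] by (simp add: c[OF z] mult.assoc)
  qed
  \<comment> \<open>The coefficient of index 1, where \<open>a 1 = 1\<close> and q does not divide
    1.\<close>
  have "c = a q" using eq[of 1] q1 a_1 by (simp add: A_def)
  with eq show "A (q * k) + of_nat q * (if q dvd k then A (k div q) else 0) = a q * A k" by simp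
  show "(\<Sum>b<q. f ((z + of_nat b) / of_nat q)) / of_nat q + of_nat q * f (of_nat q * z) = a q * f z"
    using c[OF z] \<open>c = a q\<close> hecke_prime[OF q] by simp
qed

text \<open>This is the integrated eigenvalue equation. The chain rule produces exactly the weights
  1/q and q of the Hecke operator in weight 2, so the relation for G has no weights.\<close>

lemma G_hecke:
  assumes q: "prime q" "\<not> q dvd N" and z: "Im z > 0"
  shows "(\<Sum>b<q. G ((z + of_nat b) / of_nat q)) + G (of_nat q * z) = a q * G z"
proof (rule upper_half_deriv_unique[OF _ _ _ _ z])
  have q0: "q > 0" using q prime_gt_0_nat by auto
  fix z :: complex assume z: "Im z > 0"
  have "((\<lambda>z. G ((z + of_nat b) / of_nat q)) has_field_derivative
      2 * of_real pi * \<i> * f ((z + of_nat b) / of_nat q) * (1 / of_nat q)) (at z)" for b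
    by (rule DERIV_chain2[of G]) (use z q0 in \<open>auto intro!: G_deriv derivative_eq_intros\<close>)
  moreover have "((\<lambda>z. G (of_nat q * z)) has_field_derivative
      2 * of_real pi * \<i> * f (of_nat q * z) * of_nat q) (at z)"
    by (rule DERIV_chain2[of G]) (use z q0 in \<open>auto intro!: G_deriv derivative_eq_intros\<close>)
  ultimately have "((\<lambda>z. (\<Sum>b<q. G ((z + of_nat b) / of_nat q)) + G (of_nat q * z)) has_field_derivative
      (\<Sum>b<q. 2 * of_real pi * \<i> * f ((z + of_nat b) / of_nat q) * (1 / of_nat q))
      + 2 * of_real pi * \<i> * f (of_nat q * z) * of_nat q) (at z)"
    by (intro DERIV_add DERIV_sum)
  also have "(\<Sum>b<q. 2 * of_real pi * \<i> * f ((z + of_nat b) / of_nat q) * (1 / of_nat q))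
      + 2 * of_real pi * \<i> * f (of_nat q * z) * of_nat q = 2 * of_real pi * \<i> *
      ((\<Sum>b<q. f ((z + of_nat b) / of_nat q)) / of_nat q + of_nat q * f (of_nat q * z))"
    by (simp add: sum_distrib_left sum_divide_distrib distrib_left mult_ac)
  also have "\<dots> = 2 * of_real pi * \<i> * (a q * f z)"
    by (simp only: hecke_eigenvalue(1)[OF q z])
  finally show "((\<lambda>z. (\<Sum>b<q. G ((z + of_nat b) / of_nat q)) + G (of_nat q * z)) has_field_derivative
      2 * of_real pi * \<i> * (a q * f z)) (at z)" .
  show "((\<lambda>z. a q * G z) has_field_derivative 2 * of_real pi * \<i> * (a q * f z)) (at z)"
    using DERIV_cmult[OF G_deriv[OF z], of "a q"] by (simp add: mult_ac)
next
  have q0: "q > 0" using q prime_gt_0_nat by auto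
  have "((\<lambda>z. G ((z + of_nat b) / of_nat q)) \<longlongrightarrow> 0) im_top" for b
    by (rule filterlim_compose[OF G_tendsto_0 filterlim_im_top_scale[of "1 / real q"]]) (use q0 in auto)
  moreover have "((\<lambda>z. G (of_nat q * z)) \<longlongrightarrow> 0) im_top"
    by (rule filterlim_compose[OF G_tendsto_0 filterlim_im_top_scale[of "real q"]]) (use q0 in auto)
  ultimately have "((\<lambda>z. (\<Sum>b<q. G ((z + of_nat b) / of_nat q)) + G (of_nat q * z)) \<longlongrightarrow> (\<Sum>b<q. 0) + 0) im_top"
    by (intro tendsto_add tendsto_sum)
  then show "((\<lambda>z. (\<Sum>b<q. G ((z + of_nat b) / of_nat q)) + G (of_nat q * z)) \<longlongrightarrow> 0) im_top" by simp
  have "((\<lambda>z. a q * G z) \<longlongrightarrow> a q * 0) im_top" by (intro tendsto_intros G_tendsto_0)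
  then show "((\<lambda>z. a q * G z) \<longlongrightarrow> 0) im_top" by simp
qed

lemma Gc_hecke:
  assumes q: "prime q" "\<not> q dvd N" and x: "x \<in> \<rat>"
  shows "(\<Sum>b<q. Gc ((x + real b) / real q)) + Gc (real q * x) = a q * Gc x"
proof -
  have q0: "q > 0" using q prime_gt_0_nat by auto
  \<comment> \<open>The terms are approached along the heights t/q and q t, so that all of them
    belong to the same point x + i t.\<close>
  have l1: "filterlim (\<lambda>t. t / real q) (at_right 0) (at_right 0)"
    and l2: "filterlim (\<lambda>t. real q * t) (at_right 0) (at_right 0)"
    using q0 by (auto simp: filterlim_at eventually_at_right_less intro!: tendsto_eq_intros
        eventually_mono[OF eventually_at_right_less[of "0::real"]])
  have "((\<lambda>t. G (Complex ((x + real b) / real q) (t / real q))) \<longlongrightarrow> Gc ((x + real b) / real q)) (at_right 0)" for b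
    by (rule filterlim_compose[OF Gc_tendsto l1]) (use x in auto)
  moreover have "((\<lambda>t. G (Complex (real q * x) (real q * t))) \<longlongrightarrow> Gc (real q * x)) (at_right 0)"
    by (rule filterlim_compose[OF Gc_tendsto l2]) (use x in auto)
  ultimately have "((\<lambda>t. (\<Sum>b<q. G (Complex ((x + real b) / real q) (t / real q))) +
      G (Complex (real q * x) (real q * t))) \<longlongrightarrow> (\<Sum>b<q. Gc ((x + real b) / real q)) + Gc (real q * x)) (at_right 0)"
    by (intro tendsto_add tendsto_sum)
  moreover have "eventually (\<lambda>t. (\<Sum>b<q. G (Complex ((x + real b) / real q) (t / real q))) +
      G (Complex (real q * x) (real q * t)) = a q * G (Complex x t)) (at_right 0)"
    using eventually_at_right_less[of "0::real"]
  proof eventually_elim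
    case (elim t)
    have "Complex ((x + real b) / real q) (t / real q) = (Complex x t + of_nat b) / of_nat q" for b
      using q0 by (simp add: complex_eq_iff Re_divide Im_divide power2_eq_square)
    moreover have "Complex (real q * x) (real q * t) = of_nat q * Complex x t"
      by (simp add: complex_eq_iff)
    ultimately show ?case using G_hecke[OF q, of "Complex x t"] elim by simp
  qed
  ultimately have "((\<lambda>t. a q * G (Complex x t)) \<longlongrightarrow> (\<Sum>b<q. Gc ((x + real b) / real q)) + Gc (real q * x)) (at_right 0)"
    by (rule Lim_transform_eventually)
  moreover have "((\<lambda>t. a q * G (Complex x t)) \<longlongrightarrow> a q * Gc x) (at_right 0)"
    by (intro tendsto_intros Gc_tendsto x)
  ultimately show ?thesis using tendsto_unique[OF trivial_limit_at_right_real] by blast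
qed

lemma Gc_periodic:
  assumes x: "x \<in> \<rat>"
  shows "Gc (x + 1) = Gc x"
proof -
  have "eventually (\<lambda>t. G (Complex x t) = G (Complex (x + 1) t)) (at_right 0)"
    using eventually_at_right_less[of "0::real"]
  proof eventually_elim
    case (elim t)
    have "Complex (x + 1) t = Complex x t + 1" by (simp add: complex_eq_iff)
    then show ?case using G_periodic[of "Complex x t"] elim by simp
  qed
  with Gc_tendsto[OF x] have "((\<lambda>t. G (Complex (x + 1) t)) \<longlongrightarrow> Gc x) (at_right 0)"
    by (rule Lim_transform_eventually)
  moreover have "((\<lambda>t. G (Complex (x + 1) t)) \<longlongrightarrow> Gc (x + 1)) (at_right 0)"
    by (intro Gc_tendsto) (use x in auto)
  ultimately show ?thesis using tendsto_unique[OF trivial_limit_at_right_real] by blast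
qed

lemma Gc_uminus:
  assumes x: "x \<in> \<rat>"
  shows "Gc (- x) = cnj (Gc x)"
proof -
  have "eventually (\<lambda>t. cnj (G (Complex x t)) = G (Complex (- x) t)) (at_right 0)"
    using eventually_at_right_less[of "0::real"]
  proof eventually_elim
    case (elim t)
    have "Complex (- x) t = - cnj (Complex x t)" by (simp add: complex_eq_iff)
    then show ?case using G_cnj[of "Complex x t"] elim by simp
  qed
  with tendsto_cnj[OF Gc_tendsto[OF x]] have "((\<lambda>t. G (Complex (- x) t)) \<longlongrightarrow> cnj (Gc x)) (at_right 0)"
    by (rule Lim_transform_eventually)
  moreover have "((\<lambda>t. G (Complex (- x) t)) \<longlongrightarrow> Gc (- x)) (at_right 0)"
    by (intro Gc_tendsto) (use x in auto)
  ultimately show ?thesis using tendsto_unique[OF trivial_limit_at_right_real] by blast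
qed

text \<open>Cauchy's inequality on the circle of radius r = exp(-2 pi / n), which corresponds to the
  line Im z = 1/n. There |f| <= C n by \<open>f_bound\<close>, and r^(-n) is the constant exp(2
  pi).\<close>

lemma a_bound: "\<exists>C>0. \<forall>n\<ge>1. norm (a n) \<le> C * real n"
proof -
  obtain C where C: "C > 0" "\<And>z. Im z > 0 \<Longrightarrow> norm (f z) * Im z \<le> C"
    using f_bound by blast
  from periodic_qq[of f 1, OF hol _ _ sl_tendsto_0[of 1 1 0 0, unfolded sl_1]]
  obtain \<psi> where \<psi>: "\<psi> holomorphic_on ball 0 1 \<and> (\<forall>z. Im z > 0 \<longrightarrow> f z = qq 1 z * \<psi> (qq 1 z))"
    using f_periodic by auto
  define F where "F w = w * \<psi> w" for w
  have F: "F holomorphic_on ball 0 1" unfolding F_def using \<psi> by (intro holomorphic_intros) auto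
  have Ff: "F (qq 1 z) = f z" if "Im z > 0" for z using \<psi> that by (simp add: F_def)
  have coef: "A n = (deriv ^^ n) F 0 / fact n" for n
  proof (rule A_unique[where g = f])
    fix z :: complex assume z: "Im z > 0"
    show "(\<lambda>n. A n * qq 1 z ^ n) sums f z" by (rule A_sums[OF z])
    have "qq 1 z \<in> ball 0 1" by (rule qq_in_ball[OF _ z]) simp
    from holomorphic_power_series[OF F this]
    show "(\<lambda>n. (deriv ^^ n) F 0 / fact n * qq 1 z ^ n) sums f z"
      by (simp add: Ff[OF z])
  qed
  show ?thesis
  proof (rule exI[of _ "C * exp (2 * pi)"], intro conjI allI impI)
    fix n :: nat assume n: "n \<ge> 1"
    define r where "r = exp (- 2 * pi / real n)"
    have r: "0 < r" "r < 1" using n by (simp_all add: r_def)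
    have rn: "r ^ n = exp (- 2 * pi)" using n by (simp add: r_def exp_of_nat_mult[symmetric])
    have "norm ((deriv ^^ n) F 0) \<le> fact n * (C * real n) / r ^ n"
    proof (rule Cauchy_inequality)
      show "F holomorphic_on ball 0 r" by (rule holomorphic_on_subset[OF F]) (use r in auto)
      show "continuous_on (cball 0 r) F"
        by (rule holomorphic_on_imp_continuous_on[OF holomorphic_on_subset[OF F]]) (use r in auto)
      show "r > 0" by fact
      fix w :: complex assume "norm (0 - w) = r"
      then have w: "norm w = r" by simp
      then obtain z where z: "Im z > 0" "qq 1 z = w" "Im z = - ln (norm w) / (2 * pi)"
        using r by (metis norm_zero less_irrefl qq1_surj)
      have "Im z = 1 / real n" using z(3) by (simp add: w r_def)
      then have "norm (f z) / real n \<le> C" using C(2)[OF z(1)] by simp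
      then show "norm (F w) \<le> C * real n" using Ff[OF z(1)] z(2) n
        by (simp add: divide_le_eq)
    qed
    then have "norm (A n) \<le> C * real n / exp (- 2 * pi)"
      by (simp add: coef rn norm_divide divide_le_eq mult_ac)
    then show "norm (a n) \<le> C * exp (2 * pi) * real n"
      using n by (simp add: A_def exp_minus field_simps)
  qed (use C in auto)
qed

end

section \<open>Eichler integral periods in the homological period lattice\<close>


context cusp_form2
begin

definition equiv0 :: "complex \<Rightarrow> complex \<Rightarrow> bool" where
  "equiv0 z w \<longleftrightarrow> (\<exists>a b c d. a * d - b * c = 1 \<and> int N dvd c \<and> w = mob a b c d z)"

lemma equiv0_refl: "equiv0 z z"
  unfolding equiv0_def by (rule exI[of _ 1], rule exI[of _ 0], rule exI[of _ 0], rule exI[of _ 1]) simp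

lemma equiv0_Im: "equiv0 z w \<Longrightarrow> Im z > 0 \<Longrightarrow> Im w > 0"
  unfolding equiv0_def using Im_mob_pos by blast

lemma equiv0_sym:
  assumes "equiv0 z w" "Im z > 0"
  shows "equiv0 w z"
proof -
  obtain a b c d where 1: "a * d - b * c = 1" "int N dvd c" "w = mob a b c d z"
    using assms(1) unfolding equiv0_def by blast
  have "z = mob d (- b) (- c) a w" using mob_inverse[OF 1(1) assms(2)] 1(3) by simp
  moreover have "d * a - (- b) * (- c) = 1" using 1(1) by (simp add: algebra_simps)
  moreover have "int N dvd - c" using 1(2) by simp
  ultimately show ?thesis unfolding equiv0_def by blast
qed

lemma equiv0_trans:
  assumes "equiv0 z w" "equiv0 w u" "Im z > 0"
  shows "equiv0 z u"
proof -
  obtain a b c d where 1: "a * d - b * c = 1" "int N dvd c" "w = mob a b c d z"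
    using assms(1) unfolding equiv0_def by blast
  obtain a' b' c' d' where 2: "a' * d' - b' * c' = 1" "int N dvd c'" "u = mob a' b' c' d' w"
    using assms(2) unfolding equiv0_def by blast
  have "u = mob (a' * a + b' * c) (a' * b + b' * d) (c' * a + d' * c) (c' * b + d' * d) z"
    unfolding 2(3) 1(3) by (rule mob_mob[OF 1(1) assms(3)])
  moreover have "(a' * a + b' * c) * (c' * b + d' * d) - (a' * b + b' * d) * (c' * a + d' * c)
      = (a' * d' - b' * c') * (a * d - b * c)" by (simp add: algebra_simps)
  moreover have "int N dvd c' * a + d' * c" using 1(2) 2(2) by simp
  ultimately show ?thesis unfolding equiv0_def using 1(1) 2(1) by (metis mult_1)
qed

lemma orbit0_Pt: "orbit0 N (Pt z) = Pt ` {w. equiv0 z w}"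
proof (intro equalityI subsetI)
  fix p assume "p \<in> orbit0 N (Pt z)"
  then obtain A where A: "A \<in> Gamma0 N" "p = Pt (act A z)" by (auto simp: orbit0_def)
  then have "equiv0 z (act A z)"
    unfolding equiv0_def act_eq_mob Gamma0_def SL2Z_iff by blast
  then show "p \<in> Pt ` {w. equiv0 z w}" using A(2) by blast
next
  fix p assume "p \<in> Pt ` {w. equiv0 z w}"
  then obtain a b c d where 1: "a * d - b * c = 1" "int N dvd c" "p = Pt (mob a b c d z)"
    unfolding equiv0_def by blast
  have "mk_mat a b c d \<in> Gamma0 N" using 1 by (simp add: Gamma0_def SL2Z_iff)
  moreover have "p = ext_act (mk_mat a b c d) (Pt z)" using 1(3) by (simp add: act_eq_mob)
  ultimately show "p \<in> orbit0 N (Pt z)" unfolding orbit0_def by blast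
qed

lemma mem_orbit0: "p \<in> orbit0 N p"
proof -
  have "mk_mat 1 0 0 1 \<in> Gamma0 N" by (simp add: Gamma0_def SL2Z_iff)
  moreover have "ext_act (mk_mat 1 0 0 1) p = p" by (cases p) (simp_all add: act_eq_mob)
  ultimately show ?thesis unfolding orbit0_def by (metis image_eqI)
qed

section \<open>The quotient map from the upper half plane to X_0(N)\<close>

definition proj :: "complex \<Rightarrow> ext_upper set" where
  "proj z = orbit0 N (Pt z)"

lemma proj_eq_iff:
  assumes "Im z > 0" "Im w > 0"
  shows "proj z = proj w \<longleftrightarrow> equiv0 z w"
proof
  assume "proj z = proj w"
  then have "Pt w \<in> orbit0 N (Pt z)" using mem_orbit0[of "Pt w"] by (simp add: proj_def)
  then show "equiv0 z w" by (auto simp: orbit0_Pt)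
next
  assume e: "equiv0 z w"
  have "equiv0 z u \<longleftrightarrow> equiv0 w u" for u
    using equiv0_trans[OF equiv0_sym[OF e assms(1)] _ assms(2)] equiv0_trans[OF e _ assms(1)] by blast
  then show "proj z = proj w" by (simp add: proj_def orbit0_Pt)
qed

lemma continuous_on_mob:
  assumes "a * d - b * c = 1"
  shows "continuous_on upper_half (mob a b c d)"
  using has_field_derivative_mob[OF assms] DERIV_isCont
  by (intro continuous_at_imp_continuous_on) blast

lemma open_mob_preimage:
  assumes "a * d - b * c = 1" "open B"
  shows "open {z. Im z > 0 \<and> mob a b c d z \<in> B}"
proof -
  have "open (upper_half \<inter> mob a b c d -` B)"
    by (rule continuous_open_preimage[OF continuous_on_mob[OF assms(1)] open_upper_half assms(2)])
  also have "upper_half \<inter> mob a b c d -` B = {z. Im z > 0 \<and> mob a b c d z \<in> B}" by auto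
  finally show ?thesis .
qed

text \<open>The preimage is the union of the translates of \<open>B\<close>. It contains no cusp,
  because the orbit of an interior point consists of interior points, so the horocycle conditions
  hold vacuously.\<close>

lemma openin_proj_image:
  assumes B: "open B" "B \<subseteq> upper_half"
  shows "openin (X0_top N) (proj ` B)"
proof -
  have B': "Pt ` B \<subseteq> ext_upper_points" using B(2) by (auto simp: ext_upper_points_def)
  define S where "S = {p \<in> ext_upper_points. orbit0 N p \<in> proj ` B}"
  have noncusp: "\<exists>z. p = Pt z \<and> Im z > 0" if p: "p \<in> S" for p
  proof -
    obtain w where w: "w \<in> B" "orbit0 N p = orbit0 N (Pt w)" using p by (auto simp: S_def proj_def)
    then have "p \<in> Pt ` {u. equiv0 w u}" using mem_orbit0[of p] by (simp add: orbit0_Pt)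
    then show ?thesis using equiv0_Im w(1) B(2) by auto
  qed
  have eq: "{z. Im z > 0 \<and> Pt z \<in> S} = (\<Union>(a, b, c, d) \<in> {(a, b, c, d). a * d - b * c = 1 \<and> int N dvd c}.
      {z. Im z > 0 \<and> mob a b c d z \<in> B})" (is "_ = ?R")
  proof (intro equalityI subsetI)
    fix z assume z: "z \<in> {z. Im z > 0 \<and> Pt z \<in> S}"
    then obtain w where w: "w \<in> B" "proj z = proj w" by (auto simp: S_def proj_def)
    then have "equiv0 z w" using proj_eq_iff[of z w] z B(2) by auto
    then show "z \<in> ?R" using z w(1) unfolding equiv0_def by force
  next
    fix z assume "z \<in> ?R"
    then obtain a b c d where 1: "a * d - b * c = 1" "int N dvd c" "Im z > 0" "mob a b c d z \<in> B" by auto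
    then have "equiv0 z (mob a b c d z)" unfolding equiv0_def by blast
    then have "proj z = proj (mob a b c d z)" using 1 Im_mob_pos by (subst proj_eq_iff) auto
    then show "z \<in> {z. Im z > 0 \<and> Pt z \<in> S}" using 1 by (auto simp: S_def ext_upper_points_def proj_def)
  qed
  have "open {z. Im z > 0 \<and> Pt z \<in> S}"
    unfolding eq using B(1) by (auto intro!: open_UN open_mob_preimage)
  moreover have "Cusp_inf \<notin> S" "Cusp r \<notin> S" for r using noncusp by blast+
  moreover have "S \<subseteq> ext_upper_points" by (auto simp: S_def)
  ultimately have "ext_upper_open S" unfolding ext_upper_open_def by blast
  then show ?thesis
    unfolding openin_X0_top X0_open_def openin_ext_upper_top S_def
    using B' by (auto simp: proj_def)
qed

lemma continuous_map_proj: "continuous_map (top_of_set upper_half) (X0_top N) proj"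
  unfolding continuous_map
proof (intro conjI allI impI)
  show "proj ` topspace (top_of_set upper_half) \<subseteq> topspace (X0_top N)"
    by (auto simp: topspace_X0_top proj_def ext_upper_points_def)
  fix V assume "openin (X0_top N) V"
  then have "open {z. Im z > 0 \<and> Pt z \<in> {p \<in> ext_upper_points. orbit0 N p \<in> V}}"
    unfolding openin_X0_top X0_open_def openin_ext_upper_top ext_upper_open_def by blast
  also have "{z. Im z > 0 \<and> Pt z \<in> {p \<in> ext_upper_points. orbit0 N p \<in> V}} =
      {x \<in> topspace (top_of_set upper_half). proj x \<in> V}"
    by (auto simp: proj_def ext_upper_points_def)
  finally show "openin (top_of_set upper_half) {x \<in> topspace (top_of_set upper_half). proj x \<in> V}"
    by (intro open_subset) auto
qed

section \<open>Proper discontinuity of the modular group\<close>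

lemma int_abs_Im_le:
  fixes c d :: int
  shows "\<bar>of_int c\<bar> * \<bar>Im z\<bar> \<le> cmod (of_int c * z + of_int d)"
  using abs_Im_le_cmod[of "of_int c * z + of_int d"] by (simp add: abs_mult)

text \<open>Both z and its image have imaginary part between y/2 and 3y/2, which forces |c z + d|^2
  < 4. This bounds c and then d. The numerator a z + b is the image times c z + d, which bounds a
  and then b.\<close>

lemma mob_entries_bounded:
  assumes z0: "Im z0 > 0"
  shows "\<exists>M::int. \<forall>a b c d z. a * d - b * c = 1 \<longrightarrow> z \<in> ball z0 (Im z0 / 2) \<longrightarrow>
    mob a b c d z \<in> ball z0 (Im z0 / 2) \<longrightarrow> \<bar>a\<bar> \<le> M \<and> \<bar>b\<bar> \<le> M \<and> \<bar>c\<bar> \<le> M \<and> \<bar>d\<bar> \<le> M"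
proof -
  define y where "y = Im z0"
  define R where "R = cmod z0 + y"
  define Ma where "Ma = 4 * R / y"
  define Mb where "Mb = 2 * R + Ma * R"
  define Mc where "Mc = 4 / y"
  define Md where "Md = 2 + Mc * R"
  have y: "y > 0" using z0 by (simp add: y_def)
  have R: "R > 0" using y by (simp add: R_def add_nonneg_pos)
  have ball: "Im z > y / 2 \<and> Im z < 3 * y / 2 \<and> cmod z \<le> R" if "z \<in> ball z0 (Im z0 / 2)" for z
  proof -
    have d: "cmod (z0 - z) < y / 2" using that by (simp add: dist_norm y_def)
    then have "\<bar>y - Im z\<bar> < y / 2" using abs_Im_le_cmod[of "z0 - z"] by (simp add: y_def)
    moreover have "cmod z \<le> cmod z0 + cmod (z0 - z)" using norm_triangle_sub[of z z0] by (simp add: norm_minus_commute)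
    ultimately show ?thesis using d y by (auto simp: R_def abs_if split: if_splits)
  qed
  have main: "\<bar>real_of_int a\<bar> \<le> Ma \<and> \<bar>real_of_int b\<bar> \<le> Mb \<and> \<bar>real_of_int c\<bar> \<le> Mc \<and> \<bar>real_of_int d\<bar> \<le> Md"
    if 1: "a * d - b * c = 1" and z: "z \<in> ball z0 (Im z0 / 2)" and w: "mob a b c d z \<in> ball z0 (Im z0 / 2)"
    for a b c d z
  proof -
    have z': "Im z > y / 2" "Im z < 3 * y / 2" "cmod z \<le> R" using ball[OF z] by auto
    have w': "Im (mob a b c d z) > y / 2" "cmod (mob a b c d z) \<le> R" using ball[OF w] by auto
    have zp: "Im z > 0" using z' y by linarith
    define j where "j = of_int c * z + of_int d"
    have jnz: "j \<noteq> 0" unfolding j_def by (rule mob_den_nz[OF 1 zp])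
    have "y / 2 * (cmod j)\<^sup>2 < Im (mob a b c d z) * (cmod j)\<^sup>2"
      using w' jnz by (intro mult_strict_right_mono) auto
    also have "\<dots> = Im z" using jnz by (simp add: Im_mob[OF 1 zp] j_def)
    also have "\<dots> < 3 * y / 2" by (rule z')
    finally have "(cmod j)\<^sup>2 < 2\<^sup>2" using y by (simp add: field_simps)
    then have j2: "cmod j < 2" by (rule power_less_imp_less_base) simp
    have num: "of_int a * z + of_int b = mob a b c d z * j"
      using jnz by (simp add: mob_def j_def)
    have n2: "cmod (of_int a * z + of_int b) \<le> 2 * R"
      unfolding num norm_mult using mult_mono[OF w'(2) less_imp_le[OF j2]] R by (simp add: mult.commute)
    have "\<bar>real_of_int c\<bar> * (y / 2) \<le> \<bar>real_of_int c\<bar> * \<bar>Im z\<bar>" using z' zp by (intro mult_left_mono) auto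
    also have "\<dots> \<le> 2" using int_abs_Im_le[of c z d] j2 unfolding j_def by linarith
    finally have c: "\<bar>real_of_int c\<bar> \<le> Mc" using y by (simp add: Mc_def field_simps)
    have "\<bar>real_of_int a\<bar> * (y / 2) \<le> \<bar>real_of_int a\<bar> * \<bar>Im z\<bar>" using z' zp by (intro mult_left_mono) auto
    also have "\<dots> \<le> 2 * R" using int_abs_Im_le[of a z b] n2 by linarith
    finally have a: "\<bar>real_of_int a\<bar> \<le> Ma" using y by (simp add: Ma_def field_simps)
    have "cmod (of_int d) \<le> cmod j + cmod (of_int c * z)"
      using norm_triangle_ineq4[of j "of_int c * z"] by (simp add: j_def)
    also have "\<dots> \<le> 2 + Mc * R"
      unfolding norm_mult using j2 mult_mono[OF c z'(3)] y by (auto simp: Mc_def intro!: add_mono)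
    finally have d: "\<bar>real_of_int d\<bar> \<le> Md" by (simp add: Md_def)
    have "cmod (of_int b) \<le> cmod (of_int a * z + of_int b) + cmod (of_int a * z)"
      using norm_triangle_ineq4[of "of_int a * z + of_int b" "of_int a * z"] by simp
    also have "\<dots> \<le> 2 * R + Ma * R"
      unfolding norm_mult using n2 mult_mono[OF a z'(3)] y R by (auto simp: Ma_def intro!: add_mono)
    finally have b: "\<bar>real_of_int b\<bar> \<le> Mb" by (simp add: Mb_def)
    show ?thesis using a b c d by blast
  qed
  define M where "M = max (max \<lceil>Ma\<rceil> \<lceil>Mb\<rceil>) (max \<lceil>Mc\<rceil> \<lceil>Md\<rceil>)"
  have "\<bar>x\<bar> \<le> M" if "\<bar>real_of_int x\<bar> \<le> Ma \<or> \<bar>real_of_int x\<bar> \<le> Mb \<or> \<bar>real_of_int x\<bar> \<le> Mc \<or> \<bar>real_of_int x\<bar> \<le> Md" for x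
    using that unfolding M_def by linarith
  then show ?thesis using main by blast
qed

text \<open>Only finitely many matrices can return to the ball of radius Im z0 / 2. Those that move
  \<open>z0\<close> are excluded by shrinking the radius, and the stabilizer of \<open>z0\<close>
  remains.\<close>

lemma mob_properly_discontinuous:
  assumes z0: "Im z0 > 0"
  shows "\<exists>\<delta>>0. ball z0 \<delta> \<subseteq> upper_half \<and> (\<forall>a b c d z. a * d - b * c = 1 \<longrightarrow> z \<in> ball z0 \<delta> \<longrightarrow>
    mob a b c d z \<in> ball z0 \<delta> \<longrightarrow> mob a b c d z0 = z0)"
proof -
  obtain M :: int where M: "\<And>a b c d z. a * d - b * c = 1 \<Longrightarrow> z \<in> ball z0 (Im z0 / 2) \<Longrightarrow>
    mob a b c d z \<in> ball z0 (Im z0 / 2) \<Longrightarrow> \<bar>a\<bar> \<le> M \<and> \<bar>b\<bar> \<le> M \<and> \<bar>c\<bar> \<le> M \<and> \<bar>d\<bar> \<le> M"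
    using mob_entries_bounded[OF z0] by blast
  define F where "F = {(a, b, c, d). a * d - b * c = 1 \<and> mob a b c d z0 \<noteq> z0} \<inter>
    ({-M..M} \<times> {-M..M} \<times> {-M..M} \<times> {-M..M})"
  have fin: "finite F" unfolding F_def by (intro finite_Int disjI2 finite_cartesian_product) auto
  have ev: "eventually (\<lambda>\<delta>. \<forall>z\<in>ball z0 \<delta>. mob a b c d z \<notin> ball z0 \<delta>) (at_right 0)"
    if 1: "a * d - b * c = 1" and ne: "mob a b c d z0 \<noteq> z0" for a b c d
  proof -
    define e where "e = dist (mob a b c d z0) z0 / 2"
    have e: "e > 0" using ne by (simp add: e_def)
    have "isCont (mob a b c d) z0" using has_field_derivative_mob[OF 1 z0] by (rule DERIV_isCont)
    then obtain r where r: "r > 0" "\<And>z. dist z z0 < r \<Longrightarrow> dist (mob a b c d z) (mob a b c d z0) < e"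
      using e unfolding continuous_at_eps_delta by blast
    have "\<forall>z\<in>ball z0 \<delta>. mob a b c d z \<notin> ball z0 \<delta>" if "\<delta> < min r e" for \<delta>
    proof
      fix z assume "z \<in> ball z0 \<delta>"
      then have "dist (mob a b c d z) (mob a b c d z0) < e" using that by (intro r(2)) (simp add: dist_commute)
      then have "dist (mob a b c d z) z0 > e"
        using dist_triangle[of "mob a b c d z0" z0 "mob a b c d z"] by (simp add: e_def dist_commute)
      then show "mob a b c d z \<notin> ball z0 \<delta>" using that by (simp add: dist_commute)
    qed
    then show ?thesis
      using eventually_at_right_real[of 0 "min r e"] r(1) e by (auto elim!: eventually_mono)
  qed
  have "eventually (\<lambda>\<delta>. \<forall>p\<in>F. case p of (a, b, c, d) \<Rightarrow> \<forall>z\<in>ball z0 \<delta>. mob a b c d z \<notin> ball z0 \<delta>) (at_right 0)"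
    by (rule eventually_ball_finite[OF fin]) (auto simp: F_def simp del: mem_ball intro!: ev)
  moreover have "eventually (\<lambda>\<delta>. \<delta> \<in> {0<..<Im z0 / 2}) (at_right 0)"
    by (rule eventually_at_right_real) (use z0 in simp)
  ultimately have "eventually (\<lambda>\<delta>. (\<forall>p\<in>F. case p of (a, b, c, d) \<Rightarrow> \<forall>z\<in>ball z0 \<delta>. mob a b c d z \<notin> ball z0 \<delta>) \<and>
      \<delta> \<in> {0<..<Im z0 / 2}) (at_right 0)" by (rule eventually_conj)
  then obtain \<delta> where \<delta>: "\<forall>p\<in>F. case p of (a, b, c, d) \<Rightarrow> \<forall>z\<in>ball z0 \<delta>. mob a b c d z \<notin> ball z0 \<delta>"
    "0 < \<delta>" "\<delta> < Im z0 / 2"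
    using eventually_happens'[OF trivial_limit_at_right_real] by force
  have "Im z > 0" if "z \<in> ball z0 \<delta>" for z
  proof -
    have "\<bar>Im (z0 - z)\<bar> < Im z0 / 2"
      using that \<delta>(3) abs_Im_le_cmod[of "z0 - z"] by (simp add: dist_norm)
    then show ?thesis using z0 by (simp add: abs_if split: if_splits)
  qed
  moreover have "mob a b c d z0 = z0" if "a * d - b * c = 1" "z \<in> ball z0 \<delta>" "mob a b c d z \<in> ball z0 \<delta>" for a b c d z
  proof (rule ccontr)
    assume "mob a b c d z0 \<noteq> z0"
    moreover have "\<bar>a\<bar> \<le> M \<and> \<bar>b\<bar> \<le> M \<and> \<bar>c\<bar> \<le> M \<and> \<bar>d\<bar> \<le> M"
      by (rule M[OF that(1), of z]) (use that(2,3) \<delta>(3) in auto)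
    ultimately have "(a, b, c, d) \<in> F" using that(1) by (auto simp: F_def)
    then have "\<forall>z\<in>ball z0 \<delta>. mob a b c d z \<notin> ball z0 \<delta>" using \<delta>(1) by fast
    then show False using that by blast
  qed
  ultimately show ?thesis using \<delta>(2) by blast
qed

text \<open>G is not invariant under Gamma0(N), but on a small ball equivalent points are related by
  matrices fixing \<open>z0\<close>. For these the constant in \<open>G_mob_const\<close> is 0, as
  evaluation at \<open>z0\<close> shows. So G descends near every point, elliptic ones
  included.\<close>

lemma local_primitive_exists:
  assumes z0: "Im z0 > 0"
  shows "\<exists>B F. open B \<and> z0 \<in> B \<and> B \<subseteq> upper_half \<and> local_primitive N f (proj ` B) F \<and>
    (\<forall>z\<in>B. F (proj z) = G z)"
proof -
  obtain \<delta> where \<delta>: "\<delta> > 0" "ball z0 \<delta> \<subseteq> upper_half" "\<And>a b c d z. a * d - b * c = 1 \<Longrightarrow> z \<in> ball z0 \<delta> \<Longrightarrow>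
    mob a b c d z \<in> ball z0 \<delta> \<Longrightarrow> mob a b c d z0 = z0"
    using mob_properly_discontinuous[OF z0] by blast
  define B where "B = ball z0 \<delta>"
  have B: "open B" "z0 \<in> B" "B \<subseteq> upper_half" using \<delta> by (auto simp: B_def)
  define F where "F P = G (SOME z. z \<in> B \<and> proj z = P)" for P
  have F: "F (proj z) = G z" if z: "z \<in> B" for z
  proof -
    define w where "w = (SOME w. w \<in> B \<and> proj w = proj z)"
    have w: "w \<in> B" "proj w = proj z"
      using someI[of "\<lambda>w. w \<in> B \<and> proj w = proj z" z] z unfolding w_def by auto
    have "equiv0 z w" using w z B(3) proj_eq_iff[of z w] by auto
    then obtain a b c d where 1: "a * d - b * c = 1" "int N dvd c" "w = mob a b c d z"
      unfolding equiv0_def by blast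
    obtain C where C: "\<And>z. Im z > 0 \<Longrightarrow> G (mob a b c d z) = G z + C" using G_mob_const[OF 1(1,2)] by blast
    have "mob a b c d z0 = z0" using \<delta>(3)[OF 1(1), of z] z w 1(3) by (simp add: B_def)
    then have "C = 0" using C[OF z0] by simp
    moreover have "Im z > 0" using z B(3) by auto
    ultimately have "G w = G z" using C[of z] 1(3) by simp
    then show ?thesis by (simp add: F_def w_def)
  qed
  have contG: "continuous_on upper_half G"
    using G_deriv DERIV_isCont by (intro continuous_at_imp_continuous_on) blast
  have U: "openin (X0_top N) (proj ` B)" by (rule openin_proj_image[OF B(1,3)])
  have "continuous_map (subtopology (X0_top N) (proj ` B)) euclidean F"
    unfolding continuous_map
  proof (intro conjI allI impI)
    fix V :: "complex set" assume "openin euclidean V"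
    then have "open V" by simp
    then have "open (B \<inter> G -` V)"
      by (intro continuous_open_preimage[OF continuous_on_subset[OF contG] B(1)] B(3))
    then have "openin (X0_top N) (proj ` (B \<inter> G -` V))" using B(3) by (intro openin_proj_image) auto
    moreover have "{x \<in> topspace (subtopology (X0_top N) (proj ` B)). F x \<in> V} = proj ` (B \<inter> G -` V)"
      using openin_subset[OF U] F by auto
    ultimately show "openin (subtopology (X0_top N) (proj ` B))
        {x \<in> topspace (subtopology (X0_top N) (proj ` B)). F x \<in> V}"
      by (auto simp: openin_open_subtopology[OF U])
  qed auto
  \<comment> \<open>The derivative is required at every point lying over the open set, not only in
    \<open>B\<close>: a matrix moves z into \<open>B\<close> and changes G by a constant.\<close>
  moreover have "((\<lambda>w. F (orbit0 N (Pt w))) has_field_derivative 2 * of_real pi * \<i> * f z) (at z)"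
    if z: "Im z > 0" "orbit0 N (Pt z) \<in> proj ` B" for z
  proof -
    obtain w where w: "w \<in> B" "proj z = proj w" using z(2) by (auto simp: proj_def)
    then have "equiv0 z w" using z(1) B(3) proj_eq_iff[of z w] by auto
    then obtain a b c d where 1: "a * d - b * c = 1" "int N dvd c" "w = mob a b c d z"
      unfolding equiv0_def by blast
    obtain C where C: "\<And>z. Im z > 0 \<Longrightarrow> G (mob a b c d z) = G z + C" using G_mob_const[OF 1(1,2)] by blast
    define S where "S = {z. Im z > 0 \<and> mob a b c d z \<in> B}"
    have S: "open S" "z \<in> S" unfolding S_def using open_mob_preimage[OF 1(1) B(1)] z(1) w(1) 1(3) by auto
    have "((\<lambda>z. G z + C) has_field_derivative 2 * of_real pi * \<i> * f z) (at z)"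
      using DERIV_add[OF G_deriv[OF z(1)] DERIV_const[of C]] by simp
    then show ?thesis
    proof (rule has_field_derivative_transform_within_open[OF _ S])
      fix u assume "u \<in> S"
      then have u: "Im u > 0" "mob a b c d u \<in> B" by (auto simp: S_def)
      then have "equiv0 u (mob a b c d u)" unfolding equiv0_def using 1 by blast
      then have "proj u = proj (mob a b c d u)" using u Im_mob_pos[OF 1(1)] by (subst proj_eq_iff) auto
      then show "G u + C = F (orbit0 N (Pt u))" using F[OF u(2)] C[OF u(1)] by (simp add: proj_def)
    qed
  qed
  ultimately have "local_primitive N f (proj ` B) F" unfolding local_primitive_def using U by blast
  then show ?thesis using B F by blast
qed

text \<open>G along the lifted path is the function whose increments agree locally with those of the
  local primitives.\<close>

lemma has_path_integral_proj:
  assumes cont: "continuous_on {0..1} g" and Im: "\<And>t. t \<in> {0..1} \<Longrightarrow> Im (g t) > 0"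
    and p: "\<And>t. t \<in> {0..1} \<Longrightarrow> p t = proj (g t)"
  shows "has_path_integral N f p (G (g 1) - G (g 0))"
  unfolding has_path_integral_def
proof (intro exI[of _ "\<lambda>t. G (g t)"] conjI ballI refl)
  fix t :: real assume t: "t \<in> {0..1}"
  obtain B F where B: "open B" "g t \<in> B" "B \<subseteq> upper_half" "local_primitive N f (proj ` B) F"
    "\<forall>z\<in>B. F (proj z) = G z"
    using local_primitive_exists[OF Im[OF t]] by blast
  have "(g \<longlongrightarrow> g t) (at t within {0..1})" using cont t by (auto simp: continuous_on_def)
  then have "eventually (\<lambda>s. g s \<in> B) (at t within {0..1})" using B(1,2) by (rule topological_tendstoD)
  moreover have "eventually (\<lambda>s. s \<in> {0..1}) (at t within {0..1})" by (simp add: eventually_at_filter)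
  ultimately have ev: "\<forall>\<^sub>F s in at t within {0..1}. p s \<in> proj ` B \<and> G (g s) - G (g t) = F (p s) - F (p t)"
    by eventually_elim (use B(2,5) p t in auto)
  have "p t \<in> proj ` B" using p[OF t] B(2) by simp
  then show "\<exists>U F. local_primitive N f U F \<and> p t \<in> U \<and>
         (\<forall>\<^sub>F s in at t within {0..1}. p s \<in> U \<and> G (g s) - G (g t) = F (p s) - F (p t))"
    using B(4) ev by blast
qed

text \<open>The segment from \<open>z0\<close> to \<open>z1\<close> projects to a loop, since its
  endpoints are equivalent. A singular 1-simplex with equal faces is a cycle, and its integral is
  the increment of G along the lift.\<close>

lemma primitive_diff_mem_lattice:
  assumes z: "Im z0 > 0" "Im z1 > 0" and e: "proj z0 = proj z1"
  shows "G z1 - G z0 \<in> period_lattice N f"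
proof -
  define g where "g t = (1 - t) *\<^sub>R z0 + t *\<^sub>R z1" for t :: real
  have cont: "continuous_on {0..1} g" unfolding g_def by (intro continuous_intros)
  have Im: "g t \<in> upper_half" if "t \<in> {0..1}" for t
    using convexD_alt[OF convex_upper_half, of z0 z1 t] z that by (simp add: g_def)
  have g01: "g 0 = z0" "g 1 = z1" by (simp_all add: g_def)
  \<comment> \<open>Singular simplices are required to be extensional, hence the restriction; on the
    simplex the coordinate \<open>x 1\<close> is the parameter of the path.\<close>
  define \<sigma> where "\<sigma> = restrict (\<lambda>x. proj (g (x 1))) (standard_simplex 1)"
  have s1: "x 1 \<in> {0..1}" if "x \<in> standard_simplex 1" for x
    using that by (auto simp: standard_simplex_def)
  have "continuous_map (subtopology (powertop_real UNIV) (standard_simplex 1)) (top_of_set {0..1}) (\<lambda>x. x 1)"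
    unfolding continuous_map_in_subtopology
    using s1 by (auto intro!: continuous_map_from_subtopology continuous_map_product_projection)
  moreover have "continuous_map (top_of_set {0..1}) (top_of_set upper_half) g"
    using cont Im by (auto simp: continuous_map_in_subtopology)
  ultimately have "continuous_map (subtopology (powertop_real UNIV) (standard_simplex 1)) (X0_top N) (proj \<circ> (g \<circ> (\<lambda>x. x 1)))"
    by (intro continuous_map_compose[OF _ continuous_map_proj] continuous_map_compose)
  then have "continuous_map (subtopology (powertop_real UNIV) (standard_simplex 1)) (X0_top N) \<sigma>"
    by (rule continuous_map_eq) (auto simp: \<sigma>_def)
  then have simp\<sigma>: "singular_simplex 1 (X0_top N) \<sigma>"
    by (simp add: singular_simplex_def \<sigma>_def)
  have face: "singular_face 1 0 \<sigma> = singular_face 1 1 \<sigma>"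
  proof
    fix x
    show "singular_face 1 0 \<sigma> x = singular_face 1 1 \<sigma> x"
    proof (cases "x \<in> standard_simplex 0")
      case True
      then have x: "x 0 = 1" by (simp add: standard_simplex_def)
      have "simplical_face 0 x \<in> standard_simplex 1" "simplical_face 1 x \<in> standard_simplex 1"
        using True by (auto intro!: simplical_face_in_standard_simplex)
      then show ?thesis using True x e g01
        by (simp add: singular_face_def \<sigma>_def simplical_face_def)
    qed (simp add: singular_face_def)
  qed
  have "chain_boundary 1 (frag_of \<sigma>) = 0"
    using face by (simp add: chain_boundary_def frag_extend_of)
  then have cyc: "singular_relcycle 1 (X0_top N) {} (frag_of \<sigma>)"
    using simp\<sigma> by (simp add: singular_cycle singular_chain_of)
  then have mem: "homologous_rel_set 1 (X0_top N) {} (frag_of \<sigma>) \<in> carrier (homology_group 1 (X0_top N))"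
    using carrier_relative_homology_group[of 1 "X0_top N" "{}"] by auto
  have self: "frag_of \<sigma> \<in> homologous_rel_set 1 (X0_top N) {} (frag_of \<sigma>)"
    by simp
  have "has_path_integral N f (simplex_path \<sigma>) (G (g 1) - G (g 0))"
  proof (rule has_path_integral_proj[OF cont])
    fix t :: real assume t: "t \<in> {0..1}"
    then show "Im (g t) > 0" using Im by simp
    have "(\<lambda>i. if i = 0 then 1 - t else if i = 1 then t else 0) \<in> standard_simplex 1"
      using t by (auto simp: standard_simplex_def)
    then show "simplex_path \<sigma> t = proj (g t)" by (simp add: simplex_path_def \<sigma>_def)
  qed
  then have "has_chain_integral N f (frag_of \<sigma>) (G z1 - G z0)"
    unfolding has_chain_integral_def g01
    by (intro exI[of _ "\<lambda>_. G z1 - G z0"]) simp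
  then show ?thesis unfolding period_lattice_def using mem self by blast
qed

lemma period_mem_lattice:
  assumes 1: "a * d - b * c = 1" and 2: "int N dvd c"
    and C: "\<And>z. Im z > 0 \<Longrightarrow> G (mob a b c d z) = G z + C"
  shows "C \<in> period_lattice N f"
proof -
  have i: "Im \<i> > 0" by simp
  have "equiv0 \<i> (mob a b c d \<i>)" using 1 2 unfolding equiv0_def by blast
  then have "proj \<i> = proj (mob a b c d \<i>)" using Im_mob_pos[OF 1 i] by (subst proj_eq_iff) auto
  from primitive_diff_mem_lattice[OF i Im_mob_pos[OF 1 i] this]
  show ?thesis using C[OF i] by simp
qed

text \<open>As m is prime to k N, Bezout completes the column (k, m) to a matrix in Gamma0(N), which
  carries the cusp 0 to k/m.\<close>

lemma Gc_diff_mem_lattice: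
  assumes "coprime k (int m)" "coprime m N" "m \<noteq> 0"
  shows "Gc (of_int k / of_nat m) - Gc 0 \<in> period_lattice N f"
proof -
  have "coprime (int m) (k * int N)" using assms by (simp add: coprime_commute)
  then obtain u v where uv: "u * int m + v * (k * int N) = 1" using bezout_int[of "int m" "k * int N"] by auto
  have 1: "u * int m - k * (- v * int N) = 1" using uv by (simp add: algebra_simps)
  have 2: "int N dvd - v * int N" by simp
  obtain C where C: "\<And>z. Im z > 0 \<Longrightarrow> G (mob u k (- v * int N) (int m) z) = G z + C"
    using G_mob_const[OF 1 2] by blast
  have "C = Gc (of_int k / of_int (int m)) - Gc 0" by (rule period_eq_Gc[OF 1 2 _ C]) (use assms in auto)
  then show ?thesis using period_mem_lattice[OF 1 2 C] by simp
qed

end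

section \<open>Mellin transforms\<close>


lemma has_integral_Gamma_scaled:
  assumes s: "Re s > 0" and a: "a > 0"
  shows "((\<lambda>t. of_real t powr (s - 1) * of_real (exp (- a * t))) has_integral
    Gamma s * of_real a powr (- s)) {0<..}"
proof -
  define \<phi> where "\<phi> t = complex_of_real t powr (s - 1) / of_real (exp t)" for t
  have abs: "\<phi> absolutely_integrable_on {0<..}"
    unfolding \<phi>_def by (rule absolutely_integrable_Gamma_integral'[OF s])
  have int: "integral {0<..} \<phi> = Gamma s"
    unfolding \<phi>_def using Gamma_integral_complex'[OF s] by (rule integral_unique)
  have "has_bochner_integral lebesgue (\<lambda>t. indicator {0<..} t *\<^sub>R \<phi> t) (Gamma s)"
    using abs set_lebesgue_integral_eq_integral(2)[OF abs] int
    by (simp add: has_bochner_integral_iff set_integrable_def set_lebesgue_integral_def)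
  then have "has_bochner_integral lebesgue (\<lambda>t. indicator {0<..} (0 + a * t) *\<^sub>R \<phi> (0 + a * t)) (Gamma s /\<^sub>R \<bar>a\<bar>)"
    using a by (subst (asm) has_bochner_integral_lebesgue_real_affine_iff[where c = a and t = 0]) auto
  also have "(\<lambda>t. indicator {0<..} (0 + a * t) *\<^sub>R \<phi> (0 + a * t)) = (\<lambda>t. indicator {0<..} t *\<^sub>R \<phi> (a * t))"
    using a by (auto simp: indicator_def zero_less_mult_iff)
  finally have b: "has_bochner_integral lebesgue (\<lambda>t. indicator {0<..} t *\<^sub>R \<phi> (a * t)) (Gamma s /\<^sub>R \<bar>a\<bar>)" .
  have abs2: "(\<lambda>t. \<phi> (a * t)) absolutely_integrable_on {0<..}"
    using b by (simp add: has_bochner_integral_iff set_integrable_def)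
  have "integral {0<..} (\<lambda>t. \<phi> (a * t)) = Gamma s /\<^sub>R \<bar>a\<bar>"
    using b set_lebesgue_integral_eq_integral(2)[OF abs2]
    by (simp add: has_bochner_integral_iff set_lebesgue_integral_def)
  with set_lebesgue_integral_eq_integral(1)[OF abs2]
  have "((\<lambda>t. \<phi> (a * t)) has_integral Gamma s /\<^sub>R \<bar>a\<bar>) {0<..}"
    using has_integral_integral by metis
  from has_integral_mult_right[OF this, of "of_real a powr (1 - s)"]
  have "((\<lambda>t. of_real a powr (1 - s) * \<phi> (a * t)) has_integral of_real a powr (1 - s) * (Gamma s /\<^sub>R \<bar>a\<bar>)) {0<..}" .
  moreover have e1: "of_real a powr (1 - s) * \<phi> (a * t) = of_real t powr (s - 1) * of_real (exp (- a * t))"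
    if "t \<in> {0<..}" for t
  proof -
    have "of_real (a * t) powr (s - 1) = (of_real a powr (s - 1) * of_real t powr (s - 1) :: complex)"
      using a that by (simp add: powr_times_real)
    moreover have "of_real a powr (1 - s) * of_real a powr (s - 1) = (1 :: complex)"
      using a by (simp flip: powr_add)
    ultimately have "of_real a powr (1 - s) * of_real (a * t) powr (s - 1) = (of_real t powr (s - 1) :: complex)"
      by (simp add: mult.assoc[symmetric])
    then show ?thesis
      unfolding \<phi>_def by (simp add: exp_minus divide_inverse flip: mult.assoc)
  qed
  moreover have e2: "of_real a powr (1 - s) * (Gamma s /\<^sub>R \<bar>a\<bar>) = Gamma s * of_real a powr (- s)"
  proof -
    have "of_real a powr (1 - s) = of_real a * (of_real a powr (- s) :: complex)"
      using a powr_add[of "of_real a :: complex" 1 "- s"] by simp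
    then show ?thesis using a by (simp add: scaleR_conv_of_real)
  qed
  ultimately show ?thesis by (metis (no_types, lifting) has_integral_eq)
qed

lemma has_integral_Gamma_scaled_real:
  assumes "\<sigma> > 0" and a: "a > (0::real)"
  shows "((\<lambda>t. t powr (\<sigma> - 1) * exp (- a * t)) has_integral Gamma \<sigma> * a powr (- \<sigma>)) {0<..}"
proof -
  have "((\<lambda>t. Re (of_real t powr (of_real \<sigma> - 1) * of_real (exp (- a * t)))) has_integral
      Re (Gamma (of_real \<sigma>) * of_real a powr (- of_real \<sigma>))) {0<..}"
    using has_integral_linear[OF has_integral_Gamma_scaled[of "of_real \<sigma>" a] bounded_linear_Re] assms
    by (simp add: o_def)
  moreover have "Re (of_real t powr (of_real \<sigma> - 1) * of_real (exp (- a * t))) = t powr (\<sigma> - 1) * exp (- a * t)"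
    if "t \<in> {0<..}" for t
  proof -
    have "complex_of_real t powr (of_real \<sigma> - 1) = of_real (t powr (\<sigma> - 1))"
      using that powr_of_real[of t "\<sigma> - 1"] by simp
    then show ?thesis by simp
  qed
  moreover have "Re (Gamma (of_real \<sigma>) * of_real a powr (- of_real \<sigma>)) = Gamma \<sigma> * a powr (- \<sigma>)"
  proof -
    have "complex_of_real a powr (- of_real \<sigma>) = of_real (a powr (- \<sigma>))"
      using a powr_of_real[of a "- \<sigma>"] by simp
    then show ?thesis by (simp add: Gamma_complex_of_real)
  qed
  ultimately show ?thesis by (metis (no_types, lifting) has_integral_eq)
qed

text \<open>Up to a factor, an integrable majorant for all Mellin integrands.\<close>

definition dom_fun :: "real \<Rightarrow> real" where
  "dom_fun t = (if t \<le> 1 then 1 else t powr (- 2))"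

lemma dom_fun_integrable: "dom_fun integrable_on {0<..}"
proof -
  have a: "dom_fun integrable_on {0..1}"
    by (rule integrable_eq[of "\<lambda>_. 1"]) (auto simp: dom_fun_def)
  have b: "dom_fun integrable_on {1..}"
    by (rule integrable_eq[of "\<lambda>t. t powr (- 2)"])
       (use has_integral_powr_to_inf[of "-2" 1] in \<open>auto simp: dom_fun_def\<close>)
  have c: "negligible ({0..1} \<inter> {1..} :: real set)"
    by (rule negligible_subset[of "{1}"]) auto
  have "dom_fun integrable_on {0..1} \<union> {1..}"
    by (intro integrable_Un a b c)
  also have "{0..1} \<union> {1..} = {0::real..}" by auto
  finally have "dom_fun integrable_on {0..}" .
  then show ?thesis
    by (rule integrable_spike_set) (auto intro: negligible_subset[of "{0}"])
qed

text \<open>\<open>h\<close> stands for a combination of values of f on vertical lines,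
  \<open>H\<close> for the same combination of values of G, with limit \<open>H0\<close> at the
  cusps, and \<open>b\<close> for the coefficients of the resulting Dirichlet series.\<close>

locale mellin =
  fixes h H :: "real \<Rightarrow> complex" and b :: "nat \<Rightarrow> complex" and B :: real and H0 :: complex
  assumes cont: "continuous_on {0<..} h"
    and decay: "\<And>\<rho>. \<exists>C>0. \<forall>t>0. norm (h t) \<le> C * t powr \<rho>"
    and b_bound: "\<And>n. norm (b n) \<le> B * real (Suc n)"
    and series: "\<And>t. t > 0 \<Longrightarrow> (\<lambda>n. b n * of_real (exp (- (2 * pi * real (Suc n)) * t))) sums h t"
    and H_deriv: "\<And>t. t > 0 \<Longrightarrow> (H has_vector_derivative - 2 * of_real pi * h t) (at t)"
    and H_0: "(H \<longlongrightarrow> H0) (at_right 0)"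
    and H_inf: "(H \<longlongrightarrow> 0) at_top"
begin

definition \<phi> :: "complex \<Rightarrow> real \<Rightarrow> complex" where
  "\<phi> s t = h t * of_real t powr (s - 1)"

text \<open>Compact intervals exhausting the positive half line; the integrals truncated to them are
  entire in s.\<close>

definition I :: "nat \<Rightarrow> real set" where
  "I n = {1 / real (Suc n)..real (Suc n)}"

lemma I_pos: "t \<in> I n \<Longrightarrow> t > 0"
  unfolding I_def by (auto intro: less_le_trans[of _ "1 / real (Suc n)"])

lemma I_subset: "I n \<subseteq> {0<..}"
  using I_pos by auto

lemma I_eventually:
  assumes "t > 0"
  shows "eventually (\<lambda>n. t \<in> I n) sequentially"
proof -
  obtain m where m: "real m \<ge> max t (1 / t)" using real_arch_simple by blast
  have "t \<in> I n" if "n \<ge> m" for n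
  proof -
    have n: "real (Suc n) \<ge> max t (1 / t)" using m that by simp
    then have "1 / real (Suc n) \<le> t"
      using assms by (simp add: field_simps)
    then show ?thesis using n by (simp add: I_def)
  qed
  then show ?thesis unfolding eventually_sequentially by blast
qed

lemma norm_powr_le:
  fixes s :: complex
  assumes t: "t > 0" and s: "norm s \<le> R"
  shows "norm (of_real t powr (s - 1)) \<le> t powr (R + 1) + t powr (- R - 1)"
proof -
  have R: "\<bar>Re s\<bar> \<le> R" using abs_Re_le_cmod[of s] s by linarith
  have "norm (of_real t powr (s - 1)) = t powr (Re s - 1)"
    using t by (simp add: norm_powr_real_powr)
  also have "\<dots> \<le> t powr (R + 1) + t powr (- R - 1)"
  proof (cases "t \<ge> 1")
    case True
    have "t powr (Re s - 1) \<le> t powr (R + 1)" using True R by (intro powr_mono) auto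
    then show ?thesis by (smt (verit) powr_ge_zero)
  next
    case False
    have "t powr (Re s - 1) \<le> t powr (- R - 1)" using False t R by (intro powr_mono') auto
    then show ?thesis by (smt (verit) powr_ge_zero)
  qed
  finally show ?thesis .
qed

lemma \<phi>_bound:
  "\<exists>K>0. \<forall>s t. norm s \<le> R \<longrightarrow> t > 0 \<longrightarrow> norm (\<phi> s t) \<le> K * dom_fun t"
proof -
  define D where "D \<rho> = (SOME C. C > 0 \<and> (\<forall>t>0. norm (h t) \<le> C * t powr \<rho>))" for \<rho>
  have D: "D \<rho> > 0" "t > 0 \<Longrightarrow> norm (h t) \<le> D \<rho> * t powr \<rho>" for \<rho> t
    using someI_ex[OF decay[of \<rho>]] unfolding D_def by blast+
  \<comment> \<open>The first two exponents cancel t powr (R + 1) and t powr (- R - 1) for t <= 1;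
    the last two leave t powr (- 2) for t > 1.\<close>
  define K where "K = D (- R - 1) + D (R + 1) + D (- R - 3) + D (R - 1)"
  have "norm (\<phi> s t) \<le> K * dom_fun t" if s: "norm s \<le> R" and t: "t > 0" for s t
  proof -
    have "norm (\<phi> s t) \<le> norm (h t) * (t powr (R + 1) + t powr (- R - 1))"
      unfolding \<phi>_def norm_mult by (intro mult_left_mono norm_powr_le s t) auto
    also have "\<dots> \<le> K * dom_fun t"
    proof (cases "t \<le> 1")
      case True
      have "norm (h t) * t powr (R + 1) \<le> D (- R - 1) * t powr (- R - 1) * t powr (R + 1)"
        by (intro mult_right_mono D t) auto
      also have "\<dots> = D (- R - 1)" using t by (simp add: mult.assoc flip: powr_add)
      finally have 1: "norm (h t) * t powr (R + 1) \<le> D (- R - 1)" .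
      have "norm (h t) * t powr (- R - 1) \<le> D (R + 1) * t powr (R + 1) * t powr (- R - 1)"
        by (intro mult_right_mono D t) auto
      also have "\<dots> = D (R + 1)" using t by (simp add: mult.assoc flip: powr_add)
      finally have 2: "norm (h t) * t powr (- R - 1) \<le> D (R + 1)" .
      show ?thesis
        using 1 2 True D(1)[of "- R - 3"] D(1)[of "R - 1"] by (simp add: dom_fun_def K_def distrib_left)
    next
      case False
      have "norm (h t) * t powr (R + 1) \<le> D (- R - 3) * t powr (- R - 3) * t powr (R + 1)"
        by (intro mult_right_mono D t) auto
      also have "\<dots> = D (- R - 3) * t powr (- 2)" using t by (simp add: mult.assoc flip: powr_add)
      finally have 1: "norm (h t) * t powr (R + 1) \<le> D (- R - 3) * t powr (- 2)" .
      have "norm (h t) * t powr (- R - 1) \<le> D (R - 1) * t powr (R - 1) * t powr (- R - 1)"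
        by (intro mult_right_mono D t) auto
      also have "\<dots> = D (R - 1) * t powr (- 2)" using t by (simp add: mult.assoc flip: powr_add)
      finally have 2: "norm (h t) * t powr (- R - 1) \<le> D (R - 1) * t powr (- 2)" .
      have "norm (h t) * (t powr (R + 1) + t powr (- R - 1)) \<le> (D (- R - 3) + D (R - 1)) * t powr (- 2)"
        using 1 2 by (simp add: algebra_simps)
      also have "\<dots> \<le> K * t powr (- 2)"
        using D(1)[of "- R - 1"] D(1)[of "R + 1"] by (intro mult_right_mono) (auto simp: K_def)
      finally show ?thesis using False by (simp add: dom_fun_def)
    qed
    finally show ?thesis .
  qed
  moreover have "K > 0" unfolding K_def using D(1) by (simp add: add_pos_pos)
  ultimately show ?thesis by blast
qed

lemma continuous_on_\<phi>: "S \<subseteq> {0<..} \<Longrightarrow> continuous_on S (\<phi> s)"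
  unfolding \<phi>_def
  by (intro continuous_intros continuous_on_subset[OF cont]) auto

definition M where "M s = integral {0<..} (\<phi> s)"
definition Mn where "Mn n s = integral (I n) (\<phi> s)"

lemma \<phi>_integrable_I: "\<phi> s integrable_on I n"
  unfolding I_def by (rule integrable_continuous_interval) (rule continuous_on_\<phi>[OF I_subset[unfolded I_def]])

lemma \<phi>_restrict_integrable: "(\<lambda>t. if t \<in> I n then \<phi> s t else 0) integrable_on {0<..}"
proof -
  have "{0<..} \<inter> I n = I n" using I_subset by auto
  then show ?thesis
    using \<phi>_integrable_I[of s n] by (subst integrable_restrict_Int) (simp add: Int_commute)
qed

lemma Mn_eq: "Mn n s = integral {0<..} (\<lambda>t. if t \<in> I n then \<phi> s t else 0)"
proof -
  have e: "{0<..} \<inter> I n = I n" "I n \<inter> {0<..} = I n" using I_subset by auto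
  show ?thesis unfolding Mn_def by (simp add: integral_restrict_Int e)
qed

lemma \<phi>_integrable: "\<phi> s integrable_on {0<..}"
  and Mn_tendsto: "(\<lambda>n. Mn n s) \<longlonglongrightarrow> M s"
proof -
  obtain K where K: "K > 0" "\<And>t. t > 0 \<Longrightarrow> norm (\<phi> s t) \<le> K * dom_fun t"
    using \<phi>_bound[of "norm s"] by blast
  have dom: "dom_fun t \<ge> 0" for t by (simp add: dom_fun_def)
  have *: "norm (if t \<in> I n then \<phi> s t else 0) \<le> K * dom_fun t" if "t \<in> {0<..}" for t n
    using K(2)[of t] that K(1) dom[of t] by auto
  have int: "(\<lambda>t. K * dom_fun t) integrable_on {0<..}"
    by (intro integrable_on_mult_right dom_fun_integrable)
  have lim: "(\<lambda>n. if t \<in> I n then \<phi> s t else 0) \<longlonglongrightarrow> \<phi> s t" if "t \<in> {0<..}" for t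
    by (rule tendsto_eventually, rule eventually_mono[OF I_eventually[of t]]) (use that in auto)
  show "\<phi> s integrable_on {0<..}"
    by (rule dominated_convergence(1)[OF \<phi>_restrict_integrable int * lim])
  show "(\<lambda>n. Mn n s) \<longlonglongrightarrow> M s"
    unfolding Mn_eq M_def by (rule dominated_convergence(2)[OF \<phi>_restrict_integrable int * lim])
qed

text \<open>The tail of the majorant. It bounds the truncation error uniformly for bounded s, which
  gives locally uniform convergence of \<open>Mn\<close>.\<close>

definition \<epsilon> where "\<epsilon> n = integral {0<..} (\<lambda>t. if t \<in> I n then 0 else dom_fun t)"

lemma dom_restrict_integrable: "(\<lambda>t. if t \<in> I n then 0 else dom_fun t) integrable_on {0<..}"
  and \<epsilon>_tendsto: "\<epsilon> \<longlonglongrightarrow> 0"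
proof -
  have "dom_fun integrable_on I n" for n
    unfolding I_def by (rule integrable_on_subinterval[OF dom_fun_integrable]) (use I_subset[of n] in \<open>auto simp: I_def\<close>)
  moreover have "{0<..} \<inter> I n = I n" for n using I_subset by auto
  ultimately have 1: "(\<lambda>t. if t \<in> I n then dom_fun t else 0) integrable_on {0<..}" for n
    by (subst integrable_restrict_Int) (simp add: Int_commute)
  have "(\<lambda>t. dom_fun t - (if t \<in> I n then dom_fun t else 0)) integrable_on {0<..}" for n
    by (intro integrable_diff dom_fun_integrable 1)
  also have "(\<lambda>t. dom_fun t - (if t \<in> I n then dom_fun t else 0)) = (\<lambda>t. if t \<in> I n then 0 else dom_fun t)" for n
    by auto
  finally have 2: "(\<lambda>t. if t \<in> I n then 0 else dom_fun t) integrable_on {0<..}" for n .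
  then show "(\<lambda>t. if t \<in> I n then 0 else dom_fun t) integrable_on {0<..}" .
  have lim: "(\<lambda>n. if t \<in> I n then 0 else dom_fun t) \<longlonglongrightarrow> 0" if "t \<in> {0<..}" for t
    by (rule tendsto_eventually, rule eventually_mono[OF I_eventually[of t]]) (use that in auto)
  have "(\<lambda>n. integral {0<..} (\<lambda>t. if t \<in> I n then 0 else dom_fun t)) \<longlonglongrightarrow> integral {0<..} (\<lambda>t::real. 0)"
    by (rule dominated_convergence(2)[where f = "\<lambda>n t. if t \<in> I n then 0 else dom_fun t" and g = "\<lambda>_. 0",
          OF 2 dom_fun_integrable _ lim]) (auto simp: dom_fun_def)
  then show "\<epsilon> \<longlonglongrightarrow> 0" by (simp add: \<epsilon>_def[abs_def])
qed

lemma Mn_holomorphic: "Mn n holomorphic_on UNIV"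
proof -
  have I: "I n = cbox (1 / real (Suc n)) (real (Suc n))" by (simp add: I_def)
  have "(\<lambda>s. integral (cbox (1 / real (Suc n)) (real (Suc n))) (\<phi> s)) holomorphic_on UNIV"
  proof (rule leibniz_rule_holomorphic[where fx = "\<lambda>s t. h t * (of_real t powr (s - 1) * Ln (of_real t))"])
    fix s t assume "t \<in> cbox (1 / real (Suc n)) (real (Suc n))"
    then have t: "t > 0" using I_pos[of t n] unfolding I by blast
    show "((\<lambda>s. \<phi> s t) has_field_derivative h t * (of_real t powr (s - 1) * Ln (of_real t))) (at s within UNIV)"
    proof -
      have "((\<lambda>s. of_real t powr (s - 1)) has_field_derivative Ln (of_real t) * of_real t powr (s - 1) * 1) (at s)"
        by (rule DERIV_chain2[OF has_field_derivative_powr_right])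
           (use t in \<open>auto intro!: derivative_eq_intros\<close>)
      from DERIV_cmult[OF this, of "h t"] show ?thesis
        unfolding \<phi>_def by (simp add: mult_ac)
    qed
  next
    show "\<phi> s integrable_on cbox (1 / real (Suc n)) (real (Suc n))" for s
      using \<phi>_integrable_I[of s n] by (simp add: I)
  next
    have pos: "\<And>t. t \<in> cbox (1 / real (Suc n)) (real (Suc n)) \<Longrightarrow> t > 0"
      using I_pos[of _ n] unfolding I by blast
    have "continuous_on ((UNIV :: complex set) \<times> cbox (1 / real (Suc n)) (real (Suc n))) (\<lambda>p. h (snd p))"
      by (rule continuous_on_compose2[OF cont]) (use pos in \<open>auto intro!: continuous_intros\<close>)
    moreover have "\<forall>p\<in>(UNIV :: complex set) \<times> cbox (1 / real (Suc n)) (real (Suc n)). complex_of_real (snd p) \<notin> \<real>\<^sub>\<le>\<^sub>0"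
    proof
      fix p :: "complex \<times> real" assume "p \<in> UNIV \<times> cbox (1 / real (Suc n)) (real (Suc n))"
      then have "snd p > 0" by (intro pos) auto
      then show "complex_of_real (snd p) \<notin> \<real>\<^sub>\<le>\<^sub>0" by (simp add: complex_nonpos_Reals_iff)
    qed
    moreover have "continuous_on ((UNIV :: complex set) \<times> cbox (1 / real (Suc n)) (real (Suc n))) (\<lambda>p. complex_of_real (snd p))"
      by (intro continuous_intros)
    moreover have "continuous_on (UNIV \<times> cbox (1 / real (Suc n)) (real (Suc n))) (\<lambda>p. fst p - 1 :: complex)"
      by (intro continuous_intros)
    ultimately show "continuous_on (UNIV \<times> cbox (1 / real (Suc n)) (real (Suc n)))
        (\<lambda>(s, t). h t * (of_real t powr (s - 1) * Ln (of_real t)))"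
      unfolding case_prod_unfold
      by (intro continuous_on_mult continuous_on_powr_complex continuous_on_Ln') auto
  qed auto
  then show ?thesis by (simp add: Mn_def[abs_def] I)
qed

lemma M_holomorphic: "M holomorphic_on UNIV"
proof (rule holomorphic_uniform_sequence[OF open_UNIV Mn_holomorphic])
  fix s0 :: complex
  define R where "R = norm s0 + 1"
  obtain K where K: "K > 0" "\<And>s t. norm s \<le> R \<Longrightarrow> t > 0 \<Longrightarrow> norm (\<phi> s t) \<le> K * dom_fun t"
    using \<phi>_bound[of R] by blast
  have bound: "norm (M s - Mn n s) \<le> K * \<epsilon> n" if s: "s \<in> cball s0 1" for s n
  proof -
    have sR: "norm s \<le> R" using s norm_triangle_sub[of s s0] by (simp add: R_def dist_norm norm_minus_commute)
    have "M s - Mn n s = integral {0<..} (\<lambda>t. \<phi> s t - (if t \<in> I n then \<phi> s t else 0))"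
      unfolding Mn_eq M_def by (rule integral_diff[symmetric, OF \<phi>_integrable \<phi>_restrict_integrable])
    also have "norm \<dots> \<le> integral {0<..} (\<lambda>t. K * (if t \<in> I n then 0 else dom_fun t))"
    proof (rule integral_norm_bound_integral)
      show "(\<lambda>t. \<phi> s t - (if t \<in> I n then \<phi> s t else 0)) integrable_on {0<..}"
        by (intro integrable_diff \<phi>_integrable \<phi>_restrict_integrable)
      show "(\<lambda>t. K * (if t \<in> I n then 0 else dom_fun t)) integrable_on {0<..}"
        by (intro integrable_on_mult_right dom_restrict_integrable)
      fix t :: real assume "t \<in> {0<..}"
      then show "norm (\<phi> s t - (if t \<in> I n then \<phi> s t else 0)) \<le> K * (if t \<in> I n then 0 else dom_fun t)"
        using K(2)[OF sR, of t] by auto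
    qed
    also have "\<dots> = K * \<epsilon> n" by (simp add: \<epsilon>_def)
    finally show ?thesis .
  qed
  have "uniform_limit (cball s0 1) Mn M sequentially"
  proof (rule uniform_limitI)
    fix e :: real assume e: "e > 0"
    have "(\<lambda>n. K * \<epsilon> n) \<longlonglongrightarrow> K * 0" by (intro tendsto_intros \<epsilon>_tendsto)
    then have "eventually (\<lambda>n. K * \<epsilon> n < e) sequentially" using e by (simp add: order_tendstoD)
    then show "\<forall>\<^sub>F n in sequentially. \<forall>x\<in>cball s0 1. dist (Mn n x) (M x) < e"
    proof eventually_elim
      case (elim n)
      show ?case
      proof
        fix x assume "x \<in> cball s0 1"
        from bound[OF this, of n] elim show "dist (Mn n x) (M x) < e"
          by (simp add: dist_norm norm_minus_commute)
      qed
    qed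
  qed
  then show "\<exists>d>0. cball s0 d \<subseteq> UNIV \<and> uniform_limit (cball s0 d) Mn M sequentially"
    by (intro exI[of _ 1]) auto
qed

text \<open>At s = 1 the power of t is 1, and the integrand is a multiple of the derivative of
  \<open>H\<close>.\<close>

lemma M_1: "M 1 = H0 / (2 * of_real pi)"
proof -
  have Mn1: "Mn n 1 = (H (1 / real (Suc n)) - H (real (Suc n))) / (2 * of_real pi)" for n
  proof -
    have le: "1 / real (Suc n) \<le> real (Suc n)"
      by (simp add: field_simps)
    have "((\<lambda>t. - 2 * of_real pi * h t) has_integral H (real (Suc n)) - H (1 / real (Suc n))) {1 / real (Suc n)..real (Suc n)}"
    proof (rule fundamental_theorem_of_calculus[OF le])
      fix t assume "t \<in> {1 / real (Suc n)..real (Suc n)}"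
      then have "t > 0" using I_pos[of t n] unfolding I_def by blast
      then show "(H has_vector_derivative - 2 * of_real pi * h t) (at t within {1 / real (Suc n)..real (Suc n)})"
        by (rule has_vector_derivative_at_within[OF H_deriv])
    qed
    from has_integral_mult_right[OF this, of "- 1 / (2 * of_real pi)"]
    have "((\<lambda>t. (- 1 / (2 * of_real pi)) * (- 2 * of_real pi * h t)) has_integral
        (- 1 / (2 * of_real pi)) * (H (real (Suc n)) - H (1 / real (Suc n)))) (I n)"
      unfolding I_def .
    then have "(\<phi> 1 has_integral (- 1 / (2 * of_real pi)) * (H (real (Suc n)) - H (1 / real (Suc n)))) (I n)"
    proof (rule has_integral_eq[rotated])
      fix t assume "t \<in> I n"
      then have "t \<noteq> 0" using I_pos by fastforce
      then show "(- 1 / (2 * of_real pi)) * (- 2 * of_real pi * h t) = \<phi> 1 t" by (simp add: \<phi>_def)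
    qed
    then have "Mn n 1 = (- 1 / (2 * of_real pi)) * (H (real (Suc n)) - H (1 / real (Suc n)))"
      unfolding Mn_def by (rule integral_unique)
    then show ?thesis by (simp add: field_simps)
  qed
  have "filterlim (\<lambda>n. 1 / real (Suc n)) (at_right 0) sequentially" by real_asymp
  from filterlim_compose[OF H_0 this]
  have 1: "(\<lambda>n. H (1 / real (Suc n))) \<longlonglongrightarrow> H0" .
  have "filterlim (\<lambda>n. real (Suc n)) at_top sequentially" by real_asymp
  from filterlim_compose[OF H_inf this]
  have 2: "(\<lambda>n. H (real (Suc n))) \<longlonglongrightarrow> 0" .
  have "(\<lambda>n. Mn n 1) \<longlonglongrightarrow> (H0 - 0) / (2 * of_real pi)"
    unfolding Mn1 by (intro tendsto_intros 1 2) auto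
  with Mn_tendsto[of 1] show ?thesis using LIMSEQ_unique by force
qed

text \<open>Termwise integration. The absolute values have integrals of order n^(1 - Re s), summable
  for Re s > 2, so by monotone convergence their sum is an integrable majorant of all partial
  sums.\<close>

lemma M_sums:
  assumes s: "Re s > 2"
  shows "(\<lambda>n. b n * (Gamma s * of_real (2 * pi * real (Suc n)) powr (- s))) sums M s"
proof -
  define \<sigma> where "\<sigma> = Re s"
  define c where "c n = 2 * pi * real (Suc n)" for n
  have c: "c n > 0" for n by (simp add: c_def)
  define g where "g n t = b n * (of_real t powr (s - 1) * of_real (exp (- c n * t)))" for n t
  define gr where "gr n t = norm (b n) * (t powr (\<sigma> - 1) * exp (- c n * t))" for n t
  have g: "(g n has_integral b n * (Gamma s * of_real (c n) powr (- s))) {0<..}" for n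
    unfolding g_def using s c by (intro has_integral_mult_right has_integral_Gamma_scaled) auto
  have gr: "(gr n has_integral norm (b n) * (Gamma \<sigma> * c n powr (- \<sigma>))) {0<..}" for n
    unfolding gr_def using s c by (intro has_integral_mult_right has_integral_Gamma_scaled_real) (auto simp: \<sigma>_def)
  have ng: "norm (g n t) = gr n t" if "t > 0" for n t
    using that by (simp add: g_def gr_def norm_mult norm_powr_real_powr \<sigma>_def)
  have B: "B \<ge> 0" using order_trans[OF norm_ge_zero b_bound[of 0]] by simp
  have gr_summable: "summable (\<lambda>n. gr n t)" if t: "t > 0" for t
  proof (rule summable_comparison_test')
    define x where "x = exp (- (2 * pi * t))"
    have x: "norm x < 1" using t by (simp add: x_def)
    have "summable (\<lambda>n. of_nat (Suc n) * x ^ n)"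
      using geometric_deriv_sums[OF x] sums_summable by auto
    then show "summable (\<lambda>n. B * t powr (\<sigma> - 1) * x * (of_nat (Suc n) * x ^ n))"
      by (rule summable_mult)
    fix n :: nat assume "n \<ge> 0"
    have e: "exp (- c n * t) = x * x ^ n"
      unfolding x_def c_def exp_of_nat_mult[symmetric] exp_add[symmetric] by (simp add: algebra_simps)
    have "gr n t \<le> (B * real (Suc n)) * (t powr (\<sigma> - 1) * exp (- c n * t))"
      unfolding gr_def by (intro mult_right_mono b_bound) auto
    then show "norm (gr n t) \<le> B * t powr (\<sigma> - 1) * x * (of_nat (Suc n) * x ^ n)"
      unfolding e by (simp add: gr_def e mult_ac)
  qed
  have gr_nonneg: "gr n t \<ge> 0" for n t by (simp add: gr_def)
  have int_summable: "summable (\<lambda>n. norm (b n) * (Gamma \<sigma> * c n powr (- \<sigma>)))"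
  proof (rule summable_comparison_test')
    have "summable (\<lambda>n. real (Suc n) powr (1 - \<sigma>))"
      using s by (subst summable_Suc_iff) (simp add: summable_real_powr_iff \<sigma>_def)
    then show "summable (\<lambda>n. B * \<bar>Gamma \<sigma>\<bar> * (2 * pi) powr (- \<sigma>) * real (Suc n) powr (1 - \<sigma>))"
      by (rule summable_mult)
    fix n :: nat assume "n \<ge> 0"
    have e: "c n powr (- \<sigma>) * real (Suc n) = (2 * pi) powr (- \<sigma>) * real (Suc n) powr (1 - \<sigma>)"
      unfolding c_def by (simp add: powr_mult powr_diff powr_minus divide_inverse del: of_nat_Suc)
    have "norm (norm (b n) * (Gamma \<sigma> * c n powr (- \<sigma>))) = norm (b n) * (\<bar>Gamma \<sigma>\<bar> * c n powr (- \<sigma>))"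
      by (simp add: abs_mult)
    also have "\<dots> \<le> (B * real (Suc n)) * (\<bar>Gamma \<sigma>\<bar> * c n powr (- \<sigma>))"
      by (intro mult_right_mono b_bound) auto
    also have "\<dots> = B * \<bar>Gamma \<sigma>\<bar> * (c n powr (- \<sigma>) * real (Suc n))" by (simp only: mult_ac)
    finally show "norm (norm (b n) * (Gamma \<sigma> * c n powr (- \<sigma>))) \<le>
        B * \<bar>Gamma \<sigma>\<bar> * (2 * pi) powr (- \<sigma>) * real (Suc n) powr (1 - \<sigma>)"
      unfolding e by (simp only: mult_ac)
  qed
  have Gamma_pos: "Gamma \<sigma> > 0" using s by (simp add: \<sigma>_def Gamma_real_pos)
  have psum: "((\<lambda>t. \<Sum>n<k. gr n t) has_integral (\<Sum>n<k. norm (b n) * (Gamma \<sigma> * c n powr (- \<sigma>)))) {0<..}" for k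
    by (intro has_integral_sum gr) auto
  have dom: "(\<lambda>t. suminf (\<lambda>n. gr n t)) integrable_on {0<..}"
  proof (rule conjunct1[OF monotone_convergence_increasing[where f = "\<lambda>k t. \<Sum>n<k. gr n t"]])
    show "(\<lambda>t. \<Sum>n<k. gr n t) integrable_on {0<..}" for k using psum by blast
    show "(\<Sum>n<k. gr n t) \<le> (\<Sum>n<Suc k. gr n t)" for k t by (simp add: gr_nonneg)
    show "(\<lambda>k. \<Sum>n<k. gr n t) \<longlonglongrightarrow> suminf (\<lambda>n. gr n t)" if "t \<in> {0<..}" for t
      using gr_summable[of t] that by (intro summable_LIMSEQ) auto
    show "bounded (range (\<lambda>k. integral {0<..} (\<lambda>t. \<Sum>n<k. gr n t)))"
      unfolding integral_unique[OF psum]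
      using summable_LIMSEQ[OF int_summable] by (intro convergent_imp_bounded) auto
  qed
  have psum2: "((\<lambda>t. \<Sum>n<k. g n t) has_integral (\<Sum>n<k. b n * (Gamma s * of_real (c n) powr (- s)))) {0<..}" for k
    by (intro has_integral_sum g) auto
  have "(\<lambda>k. integral {0<..} (\<lambda>t. \<Sum>n<k. g n t)) \<longlonglongrightarrow> integral {0<..} (\<phi> s)"
  proof (rule dominated_convergence(2)[OF _ dom])
    show "(\<lambda>t. \<Sum>n<k. g n t) integrable_on {0<..}" for k using psum2 by blast
    fix k t assume t: "t \<in> {0::real<..}"
    have "norm (\<Sum>n<k. g n t) \<le> (\<Sum>n<k. norm (g n t))" by (rule norm_sum)
    also have "\<dots> = (\<Sum>n<k. gr n t)" using ng t by simp
    also have "\<dots> \<le> suminf (\<lambda>n. gr n t)"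
      using gr_summable[of t] t gr_nonneg by (intro sum_le_suminf) auto
    finally show "norm (\<Sum>n<k. g n t) \<le> suminf (\<lambda>n. gr n t)" .
  next
    fix t assume t: "t \<in> {0::real<..}"
    have "(\<lambda>n. b n * of_real (exp (- c n * t)) * of_real t powr (s - 1)) sums (h t * of_real t powr (s - 1))"
      unfolding c_def using t series[of t] by (intro sums_mult2) simp
    then show "(\<lambda>k. \<Sum>n<k. g n t) \<longlonglongrightarrow> \<phi> s t"
      by (simp add: sums_def g_def \<phi>_def mult_ac)
  qed
  then show ?thesis
    unfolding integral_unique[OF psum2] by (simp add: sums_def M_def c_def)
qed

text \<open>The Mellin transform is entire and has to be divided by Gamma(s); as 1/Gamma is entire,
  writing the quotient with \<open>rGamma\<close> creates no poles.\<close>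

theorem Dirichlet_series_continuation:
  "\<exists>L. L holomorphic_on UNIV \<and>
     (\<forall>s. Re s > 2 \<longrightarrow> (\<lambda>n. b n * of_nat (Suc n) powr (- s)) sums L s) \<and> L 1 = H0"
proof -
  define L where "L s = of_real (2 * pi) powr s * rGamma s * M s" for s
  have "L holomorphic_on UNIV"
    unfolding L_def by (intro holomorphic_intros M_holomorphic)
  moreover have "(\<lambda>n. b n * of_nat (Suc n) powr (- s)) sums L s" if s: "Re s > 2" for s
  proof -
    have s0: "s \<notin> \<int>\<^sub>\<le>\<^sub>0" using s by (auto elim!: nonpos_Ints_cases)
    have "(\<lambda>n. of_real (2 * pi) powr s * rGamma s * (b n * (Gamma s * of_real (2 * pi * real (Suc n)) powr (- s)))) sums L s"
      unfolding L_def by (intro sums_mult M_sums s)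
    moreover have "of_real (2 * pi) powr s * rGamma s * (b n * (Gamma s * of_real (2 * pi * real (Suc n)) powr (- s)))
        = b n * of_nat (Suc n) powr (- s)" for n
    proof -
      have g: "rGamma s * Gamma s = 1" using s0 by (simp add: rGamma_inverse_Gamma Gamma_eq_zero_iff)
      have "of_real (2 * pi * real (Suc n)) powr (- s) =
          (of_real (2 * pi) powr (- s) * of_real (real (Suc n)) powr (- s) :: complex)"
        unfolding of_real_mult[of "2 * pi" "real (Suc n)"] by (rule powr_times_real) auto
      moreover have "of_real (2 * pi) powr s * of_real (2 * pi) powr (- s) = (1 :: complex)"
        by (simp flip: powr_add)
      ultimately have "of_real (2 * pi) powr s * of_real (2 * pi * real (Suc n)) powr (- s) =
          (of_nat (Suc n) powr (- s) :: complex)"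
        by (simp only: mult.assoc[symmetric] mult_1_left of_real_of_nat_eq)
      then have "(rGamma s * Gamma s) * b n * (of_real (2 * pi) powr s * of_real (2 * pi * real (Suc n)) powr (- s)) =
          b n * of_nat (Suc n) powr (- s)"
        unfolding g by simp
      then show ?thesis by (simp only: mult_ac)
    qed
    ultimately show ?thesis by (simp only:)
  qed
  moreover have "L 1 = H0"
    by (simp add: L_def M_1 rGamma_inverse_Gamma)
  ultimately show ?thesis by blast
qed

end

section \<open>Quadratic characters and Gauss sums\<close>


lemma Legendre_cong:
  assumes "[a = b] (mod p)"
  shows "Legendre a p = Legendre b p"
proof -
  have "[a = 0] (mod p) \<longleftrightarrow> [b = 0] (mod p)" using assms cong_sym cong_trans by blast
  moreover have "QuadRes p a \<longleftrightarrow> QuadRes p b"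
    unfolding QuadRes_def using assms cong_sym cong_trans by blast
  ultimately show ?thesis by (simp add: Legendre_def)
qed

lemma Legendre_cases: "Legendre a p = 0 \<or> Legendre a p = 1 \<or> Legendre a p = - 1"
  by (simp add: Legendre_def)

lemma Legendre_eq_0_iff: "Legendre a p = 0 \<longleftrightarrow> p dvd a"
  by (simp add: Legendre_def cong_0_iff)

lemma Legendre_1: "\<not> p dvd 1 \<Longrightarrow> Legendre 1 p = 1"
  by (auto simp: Legendre_def QuadRes_def cong_0_iff intro!: exI[of _ 1])

text \<open>Euler's criterion gives the congruence modulo q, and the two sides differ by at most 2 <
  q.\<close>

lemma Legendre_mult:
  fixes q :: nat
  assumes "prime q" "odd q"
  shows "Legendre (a * b) (int q) = Legendre a (int q) * Legendre b (int q)"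
proof -
  have q2: "2 < q" using assms prime_ge_2_nat[of q] by (cases "q = 2") auto
  note e = euler_criterion[OF assms(1) q2]
  have "[Legendre a (int q) * Legendre b (int q) = a ^ ((q - 1) div 2) * b ^ ((q - 1) div 2)] (mod int q)"
    by (intro cong_mult e)
  then have "[Legendre (a * b) (int q) = Legendre a (int q) * Legendre b (int q)] (mod int q)"
    using e[of "a * b"] by (metis cong_sym cong_trans power_mult_distrib)
  then have "int q dvd Legendre (a * b) (int q) - Legendre a (int q) * Legendre b (int q)"
    by (simp add: cong_iff_dvd_diff)
  moreover have "\<bar>Legendre (a * b) (int q) - Legendre a (int q) * Legendre b (int q)\<bar> < int q"
    using Legendre_cases[of "a * b" "int q"] Legendre_cases[of a "int q"] Legendre_cases[of b "int q"] q2 by auto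
  ultimately show ?thesis
    using zdvd_imp_le by (metis abs_of_nonneg dvd_abs_iff eq_iff_diff_eq_0 abs_ge_zero less_le not_less zero_less_abs_iff)
qed

text \<open>If every nonzero residue were a square, squaring would map a finite set onto itself and
  so be injective, although 1 and -1 have the same square.\<close>

lemma Legendre_nonresidue_exists:
  fixes q :: nat
  assumes "prime q" "odd q"
  shows "\<exists>u. Legendre u (int q) = - 1"
proof (rule ccontr)
  assume no: "\<nexists>u. Legendre u (int q) = - 1"
  have q2: "2 < q" using assms prime_ge_2_nat[of q] by (cases "q = 2") auto
  define f where "f y = (y * y) mod int q" for y
  define X where "X = {1..int q - 1}"
  have "X \<subseteq> f ` X"
  proof
    fix x assume x: "x \<in> X"
    then have "\<not> int q dvd x" using zdvd_not_zless by (auto simp: X_def)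
    then have "Legendre x (int q) = 1"
      using no Legendre_cases[of x "int q"] Legendre_eq_0_iff[of x "int q"] by blast
    then obtain y where y: "[y ^ 2 = x] (mod int q)"
      by (auto simp: Legendre_def QuadRes_def split: if_splits)
    have fy: "f (y mod int q) = x"
      using y x by (simp add: f_def X_def cong_def power2_eq_square mod_mult_eq)
    have "y mod int q \<noteq> 0" using fy x by (auto simp: f_def X_def)
    moreover have "0 \<le> y mod int q" "y mod int q < int q" using q2 by simp_all
    ultimately have "y mod int q \<in> X" by (simp add: X_def)
    then show "x \<in> f ` X" using fy by (metis image_eqI)
  qed
  then have inj: "inj_on f X" by (rule finite_surj_inj[rotated]) (simp add: X_def)
  have "(int q - 1) * (int q - 1) = 1 + int q * (int q - 2)" by (simp add: algebra_simps)
  then have "f (int q - 1) = f 1" by (simp add: f_def)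
  then have "int q - 1 = 1" using inj_onD[OF inj] q2 by (auto simp: X_def)
  then show False using q2 by simp
qed

text \<open>The character is indexed by its set of primes instead of its conductor, so that divisors
  of m become subsets of \<open>Q\<close>.\<close>

definition chi :: "nat set \<Rightarrow> int \<Rightarrow> int" where
  "chi Q k = (\<Prod>q\<in>Q. Legendre k (int q))"

definition expi :: "real \<Rightarrow> complex" where
  "expi x = exp (2 * of_real pi * \<i> * of_real x)"

lemma expi_add: "expi (x + y) = expi x * expi y"
  by (simp add: expi_def exp_add distrib_left distrib_right)

lemma expi_of_int [simp]: "expi (of_int n) = 1"
  unfolding expi_def using exp_integer_2pi[of "of_int n"] by (simp add: mult_ac)

lemma expi_0 [simp]: "expi 0 = 1"
  by (simp add: expi_def)

lemma expi_cong:
  assumes "[a = b] (mod int m)" "m > 0"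
  shows "expi (of_int a / real m) = expi (of_int b / real m)"
proof -
  obtain k where k: "a = b + int m * k"
    using assms(1) by (metis cong_iff_lin cong_sym)
  have "real_of_int a / real m = real_of_int b / real m + of_int k"
    using assms(2) by (simp add: k field_simps)
  then show ?thesis by (simp add: expi_add)
qed

lemma sum_mod_mult:
  fixes g :: "int \<Rightarrow> 'a::comm_monoid_add"
  assumes m: "m > 0" and u: "coprime u (int m)"
    and per: "\<And>x y. [x = y] (mod int m) \<Longrightarrow> g x = g y"
  shows "(\<Sum>k\<in>{0..<int m}. g (u * k)) = (\<Sum>k\<in>{0..<int m}. g k)"
proof -
  have inj: "inj_on (\<lambda>k. (u * k) mod int m) {0..<int m}"
  proof (rule inj_onI)
    fix x y assume xy: "x \<in> {0..<int m}" "y \<in> {0..<int m}" and "(u * x) mod int m = (u * y) mod int m"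
    then have "[u * x = u * y] (mod int m)" by (simp add: cong_def)
    then have "[x = y] (mod int m)" using u by (simp add: cong_mult_lcancel)
    then show "x = y" using xy by (simp add: cong_def)
  qed
  have "bij_betw (\<lambda>k. (u * k) mod int m) {0..<int m} {0..<int m}"
    unfolding bij_betw_def using inj
    by (intro conjI endo_inj_surj) (use m in auto)
  then have "(\<Sum>k\<in>{0..<int m}. g ((u * k) mod int m)) = (\<Sum>k\<in>{0..<int m}. g k)"
    by (rule sum.reindex_bij_betw)
  moreover have "g ((u * k) mod int m) = g (u * k)" for k
    by (rule per) (simp add: cong_def)
  ultimately show ?thesis by simp
qed

lemma expi_sum:
  assumes m: "m > 0"
  shows "(\<Sum>n\<in>{0..<int m}. expi (of_int (n * j) / real m)) = (if int m dvd j then of_nat m else 0)"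
proof (cases "int m dvd j")
  case True
  then have "expi (of_int (n * j) / real m) = 1" for n
    using expi_cong[of "n * j" 0 m] m by (simp add: cong_0_iff)
  then show ?thesis using True by simp
next
  case False
  define x where "x = expi (of_int j / real m)"
  have xk: "x ^ k = expi (real k * (of_int j / real m))" for k
  proof (induction k)
    case (Suc k)
    have "real (Suc k) * (of_int j / real m) = of_int j / real m + real k * (of_int j / real m)"
      by (simp add: distrib_right add_divide_distrib)
    then show ?case using Suc by (simp only: expi_add power_Suc x_def)
  qed simp
  have "x \<noteq> 1"
  proof
    assume "x = 1"
    then obtain n where "2 * of_real pi * \<i> * of_real (of_int j / real m) = of_int (2 * n) * of_real pi * \<i>"
      unfolding x_def expi_def exp_eq_1 by (auto simp: complex_eq_iff)
    then have "2 * pi * (of_int j / real m) = 2 * pi * of_int n" by (auto simp: complex_eq_iff mult_ac)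
    then have "of_int j / real m = of_int n" by (simp only: mult_cancel_left) simp
    then have "real_of_int j = real_of_int (int m * n)" using m by (simp add: field_simps)
    then have "j = int m * n" by (simp only: of_int_eq_iff)
    then show False using False by simp
  qed
  moreover have "x ^ m = 1"
    using m by (simp add: xk)
  ultimately have "(\<Sum>k<m. x ^ k) = 0" by (simp add: geometric_sum)
  moreover have "(\<Sum>n\<in>{0..<int m}. expi (of_int (n * j) / real m)) = (\<Sum>k<m. x ^ k)"
    by (rule sum.reindex_bij_witness[of _ int nat]) (auto simp: xk)
  ultimately show ?thesis using False by simp
qed

lemma coprime_int_prime_iff:
  assumes "prime q"
  shows "coprime a (int q) \<longleftrightarrow> \<not> int q dvd a"
proof -
  have p: "prime (int q)" "q \<noteq> 1" using assms prime_gt_1_nat[of q] by auto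
  show ?thesis
    using prime_imp_coprime[OF p(1), of a] coprime_common_divisor[of a "int q" "int q"] p(2)
    by (auto simp: coprime_commute)
qed

section \<open>Products of Legendre symbols and their Gauss sums\<close>

locale odd_primes =
  fixes Q :: "nat set"
  assumes finite_Q: "finite Q" and prime_Q: "\<And>q. q \<in> Q \<Longrightarrow> prime q" and odd_Q: "\<And>q. q \<in> Q \<Longrightarrow> odd q"
begin

definition m where "m = \<Prod>Q"

lemma m_pos: "m > 0"
  unfolding m_def using prime_Q prime_gt_0_nat by (intro prod_pos) auto

lemma dvd_m: "q \<in> Q \<Longrightarrow> q dvd m"
  unfolding m_def using finite_Q by (rule dvd_prodI)

lemma prime_factors_m: "prime_factors m = Q"
proof (intro equalityI subsetI)
  fix p assume "p \<in> prime_factors m"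
  then have p: "prime p" "p dvd \<Prod>Q" by (auto simp: m_def)
  then obtain q where "q \<in> Q" "p dvd q" using finite_Q by (auto simp: prime_dvd_prod_iff)
  then show "p \<in> Q" using p(1) prime_Q primes_dvd_imp_eq by blast
next
  fix q assume "q \<in> Q"
  then show "q \<in> prime_factors m" using dvd_m prime_Q m_pos by (simp add: prime_factors_dvd)
qed

lemma chi_cong:
  assumes "[a = b] (mod int m)"
  shows "chi Q a = chi Q b"
  unfolding chi_def
proof (rule prod.cong[OF refl])
  fix q assume "q \<in> Q"
  then have "int q dvd int m" using dvd_m by simp
  then show "Legendre a (int q) = Legendre b (int q)"
    using assms by (intro Legendre_cong) (rule cong_dvd_modulus)
qed

lemma chi_mult: "chi Q (a * b) = chi Q a * chi Q b"
  unfolding chi_def using prime_Q odd_Q by (simp add: Legendre_mult flip: prod.distrib)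

lemma chi_1: "chi Q 1 = 1"
  unfolding chi_def
proof (intro prod.neutral ballI Legendre_1)
  fix q assume "q \<in> Q"
  then have "q > 1" using prime_Q prime_gt_1_nat by blast
  then show "\<not> int q dvd 1" by simp
qed

lemma coprime_m_iff: "coprime a (int m) \<longleftrightarrow> (\<forall>q\<in>Q. \<not> int q dvd a)"
proof -
  have "coprime a (int m) \<longleftrightarrow> (\<forall>q\<in>Q. coprime a (int q))"
    unfolding m_def of_nat_prod using finite_Q
    by (induction rule: finite_induct) auto
  also have "\<dots> \<longleftrightarrow> (\<forall>q\<in>Q. \<not> int q dvd a)"
    using prime_Q coprime_int_prime_iff by blast
  finally show ?thesis .
qed

lemma chi_nz_iff: "chi Q a \<noteq> 0 \<longleftrightarrow> coprime a (int m)"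
  unfolding chi_def coprime_m_iff using finite_Q by (simp add: Legendre_eq_0_iff)

lemma chi_sq:
  assumes "coprime a (int m)"
  shows "chi Q a * chi Q a = 1"
proof -
  have "Legendre a (int q) * Legendre a (int q) = 1" if "q \<in> Q" for q
    using Legendre_cases[of a "int q"] Legendre_eq_0_iff[of a "int q"] assms that
    by (auto simp: coprime_m_iff)
  then show ?thesis unfolding chi_def by (simp flip: prod.distrib)
qed

lemma chi_pm1: "coprime a (int m) \<Longrightarrow> chi Q a = 1 \<or> chi Q a = - 1"
  using chi_sq[of a] zmult_eq_1_iff by blast

lemma chi_minus1: "chi Q (- 1) = 1 \<or> chi Q (- 1) = - 1"
  by (rule chi_pm1) simp

text \<open>By the Chinese remainder theorem, take u a nonresidue modulo q and 1 modulo m/q.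
  Multiplication by u flips the character but fixes all multiples of q modulo m, which expresses
  that the character is primitive.\<close>

lemma exists_twist:
  assumes q: "q \<in> Q"
  shows "\<exists>u. coprime u (int m) \<and> chi Q u = - 1 \<and> int m dvd int q * (u - 1)"
proof -
  define m' where "m' = \<Prod>(Q - {q})"
  have mm': "m = q * m'" unfolding m_def m'_def using finite_Q q by (rule prod.remove)
  have "coprime q p" if "p \<in> Q - {q}" for p
    using that q prime_Q by (auto intro: primes_coprime)
  then have "coprime q m'" unfolding m'_def by (rule prod_coprime_right)
  then have cop: "coprime (int q) (int m')" by simp
  obtain v where v: "Legendre v (int q) = - 1"
    using Legendre_nonresidue_exists prime_Q odd_Q q by blast
  obtain u where u: "[u = v] (mod int q)" "[u = 1] (mod int m')"
    using binary_chinese_remainder_int[OF cop] by blast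
  have L: "Legendre u (int p) = (if p = q then - 1 else 1)" if p: "p \<in> Q" for p
  proof (cases "p = q")
    case True
    then show ?thesis using Legendre_cong[OF u(1)] v by simp
  next
    case False
    then have "p dvd m'" unfolding m'_def using finite_Q p by (intro dvd_prodI) auto
    then have "int p dvd int m'" by simp
    then have "[u = 1] (mod int p)" using u(2) cong_dvd_modulus by blast
    moreover have "\<not> int p dvd 1" using prime_Q[OF p] prime_gt_1_nat[of p] by auto
    ultimately show ?thesis using False Legendre_cong Legendre_1 by auto
  qed
  have "chi Q u = - 1"
  proof -
    have "chi Q u = (\<Prod>p\<in>Q. if p = q then - 1 else 1)" unfolding chi_def using L by (intro prod.cong) auto
    also have "\<dots> = - 1" using finite_Q q by (simp add: prod.delta)
    finally show ?thesis .
  qed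
  moreover from this have "coprime u (int m)" using chi_nz_iff[of u] by simp
  moreover have "int m dvd int q * (u - 1)"
    using u(2) by (simp add: mm' cong_iff_dvd_diff)
  ultimately show ?thesis by blast
qed

definition csum :: "int \<Rightarrow> complex" where
  "csum n = (\<Sum>k\<in>{0..<int m}. of_int (chi Q k) * expi (of_int (n * k) / real m))"

definition \<tau> where "\<tau> = csum 1"

lemma csum_cong:
  assumes "[a = b] (mod int m)"
  shows "csum a = csum b"
  unfolding csum_def using assms m_pos
  by (intro sum.cong refl arg_cong2[of _ _ _ _ "(*)"] expi_cong) (auto intro: cong_scalar_right)

lemma csum_mult:
  assumes u: "coprime u (int m)"
  shows "csum (n * u) = of_int (chi Q u) * csum n"
proof -
  have "(\<Sum>k\<in>{0..<int m}. of_int (chi Q (u * k)) * expi (of_int (n * (u * k)) / real m)) = csum n"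
    unfolding csum_def
  proof (rule sum_mod_mult[OF m_pos u])
    fix x y assume "[x = y] (mod int m)"
    then show "of_int (chi Q x) * expi (of_int (n * x) / real m) = of_int (chi Q y) * expi (of_int (n * y) / real m)"
      using chi_cong expi_cong[of "n * x" "n * y"] m_pos by (metis cong_scalar_left)
  qed
  then have "of_int (chi Q u) * csum (n * u) = csum n"
    by (simp add: csum_def chi_mult sum_distrib_left mult_ac)
  then have "of_int (chi Q u * chi Q u) * csum (n * u) = of_int (chi Q u) * csum n"
    by (simp add: mult.assoc)
  then show ?thesis by (simp add: chi_sq[OF u])
qed

text \<open>For n prime to m this is a change of variable. Otherwise a unit of character -1 fixes n
  modulo m, so the sum equals its own negative. Having the formula for all n allows a whole q-series
  to be twisted.\<close>

lemma csum_eq: "csum n = of_int (chi Q n) * \<tau>"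
proof (cases "coprime n (int m)")
  case True
  then show ?thesis using csum_mult[OF True, of 1] by (simp add: \<tau>_def)
next
  case False
  then obtain q where q: "q \<in> Q" "int q dvd n" by (auto simp: coprime_m_iff)
  obtain u where u: "coprime u (int m)" "chi Q u = - 1" "int m dvd int q * (u - 1)"
    using exists_twist[OF q(1)] by blast
  have "int q * (u - 1) dvd n * (u - 1)" using q(2) by (intro mult_dvd_mono) auto
  then have "int m dvd n * (u - 1)" using u(3) dvd_trans by blast
  then have "[n * u = n] (mod int m)" by (simp add: cong_iff_dvd_diff algebra_simps)
  then have "csum n = - csum n" using csum_mult[OF u(1), of n] csum_cong u(2) by auto
  then have "csum n = 0" by simp
  moreover have "chi Q n = 0" using False chi_nz_iff by blast
  ultimately show ?thesis by simp
qed

text \<open>The sum of \<open>csum n\<close> times e(-n/m) over n is evaluated twice: orthogonality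
  leaves only k = 1, while \<open>csum_eq\<close> turns it into tau times
  \<open>csum (- 1)\<close>.\<close>

lemma tau_sq: "of_int (chi Q (- 1)) * (\<tau> * \<tau>) = of_nat m"
proof -
  have "(\<Sum>n\<in>{0..<int m}. csum n * expi (of_int (n * (- 1)) / real m)) =
     (\<Sum>n\<in>{0..<int m}. \<Sum>k\<in>{0..<int m}. of_int (chi Q k) * expi (of_int (n * (k - 1)) / real m))"
    unfolding csum_def sum_distrib_right
    by (intro sum.cong refl) (simp add: mult.assoc add_divide_distrib algebra_simps flip: expi_add add_divide_distrib diff_divide_distrib)
  also have "\<dots> = (\<Sum>k\<in>{0..<int m}. of_int (chi Q k) * (\<Sum>n\<in>{0..<int m}. expi (of_int (n * (k - 1)) / real m)))"
    by (subst sum.swap) (simp add: sum_distrib_left)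
  also have "\<dots> = (\<Sum>k\<in>{0..<int m}. of_int (chi Q k) * (if int m dvd k - 1 then of_nat m else 0))"
    by (simp only: expi_sum[OF m_pos])
  also have "\<dots> = of_nat m"
  proof -
    \<comment> \<open>The remainder \<open>1 mod int m\<close> is written because it is 0 when m =
      1, that is, for empty \<open>Q\<close>.\<close>
    have "of_int (chi Q k) * (if int m dvd k - 1 then of_nat m else 0) = (if k = 1 mod int m then of_nat m else (0::complex))"
      if k: "k \<in> {0..<int m}" for k
    proof -
      have "int m dvd k - 1 \<longleftrightarrow> [k = 1] (mod int m)" by (simp add: cong_iff_dvd_diff)
      also have "\<dots> \<longleftrightarrow> k = 1 mod int m" using k by (simp add: cong_def)
      finally have 1: "int m dvd k - 1 \<longleftrightarrow> k = 1 mod int m" .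
      have "chi Q k = 1" if "k = 1 mod int m"
        using chi_cong[of k 1] chi_1 that by (simp add: cong_def)
      with 1 show ?thesis by simp
    qed
    then have "(\<Sum>k\<in>{0..<int m}. of_int (chi Q k) * (if int m dvd k - 1 then of_nat m else 0)) =
       (\<Sum>k\<in>{0..<int m}. if k = 1 mod int m then of_nat m else (0::complex))"
      by (intro sum.cong) auto
    also have "\<dots> = of_nat m" using m_pos by (subst sum.delta) auto
    finally show ?thesis .
  qed
  finally have "(\<Sum>n\<in>{0..<int m}. csum n * expi (of_int (n * (- 1)) / real m)) = of_nat m" .
  moreover have "(\<Sum>n\<in>{0..<int m}. csum n * expi (of_int (n * (- 1)) / real m)) = \<tau> * csum (- 1)"
    unfolding csum_def[of "- 1"] sum_distrib_left
    by (intro sum.cong refl) (simp add: csum_eq mult_ac)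
  ultimately show ?thesis using csum_eq[of "- 1"] by (simp add: mult_ac)
qed

lemma tau_nz: "\<tau> \<noteq> 0"
  using tau_sq m_pos by auto

end

section \<open>Values of twisted L-functions at 1\<close>


lemma twisted_L_eqI:
  assumes hol: "L holomorphic_on UNIV"
    and ser: "\<And>s. Re s > \<sigma> \<Longrightarrow>
      (\<lambda>n. of_int (\<psi> (int (Suc n))) * a (Suc n) * of_nat (Suc n) powr (- s)) sums L s"
  shows "twisted_L a \<psi> = L"
  unfolding twisted_L_def
proof (rule the_equality)
  show "L holomorphic_on UNIV \<and> (\<exists>\<sigma>. \<forall>s. Re s > \<sigma> \<longrightarrow>
      (\<lambda>n. of_int (\<psi> (int (Suc n))) * a (Suc n) * of_nat (Suc n) powr (- s)) sums L s)"
    using hol ser by blast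
next
  fix L' assume *: "L' holomorphic_on UNIV \<and> (\<exists>\<sigma>. \<forall>s. Re s > \<sigma> \<longrightarrow>
      (\<lambda>n. of_int (\<psi> (int (Suc n))) * a (Suc n) * of_nat (Suc n) powr (- s)) sums L' s)"
  then obtain \<sigma>' where \<sigma>': "\<And>s. Re s > \<sigma>' \<Longrightarrow>
      (\<lambda>n. of_int (\<psi> (int (Suc n))) * a (Suc n) * of_nat (Suc n) powr (- s)) sums L' s" by blast
  define r where "r = max \<sigma> \<sigma>'"
  define U where "U = {s. Re s > r}"
  have eq: "L' s - L s = 0" if "s \<in> U" for s
    using sums_unique2[OF \<sigma>'[of s] ser[of s]] that by (simp add: U_def r_def)
  have U: "open U" by (simp add: U_def open_halfspace_Re_gt)
  have mem: "of_real (r + 1) \<in> U" by (simp add: U_def)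
  have lim: "complex_of_real (r + 1) islimpt U"
    by (rule interior_limit_point) (use U mem in \<open>simp add: interior_open\<close>)
  have "L' s - L s = 0" for s
    by (rule analytic_continuation[of "\<lambda>s. L' s - L s" UNIV U "of_real (r + 1)"])
       (use * hol lim eq in \<open>auto intro!: holomorphic_intros\<close>)
  then show "L' = L" by auto
qed

locale eigen_twist = eigenform2 + odd_primes
begin

lemma quad_char_m: "quad_char m k = chi Q k"
  by (simp add: quad_char_def chi_def prime_factors_m)

lemma abs_chi_le_1: "cmod (of_int (chi Q k)) \<le> 1"
  using chi_pm1[of k] chi_nz_iff[of k] by (cases "coprime k (int m)") auto

text \<open>Since chi(n) tau is the Gauss sum with frequency n, the twisted q-series is a
  combination of f on the vertical lines over k/m, and the Mellin argument applies to it.\<close>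

theorem twisted_L_value:
  "twisted_L a (quad_char m) 1 =
    (1 / \<tau>) * (\<Sum>k\<in>{0..<int m}. of_int (chi Q k) * Gc (of_int k / real m))"
proof -
  define x where "x k = real_of_int k / real m" for k
  have x: "x k \<in> \<rat>" for k by (simp add: x_def)
  define R where "R = {0..<int m}"
  define h where "h t = (1 / \<tau>) * (\<Sum>k\<in>R. of_int (chi Q k) * f (Complex (x k) t))" for t
  define H where "H t = (1 / \<tau>) * (\<Sum>k\<in>R. of_int (chi Q k) * G (Complex (x k) t))" for t
  define b where "b n = of_int (chi Q (int (Suc n))) * a (Suc n)" for n
  obtain B where B: "B > 0" "\<And>n. n \<ge> 1 \<Longrightarrow> norm (a n) \<le> B * real n"
    using a_bound by blast
  have mel: "mellin h H b B ((1 / \<tau>) * (\<Sum>k\<in>R. of_int (chi Q k) * Gc (x k)))"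
  proof
    show "continuous_on {0<..} h"
      unfolding h_def by (intro continuous_intros continuous_on_vertical)
  next
    fix \<rho> :: real
    have "\<forall>k. \<exists>C. C > 0 \<and> (\<forall>t>0. norm (f (Complex (x k) t)) \<le> C * t powr \<rho>)"
      using f_vertical_rapid_decay[OF x] by blast
    from choice[OF this] obtain C
      where C': "\<forall>k. C k > 0 \<and> (\<forall>t>0. norm (f (Complex (x k) t)) \<le> C k * t powr \<rho>)" ..
    have C: "C k > 0" "t > 0 \<Longrightarrow> norm (f (Complex (x k) t)) \<le> C k * t powr \<rho>" for k t
      using C' by auto
    define K where "K = norm (1 / \<tau>) * (\<Sum>k\<in>R. C k) + 1"
    have "norm (h t) \<le> K * t powr \<rho>" if t: "t > 0" for t
    proof -
      have "norm (\<Sum>k\<in>R. of_int (chi Q k) * f (Complex (x k) t)) \<le> (\<Sum>k\<in>R. C k * t powr \<rho>)"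
      proof (rule sum_norm_le)
        fix k
        have "norm (of_int (chi Q k) * f (Complex (x k) t)) \<le> 1 * (C k * t powr \<rho>)"
          unfolding norm_mult by (intro mult_mono abs_chi_le_1 C t) auto
        then show "norm (of_int (chi Q k) * f (Complex (x k) t)) \<le> C k * t powr \<rho>" by simp
      qed
      then have "norm (h t) \<le> norm (1 / \<tau>) * (\<Sum>k\<in>R. C k * t powr \<rho>)"
        unfolding h_def norm_mult by (intro mult_left_mono) auto
      also have "\<dots> = norm (1 / \<tau>) * (\<Sum>k\<in>R. C k) * t powr \<rho>" by (simp add: sum_distrib_right mult.assoc)
      also have "\<dots> \<le> K * t powr \<rho>" by (intro mult_right_mono) (auto simp: K_def)
      finally show ?thesis .
    qed
    moreover have "K > 0" unfolding K_def using C(1) by (intro add_nonneg_pos mult_nonneg_nonneg sum_nonneg) (auto intro: less_imp_le)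
    ultimately show "\<exists>C>0. \<forall>t>0. norm (h t) \<le> C * t powr \<rho>" by blast
  next
    fix n
    have "norm (b n) \<le> 1 * (B * real (Suc n))"
      unfolding b_def norm_mult by (intro mult_mono abs_chi_le_1 B) auto
    then show "norm (b n) \<le> B * real (Suc n)" by simp
  next
    fix t :: real assume t: "t > 0"
    have qq: "qq 1 (Complex (x k) t) ^ n = expi (of_int (int n * k) / real m) * of_real (exp (- (2 * pi * real n) * t))" for k n
    proof -
      have "2 * of_real pi * \<i> * of_nat n * Complex (x k) t =
          2 * of_real pi * \<i> * of_real (of_int (int n * k) / real m) + of_real (- (2 * pi * real n) * t)"
        by (simp add: complex_eq_iff x_def)
      then show ?thesis unfolding qq1_power expi_def by (simp only: exp_add exp_of_real)
    qed
    have "(\<lambda>n. (1 / \<tau>) * (\<Sum>k\<in>R. of_int (chi Q k) * (A n * qq 1 (Complex (x k) t) ^ n))) sums h t"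
      unfolding h_def using t by (intro sums_mult sums_sum A_sums) simp
    moreover have "(1 / \<tau>) * (\<Sum>k\<in>R. of_int (chi Q k) * (A n * qq 1 (Complex (x k) t) ^ n)) =
        of_int (chi Q (int n)) * A n * of_real (exp (- (2 * pi * real n) * t))" for n
    proof -
      have "(\<Sum>k\<in>R. of_int (chi Q k) * (A n * qq 1 (Complex (x k) t) ^ n)) =
          csum (int n) * A n * of_real (exp (- (2 * pi * real n) * t))"
        unfolding qq csum_def R_def sum_distrib_right by (intro sum.cong refl) (simp add: mult_ac)
      then show ?thesis using tau_nz by (simp add: csum_eq[of "int n"])
    qed
    ultimately have "(\<lambda>n. of_int (chi Q (int n)) * A n * of_real (exp (- (2 * pi * real n) * t))) sums h t"
      by simp
    then have "(\<lambda>n. of_int (chi Q (int (Suc n))) * A (Suc n) * of_real (exp (- (2 * pi * real (Suc n)) * t))) sums h t"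
      by (subst sums_Suc_iff) (simp add: A_def)
    then show "(\<lambda>n. b n * of_real (exp (- (2 * pi * real (Suc n)) * t))) sums h t"
      by (simp add: b_def A_def)
  next
    fix t :: real assume t: "t > 0"
    have "(H has_vector_derivative (1 / \<tau>) * (\<Sum>k\<in>R. of_int (chi Q k) * (- 2 * of_real pi * f (Complex (x k) t)))) (at t)"
      unfolding H_def by (intro has_vector_derivative_mult_right has_vector_derivative_sum G_vertical_deriv t)
    then show "(H has_vector_derivative - 2 * of_real pi * h t) (at t)"
      by (simp add: h_def sum_distrib_left sum_negf mult_ac)
  next
    show "(H \<longlongrightarrow> (1 / \<tau>) * (\<Sum>k\<in>R. of_int (chi Q k) * Gc (x k))) (at_right 0)"
      unfolding H_def by (intro tendsto_intros Gc_tendsto x)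
    have "(H \<longlongrightarrow> (1 / \<tau>) * (\<Sum>k\<in>R. of_int (chi Q k) * 0)) at_top"
      unfolding H_def by (intro tendsto_intros G_vertical_at_top)
    then show "(H \<longlongrightarrow> 0) at_top" by simp
  qed
  from mellin.Dirichlet_series_continuation[OF mel] obtain L where L: "L holomorphic_on UNIV"
    "\<And>s. Re s > 2 \<Longrightarrow> (\<lambda>n. b n * of_nat (Suc n) powr (- s)) sums L s"
    "L 1 = (1 / \<tau>) * (\<Sum>k\<in>R. of_int (chi Q k) * Gc (x k))"
    by blast
  have "twisted_L a (quad_char m) = L"
    by (rule twisted_L_eqI[OF L(1), of 2]) (use L(2) in \<open>simp add: b_def quad_char_m\<close>)
  then show ?thesis using L(3) by (simp add: R_def x_def)
qed

end

section \<open>Sums of boundary values against characters\<close>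


lemma sum_Pow_prod:
  fixes x :: "'a \<Rightarrow> 'b::comm_semiring_1"
  assumes "finite Q"
  shows "(\<Sum>D\<in>Pow Q. \<Prod>q\<in>D. x q) = (\<Prod>q\<in>Q. 1 + x q)"
  using assms
proof (induction rule: finite_induct)
  case (insert q Q)
  have "(\<Sum>D\<in>Pow (insert q Q). \<Prod>q\<in>D. x q) =
      (\<Sum>D\<in>Pow Q. \<Prod>q\<in>D. x q) + (\<Sum>D\<in>insert q ` Pow Q. \<Prod>q\<in>D. x q)"
    unfolding Pow_insert using insert by (intro sum.union_disjoint) auto
  also have "(\<Sum>D\<in>insert q ` Pow Q. \<Prod>q\<in>D. x q) = (\<Sum>D\<in>Pow Q. \<Prod>p\<in>insert q D. x p)"
    using insert by (subst sum.reindex) (auto simp: inj_on_def o_def)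
  also have "\<dots> = (\<Sum>D\<in>Pow Q. x q * (\<Prod>p\<in>D. x p))"
    using insert by (intro sum.cong refl prod.insert) (auto intro: finite_subset)
  also have "\<dots> = x q * (\<Sum>D\<in>Pow Q. \<Prod>p\<in>D. x p)" by (simp add: sum_distrib_left)
  finally show ?case using insert by (simp add: distrib_right)
qed simp

lemma sum_int_blocks:
  fixes F :: "int \<Rightarrow> 'a::comm_monoid_add"
  assumes M: "M > 0"
  shows "(\<Sum>k\<in>{0..<int (M * q)}. F k) = (\<Sum>j\<in>{0..<int M}. \<Sum>b<q. F (j + int M * int b))"
proof -
  have "(\<Sum>k\<in>{0..<int (M * q)}. F k) = (\<Sum>(j, b)\<in>{0..<int M} \<times> {..<q}. F (j + int M * int b))"
  proof (rule sum.reindex_bij_witness[of _ "\<lambda>(j, b). j + int M * int b" "\<lambda>k. (k mod int M, nat (k div int M))"])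
    fix k assume k: "k \<in> {0..<int (M * q)}"
    have 0: "k div int M \<ge> 0" using k M by (simp add: pos_imp_zdiv_nonneg_iff)
    then show "(case (k mod int M, nat (k div int M)) of (j, b) \<Rightarrow> j + int M * int b) = k"
      "(case (k mod int M, nat (k div int M)) of (j, b) \<Rightarrow> F (j + int M * int b)) = F k" by simp_all
    have "k div int M < int q"
    proof (rule ccontr)
      assume "\<not> k div int M < int q"
      then have "int M * int q \<le> int M * (k div int M)" by (intro mult_left_mono) auto
      also have "\<dots> \<le> k" using M by (simp add: times_div_less_eq_dividend flip: minus_mod_eq_mult_div)
      finally show False using k by simp
    qed
    then show "(k mod int M, nat (k div int M)) \<in> {0..<int M} \<times> {..<q}" using M 0 by auto
  next
    fix p assume "p \<in> {0..<int M} \<times> {..<q}"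
    then obtain j b where p: "p = (j, b)" "0 \<le> j" "j < int M" "b < q" by auto
    show "((case p of (j, b) \<Rightarrow> j + int M * int b) mod int M, nat ((case p of (j, b) \<Rightarrow> j + int M * int b) div int M)) = p"
      using p M by simp
    have "int M * (int b + 1) \<le> int M * int q" using p by (intro mult_left_mono) auto
    then have "j + int M * int b < int M * int q" using p by (simp add: distrib_left)
    then show "(case p of (j, b) \<Rightarrow> j + int M * int b) \<in> {0..<int (M * q)}" using p by simp
  qed
  then show ?thesis by (simp add: sum.cartesian_product)
qed

lemma sum_int_multiples:
  fixes F :: "int \<Rightarrow> 'a::comm_monoid_add"
  assumes q: "q > 0"
  shows "(\<Sum>k\<in>{0..<int (M * q)}. if int q dvd k then F k else 0) = (\<Sum>j\<in>{0..<int M}. F (int q * j))"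
proof -
  have "(\<Sum>k\<in>{0..<int (M * q)}. if int q dvd k then F k else 0) = (\<Sum>k | k \<in> {0..<int (M * q)} \<and> int q dvd k. F k)"
    by (rule sum.inter_filter[symmetric]) simp
  also have "\<dots> = (\<Sum>j\<in>{0..<int M}. F (int q * j))"
  proof (rule sum.reindex_bij_witness[of _ "\<lambda>j. int q * j" "\<lambda>k. k div int q"])
    fix k assume k: "k \<in> {k. k \<in> {0..<int (M * q)} \<and> int q dvd k}"
    then obtain j where "k = int q * j" by (auto elim: dvdE)
    then have j: "k = int q * j" "0 \<le> int q * j" "int q * j < int q * int M"
      using k by (auto simp: mult.commute)
    then show "int q * (k div int q) = k" "k div int q \<in> {0..<int M}" "F (int q * (k div int q)) = F k"
      using q by (auto simp: zero_le_mult_iff)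
  qed (use q in \<open>auto simp: mult.commute\<close>)
  finally show ?thesis .
qed

definition squares_mod :: "nat set \<Rightarrow> int set" where
  "squares_mod Q = {k \<in> {0..<int (\<Prod>Q)}. \<forall>q\<in>Q. Legendre k (int q) = 1}"

lemma odd_primesI:
  assumes "finite Q" "\<And>q. q \<in> Q \<Longrightarrow> prime q" "\<And>q. q \<in> Q \<Longrightarrow> odd q"
  shows "odd_primes Q"
  using assms by unfold_locales

context odd_primes
begin

lemma odd_primes_subset: "D \<subseteq> Q \<Longrightarrow> odd_primes D"
  using finite_Q prime_Q odd_Q finite_subset by (intro odd_primesI) auto

lemma sum_chi_0:
  assumes "Q \<noteq> {}"
  shows "(\<Sum>k\<in>{0..<int m}. chi Q k) = 0"
proof -
  obtain q where "q \<in> Q" using assms by blast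
  then obtain u where u: "coprime u (int m)" "chi Q u = - 1" using exists_twist by blast
  have "(\<Sum>k\<in>{0..<int m}. chi Q (u * k)) = (\<Sum>k\<in>{0..<int m}. chi Q k)"
    by (rule sum_mod_mult[OF m_pos u(1) chi_cong])
  then show ?thesis using u(2) by (simp add: chi_mult sum_negf)
qed

lemma odd_m: "odd m"
  unfolding m_def using finite_Q odd_Q by (auto simp: even_prod_iff)

text \<open>The reflection k -> m - k preserves the set because -1 is a residue at each q, and it
  has no fixed point because m is odd.\<close>

lemma sum_squares_mod_eq_twice_half:
  fixes F :: "int \<Rightarrow> 'a::comm_ring_1"
  assumes ne: "Q \<noteq> {}" and neg: "\<And>q. q \<in> Q \<Longrightarrow> Legendre (- 1) (int q) = 1"
    and F: "\<And>k. k \<in> squares_mod Q \<Longrightarrow> F (int m - k) = F k"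
  shows "(\<Sum>k\<in>squares_mod Q. F k) = 2 * (\<Sum>k | k \<in> squares_mod Q \<and> 2 * k < int m. F k)"
proof -
  have fin: "finite (squares_mod Q)"
    unfolding squares_mod_def by (rule finite_subset[of _ "{0..<int (\<Prod>Q)}"]) auto
  have refl: "int m - k \<in> squares_mod Q" if k: "k \<in> squares_mod Q" for k
  proof -
    have L: "Legendre (int m - k) (int q) = 1" if q: "q \<in> Q" for q
    proof -
      have "[int m - k = - 1 * k] (mod int q)"
        using dvd_m[OF q] by (simp add: cong_iff_dvd_diff)
      then have "Legendre (int m - k) (int q) = Legendre (- 1 * k) (int q)" by (rule Legendre_cong)
      also have "\<dots> = Legendre (- 1) (int q) * Legendre k (int q)"
        by (rule Legendre_mult[OF prime_Q[OF q] odd_Q[OF q]])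
      also have "\<dots> = 1" using neg[OF q] k q by (simp add: squares_mod_def)
      finally show ?thesis .
    qed
    \<comment> \<open>This would fail for empty \<open>Q\<close>, where the set is {0} and the
      reflection leaves the range.\<close>
    have "k \<noteq> 0" using k ne by (auto simp: squares_mod_def Legendre_def)
    then show ?thesis using k L by (auto simp: squares_mod_def m_def)
  qed
  have ne: "2 * k < int m \<or> 2 * k > int m" for k
  proof -
    have "2 * k \<noteq> int m" using odd_m by (metis dvd_triv_left even_of_nat)
    then show ?thesis by linarith
  qed
  define X where "X = {k. k \<in> squares_mod Q \<and> 2 * k < int m}"
  define Y where "Y = {k. k \<in> squares_mod Q \<and> 2 * k > int m}"
  have "squares_mod Q = X \<union> Y" unfolding X_def Y_def using ne by blast
  moreover have "finite X" "finite Y" unfolding X_def Y_def using fin by simp_all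
  moreover have "X \<inter> Y = {}" unfolding X_def Y_def by auto
  ultimately have "(\<Sum>k\<in>squares_mod Q. F k) = (\<Sum>k\<in>X. F k) + (\<Sum>k\<in>Y. F k)"
    by (simp only: sum.union_disjoint)
  also have "(\<Sum>k\<in>Y. F k) = (\<Sum>k\<in>X. F k)"
    by (rule sum.reindex_bij_witness[of _ "\<lambda>k. int m - k" "\<lambda>k. int m - k"])
       (use refl F in \<open>auto simp: X_def Y_def\<close>)
  finally show ?thesis by (simp add: X_def)
qed

end

context eigenform2
begin

lemma Gc_add_int:
  assumes "x \<in> \<rat>"
  shows "Gc (x + of_int n) = Gc x"
proof -
  have nat: "Gc (y + of_nat n) = Gc y" if "y \<in> \<rat>" for y n
  proof (induction n)
    case (Suc n)
    have "Gc (y + of_nat (Suc n)) = Gc ((y + of_nat n) + 1)" by (simp add: algebra_simps)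
    also have "\<dots> = Gc (y + of_nat n)" using that by (intro Gc_periodic) auto
    finally show ?case using Suc by simp
  qed simp
  show ?thesis
  proof (cases "n \<ge> 0")
    case True
    then show ?thesis using nat[OF assms, of "nat n"] by simp
  next
    case False
    have "Gc ((x + of_int n) + of_nat (nat (- n))) = Gc (x + of_int n)" using assms by (intro nat) auto
    then show ?thesis using False by simp
  qed
qed

lemma Gc_cong:
  assumes "[j = k] (mod int M)" "M > 0"
  shows "Gc (of_int j / real M) = Gc (of_int k / real M)"
proof -
  obtain n where n: "j = k + int M * n" using assms(1) by (metis cong_iff_lin cong_sym)
  have "real_of_int j / real M = real_of_int k / real M + of_int n"
    using assms(2) by (simp add: n field_simps)
  then show ?thesis using Gc_add_int[of "real_of_int k / real M" n] by simp
qed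

definition T :: "nat set \<Rightarrow> complex" where
  "T D = (\<Sum>k\<in>{0..<int (\<Prod>D)}. of_int (chi D k) * Gc (of_int k / real (\<Prod>D)))"

text \<open>The analogue of \<open>T D\<close> for the imprimitive character modulo M induced by the
  character of \<open>D\<close>.\<close>

definition twsum :: "nat set \<Rightarrow> nat \<Rightarrow> complex" where
  "twsum D M = (\<Sum>k\<in>{0..<int M}. (if coprime k (int M) then of_int (chi D k) else 0) * Gc (of_int k / real M))"

lemma T_empty: "T {} = Gc 0"
proof -
  have "{0..<1::int} = {0}" by auto
  then show ?thesis by (simp add: T_def chi_def)
qed

lemma twsum_self:
  assumes "odd_primes D"
  shows "twsum D (\<Prod>D) = T D"
proof -
  interpret odd_primes D by fact
  show ?thesis
    unfolding twsum_def T_def using chi_nz_iff by (intro sum.cong refl) (auto simp: m_def)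
qed

text \<open>The units modulo M q are the k prime to M without the multiples of q. The k prime to M
  are grouped by classes modulo M, where the Hecke relation at j/M gives a_q times the old sum minus
  the sum at q j/M. This correction and the multiples of q each amount to chi_D(q) times the old
  sum, hence the factor a_q - 2 chi_D(q).\<close>

lemma twsum_step:
  assumes D: "odd_primes D" "\<Prod>D dvd M" and M: "M > 0" and q: "prime q" "\<not> q dvd M" "\<not> q dvd N"
  shows "twsum D (M * q) = (a q - 2 * of_int (chi D (int q))) * twsum D M"
proof -
  interpret odd_primes D by fact
  have q0: "q > 0" using q prime_gt_0_nat by auto
  have cq: "coprime (int q) (int M)" using q(1,2) by (simp add: prime_imp_coprime)
  then have "coprime q M" by simp
  then have "coprime q m" using D(2) coprime_divisors[of q q m M] by (simp add: m_def)
  then have cqm: "coprime (int q) (int m)" by simp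
  define c where "c = (of_int (chi D (int q)) :: complex)"
  have c2: "c * c = 1" unfolding c_def using chi_sq[OF cqm] by (simp flip: of_int_mult)
  define g where "g k = (if coprime k (int M) then of_int (chi D k) else (0::complex))" for k
  have g_cong: "g x = g y" if "[x = y] (mod int M)" for x y
  proof -
    have "m dvd M" using D(2) by (simp only: m_def)
    then have "int m dvd int M" by simp
    then have "[x = y] (mod int m)" using that cong_dvd_modulus by blast
    moreover have "coprime x (int M) \<longleftrightarrow> coprime y (int M)"
      using that cong_imp_coprime cong_sym by blast
    ultimately show ?thesis using chi_cong by (simp add: g_def)
  qed
  have g_q: "g (int q * j) = c * g j" for j
    using cq by (simp add: g_def c_def chi_mult)
  define x where "x j = real_of_int j / real M" for j
  have tw: "twsum D M = (\<Sum>j\<in>{0..<int M}. g j * Gc (x j))"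
    by (simp add: twsum_def g_def x_def)
  define F where "F k = g k * Gc (of_int k / real (M * q))" for k
  have "twsum D (M * q) = (\<Sum>k\<in>{0..<int (M * q)}. F k - (if int q dvd k then F k else 0))"
    unfolding twsum_def
  proof (intro sum.cong refl)
    fix k
    have "coprime k (int (M * q)) \<longleftrightarrow> coprime k (int M) \<and> \<not> int q dvd k"
      using coprime_int_prime_iff[OF q(1), of k] by simp
    then show "(if coprime k (int (M * q)) then of_int (chi D k) else 0) * Gc (of_int k / real (M * q)) =
        F k - (if int q dvd k then F k else 0)"
      by (auto simp: F_def g_def)
  qed
  also have "\<dots> = (\<Sum>k\<in>{0..<int (M * q)}. F k) - (\<Sum>k\<in>{0..<int (M * q)}. if int q dvd k then F k else 0)"
    by (rule sum_subtractf)
  also have "(\<Sum>k\<in>{0..<int (M * q)}. if int q dvd k then F k else 0) = (\<Sum>j\<in>{0..<int M}. F (int q * j))"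
    by (rule sum_int_multiples[OF q0])
  also have "\<dots> = c * twsum D M"
    unfolding tw sum_distrib_left F_def x_def using q0 by (intro sum.cong refl) (simp add: g_q mult.assoc)
  also have "(\<Sum>k\<in>{0..<int (M * q)}. F k) = (\<Sum>j\<in>{0..<int M}. g j * (\<Sum>b<q. Gc ((x j + real b) / real q)))"
    unfolding sum_int_blocks[OF M] sum_distrib_left
  proof (intro sum.cong refl)
    fix j b
    have "g (j + int M * int b) = g j" by (rule g_cong) (simp add: cong_iff_dvd_diff)
    moreover have "real_of_int (j + int M * int b) / real (M * q) = (x j + real b) / real q"
      using M q0 by (simp add: x_def field_simps)
    ultimately show "F (j + int M * int b) = g j * Gc ((x j + real b) / real q)"
      by (simp only: F_def)
  qed
  also have "\<dots> = (\<Sum>j\<in>{0..<int M}. g j * (a q * Gc (x j) - Gc (real q * x j)))"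
  proof (intro sum.cong refl arg_cong[of _ _ "\<lambda>y. _ * y"])
    fix j
    show "(\<Sum>b<q. Gc ((x j + real b) / real q)) = a q * Gc (x j) - Gc (real q * x j)"
      using Gc_hecke[OF q(1,3), of "x j"] by (simp add: x_def algebra_simps)
  qed
  also have "\<dots> = a q * twsum D M - (\<Sum>j\<in>{0..<int M}. g j * Gc (real q * x j))"
    by (simp add: tw sum_subtractf sum_distrib_left algebra_simps)
  \<comment> \<open>chi(j) = chi(q) chi(q j) because chi(q)^2 = 1; then q j runs through the
    residues modulo M.\<close>
  also have "(\<Sum>j\<in>{0..<int M}. g j * Gc (real q * x j)) = (\<Sum>j\<in>{0..<int M}. c * (g (int q * j) * Gc (x (int q * j))))"
    by (intro sum.cong refl) (simp add: g_q x_def c2 flip: mult.assoc)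
  also have "\<dots> = c * (\<Sum>j\<in>{0..<int M}. g (int q * j) * Gc (x (int q * j)))"
    by (simp add: sum_distrib_left)
  also have "(\<Sum>j\<in>{0..<int M}. g (int q * j) * Gc (x (int q * j))) = twsum D M"
    unfolding tw
  proof (rule sum_mod_mult[OF M cq])
    fix j k assume jk: "[j = k] (mod int M)"
    show "g j * Gc (x j) = g k * Gc (x k)"
      using g_cong[OF jk] Gc_cong[OF jk M] by (simp add: x_def)
  qed
  finally show ?thesis by (simp add: c_def algebra_simps)
qed

lemma twsum_prod:
  assumes D: "odd_primes D" and R: "finite R" "\<And>q. q \<in> R \<Longrightarrow> prime q \<and> \<not> q dvd N" "D \<inter> R = {}"
  shows "twsum D (\<Prod>(D \<union> R)) = (\<Prod>q\<in>R. a q - 2 * of_int (chi D (int q))) * T D"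
  using R
proof (induction R rule: finite_induct)
  case empty
  then show ?case using twsum_self[OF D] by simp
next
  case (insert q R)
  interpret odd_primes D by (rule D)
  have qn: "q \<notin> D \<union> R" using insert by auto
  have fin: "finite (D \<union> R)" using finite_Q insert by simp
  have pr: "p \<in> D \<union> R \<Longrightarrow> prime p" for p using prime_Q insert by auto
  have q: "prime q" "\<not> q dvd N" using insert by auto
  have pos: "\<Prod>(D \<union> R) > 0" using pr prime_gt_0_nat by (intro prod_pos) auto
  have "\<not> q dvd \<Prod>(D \<union> R)"
  proof
    assume "q dvd \<Prod>(D \<union> R)"
    then obtain p where "p \<in> D \<union> R" "q dvd p" using fin q(1) by (auto simp: prime_dvd_prod_iff)
    then show False using pr q(1) qn primes_dvd_imp_eq by metis
  qed
  moreover have "\<Prod>D dvd \<Prod>(D \<union> R)" using fin by (intro prod_dvd_prod_subset) auto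
  ultimately have "twsum D (\<Prod>(D \<union> R) * q) = (a q - 2 * of_int (chi D (int q))) * twsum D (\<Prod>(D \<union> R))"
    using twsum_step[OF D _ pos q(1) _ q(2)] by blast
  moreover have "\<Prod>(D \<union> insert q R) = \<Prod>(D \<union> R) * q" using fin qn by (simp add: mult.commute)
  ultimately show ?case using insert by (simp add: mult.assoc)
qed

lemma sum_twists_eq_sum_squares:
  assumes Q: "odd_primes Q" and N: "\<And>q. q \<in> Q \<Longrightarrow> \<not> q dvd N"
  shows "(\<Sum>D\<in>Pow Q. (\<Prod>q\<in>Q - D. a q - 2 * of_int (chi D (int q))) * T D) =
    2 ^ card Q * (\<Sum>k\<in>squares_mod Q. Gc (of_int k / real (\<Prod>Q)))"
proof -
  interpret odd_primes Q by (rule Q)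
  have "(\<Sum>D\<in>Pow Q. (\<Prod>q\<in>Q - D. a q - 2 * of_int (chi D (int q))) * T D) = (\<Sum>D\<in>Pow Q. twsum D (\<Prod>Q))"
  proof (intro sum.cong refl)
    fix D assume D: "D \<in> Pow Q"
    have "twsum D (\<Prod>(D \<union> (Q - D))) = (\<Prod>q\<in>Q - D. a q - 2 * of_int (chi D (int q))) * T D"
      using D odd_primes_subset finite_Q prime_Q N by (intro twsum_prod) auto
    moreover have "D \<union> (Q - D) = Q" using D by auto
    ultimately show "(\<Prod>q\<in>Q - D. a q - 2 * of_int (chi D (int q))) * T D = twsum D (\<Prod>Q)" by simp
  qed
  also have "\<dots> = (\<Sum>k\<in>{0..<int m}. \<Sum>D\<in>Pow Q. (if coprime k (int m) then of_int (chi D k) else 0) * Gc (of_int k / real m))"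
    unfolding twsum_def m_def by (rule sum.swap)
  also have "\<dots> = (\<Sum>k\<in>{0..<int m}. if k \<in> squares_mod Q then 2 ^ card Q * Gc (of_int k / real m) else 0)"
  proof (intro sum.cong refl)
    fix k assume k: "k \<in> {0..<int m}"
    have s: "(\<Sum>D\<in>Pow Q. chi D k) = (\<Prod>q\<in>Q. 1 + Legendre k (int q))"
      unfolding chi_def by (rule sum_Pow_prod[OF finite_Q])
    have "(\<Sum>D\<in>Pow Q. (if coprime k (int m) then of_int (chi D k) else 0)) =
        (if k \<in> squares_mod Q then 2 ^ card Q else (0::complex))"
    proof (cases "coprime k (int m)")
      case False
      then obtain q where q: "q \<in> Q" "int q dvd k" by (auto simp: coprime_m_iff)
      then have "Legendre k (int q) = 0" by (simp add: Legendre_eq_0_iff)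
      then have "k \<notin> squares_mod Q" using q(1) by (force simp: squares_mod_def)
      then show ?thesis using False by simp
    next
      case True
      have "(\<Prod>q\<in>Q. 1 + Legendre k (int q)) = (if k \<in> squares_mod Q then 2 ^ card Q else 0)"
      proof (cases "k \<in> squares_mod Q")
        case True
        then show ?thesis by (simp add: squares_mod_def)
      next
        case False
        then obtain q where q: "q \<in> Q" "Legendre k (int q) \<noteq> 1" using k by (auto simp: squares_mod_def m_def)
        then have "Legendre k (int q) = - 1"
          using Legendre_cases[of k "int q"] True Legendre_eq_0_iff[of k "int q"] by (auto simp: coprime_m_iff)
        then have "(\<Prod>q\<in>Q. 1 + Legendre k (int q)) = 0"
          by (intro prod_zero[OF finite_Q] bexI[of _ q]) (use q in simp_all)
        then show ?thesis using False by simp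
      qed
      then show ?thesis using True s by (simp flip: of_int_sum)
    qed
    then show "(\<Sum>D\<in>Pow Q. (if coprime k (int m) then of_int (chi D k) else 0) * Gc (of_int k / real m)) =
        (if k \<in> squares_mod Q then 2 ^ card Q * Gc (of_int k / real m) else 0)"
      unfolding sum_distrib_right[symmetric] by simp
  qed
  also have "\<dots> = (\<Sum>k\<in>squares_mod Q. 2 ^ card Q * Gc (of_int k / real m))"
    by (rule sum.mono_neutral_cong_right) (auto simp: squares_mod_def m_def)
  finally show ?thesis by (simp add: sum_distrib_left m_def)
qed

text \<open>Replace k by -k and use that G(-x) is the conjugate of G(x). So \<open>T D\<close> is
  real for an even character and purely imaginary for an odd one.\<close>

lemma T_cnj:
  assumes "odd_primes D"
  shows "cnj (T D) = of_int (chi D (- 1)) * T D"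
proof -
  interpret odd_primes D by fact
  have "(\<Sum>k\<in>{0..<int m}. of_int (chi D (- 1 * k)) * Gc (of_int (- 1 * k) / real m)) = T D"
    unfolding T_def m_def[symmetric]
  proof (rule sum_mod_mult[OF m_pos])
    show "coprime (- 1) (int m)" by simp
    fix j k assume jk: "[j = k] (mod int m)"
    show "of_int (chi D j) * Gc (of_int j / real m) = of_int (chi D k) * Gc (of_int k / real m)"
      using chi_cong[OF jk] Gc_cong[OF jk m_pos] by simp
  qed
  moreover have "of_int (chi D (- 1 * k)) * Gc (of_int (- 1 * k) / real m) =
      of_int (chi D (- 1)) * cnj (of_int (chi D k) * Gc (of_int k / real m))" for k
    unfolding chi_mult using Gc_uminus[of "of_int k / real m"] by simp
  ultimately have "of_int (chi D (- 1)) * cnj (T D) = T D"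
    by (simp add: T_def m_def sum_distrib_left)
  then show ?thesis using chi_minus1 by (metis minus_minus mult_1 mult_minus1 of_int_1 of_int_minus)
qed

end

section \<open>2-adic valuations of twisted sums\<close>


lemma algebraic_of_rat_real:
  assumes "x \<in> \<rat>"
  shows "algebraic (complex_of_real x)"
proof -
  obtain r where r: "x = of_rat r" using assms by (auto elim: Rats_cases)
  obtain p q where pq: "r = Fract p q" "q > 0" "coprime p q" by (rule Rat_cases)
  have "complex_of_real x * of_int q = of_int p"
    using pq by (simp add: r of_rat_rat)
  then show ?thesis using pq(2)
    by (intro algebraicI[of "[:- of_int p, of_int q:]"]) (auto simp: coeff_pCons split: nat.splits)
qed

section \<open>Valuations of rational numbers\<close>

locale valuation2 =
  fixes v :: "complex \<Rightarrow> ereal"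
  assumes val: "two_adic_valuation v"
begin

definition V :: "real \<Rightarrow> ereal" where
  "V x = v (of_real x)"

lemma V_mult: "x \<in> \<rat> \<Longrightarrow> y \<in> \<rat> \<Longrightarrow> V (x * y) = V x + V y"
  using val algebraic_of_rat_real unfolding two_adic_valuation_def V_def by simp

lemma V_add_ge: "x \<in> \<rat> \<Longrightarrow> y \<in> \<rat> \<Longrightarrow> min (V x) (V y) \<le> V (x + y)"
  using val algebraic_of_rat_real unfolding two_adic_valuation_def V_def by simp

lemma V_MInf: "x \<in> \<rat> \<Longrightarrow> V x \<noteq> - \<infinity>"
  using val algebraic_of_rat_real unfolding two_adic_valuation_def V_def by simp

lemma V_PInf: "x \<in> \<rat> \<Longrightarrow> V x = \<infinity> \<longleftrightarrow> x = 0"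
  using val algebraic_of_rat_real unfolding two_adic_valuation_def V_def by simp

lemma V_0 [simp]: "V 0 = \<infinity>"
  using V_PInf[of 0] by simp

lemma V_2 [simp]: "V 2 = 1"
  using val unfolding two_adic_valuation_def V_def by simp

lemma V_finite:
  assumes "x \<in> \<rat>" "x \<noteq> 0"
  obtains r where "V x = ereal r"
  using V_MInf[OF assms(1)] V_PInf[OF assms(1)] assms(2) by (cases "V x") auto

lemma V_sq_zero:
  assumes "x \<in> \<rat>" "V (x * x) = 0"
  shows "V x = 0"
proof -
  have "x \<noteq> 0" using assms(2) by auto
  then obtain r where r: "V x = ereal r" using V_finite[OF assms(1)] by blast
  then have "ereal (r + r) = 0" using V_mult[OF assms(1,1)] assms(2) by simp
  then show ?thesis using r by (simp add: zero_ereal_def)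
qed

lemma V_1 [simp]: "V 1 = 0"
proof -
  obtain r where r: "V 1 = ereal r" using V_finite[of 1] by auto
  have "V (1 * 1) = V 1 + V 1" by (rule V_mult) auto
  then show ?thesis using r by simp
qed

lemma V_minus1 [simp]: "V (- 1) = 0"
  by (rule V_sq_zero) auto

lemma V_minus [simp]: "x \<in> \<rat> \<Longrightarrow> V (- x) = V x"
  using V_mult[of "- 1" x] by simp

lemma V_of_nat_ge: "V (of_nat n) \<ge> 0"
proof (induction n)
  case (Suc n)
  have "min (V (of_nat n)) (V 1) \<le> V (of_nat n + 1)" by (rule V_add_ge) auto
  moreover have "0 \<le> min (V (of_nat n)) (V 1)" using Suc by simp
  ultimately have "0 \<le> V (of_nat n + 1)" by (rule order_trans[rotated])
  then show ?case by (simp add: add.commute)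
qed simp

lemma V_of_int_ge: "V (of_int n) \<ge> 0"
proof (cases "n \<ge> 0")
  case True
  then show ?thesis using V_of_nat_ge[of "nat n"] by simp
next
  case False
  then have "V (- of_int n) \<ge> 0" using V_of_nat_ge[of "nat (- n)"] by simp
  then show ?thesis by simp
qed

lemma V_even: "even n \<Longrightarrow> V (of_int n) \<ge> 1"
proof -
  assume "even n"
  then obtain k where k: "n = 2 * k" by blast
  have "V (of_int n) = 1 + V (of_int k)" using V_mult[of 2 "of_int k"] by (simp add: k)
  also have "\<dots> \<ge> 1 + 0" by (intro add_left_mono V_of_int_ge)
  finally show ?thesis by simp
qed

text \<open>1 is the sum of n and the even number 1 - n, so a positive valuation of n would make
  that of 1 positive.\<close>

lemma V_odd:
  assumes "odd n"
  shows "V (of_int n) = 0"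
proof (rule antisym)
  show "V (of_int n) \<ge> 0" by (rule V_of_int_ge)
  have "min (V (of_int n)) (V (of_int (1 - n))) \<le> V (of_int n + of_int (1 - n))"
    by (rule V_add_ge) auto
  then have "min (V (of_int n)) (V (of_int (1 - n))) \<le> 0" by simp
  moreover have "V (of_int (1 - n)) \<ge> 1" using assms by (intro V_even) simp
  then have "V (of_int (1 - n)) > 0" by (rule less_le_trans[rotated]) simp
  ultimately show "V (of_int n) \<le> 0" by (metis min_less_iff_conj not_le)
qed

text \<open>The bound is a real number, so adding bounds never meets infinite values; x = 0
  satisfies every bound.\<close>

definition vge :: "real \<Rightarrow> real \<Rightarrow> bool" where
  "vge x b \<longleftrightarrow> ereal b \<le> V x"

lemma vge_mult: "x \<in> \<rat> \<Longrightarrow> y \<in> \<rat> \<Longrightarrow> vge x b \<Longrightarrow> vge y c \<Longrightarrow> vge (x * y) (b + c)"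
  unfolding vge_def by (simp add: V_mult add_mono flip: plus_ereal.simps(1))

lemma vge_add: "x \<in> \<rat> \<Longrightarrow> y \<in> \<rat> \<Longrightarrow> vge x b \<Longrightarrow> vge y b \<Longrightarrow> vge (x + y) b"
  unfolding vge_def using V_add_ge[of x y] by (meson min.boundedI order_trans)

lemma vge_minus: "x \<in> \<rat> \<Longrightarrow> vge x b \<Longrightarrow> vge (- x) b"
  by (simp add: vge_def)

lemma vge_diff: "x \<in> \<rat> \<Longrightarrow> y \<in> \<rat> \<Longrightarrow> vge x b \<Longrightarrow> vge y b \<Longrightarrow> vge (x - y) b"
  using vge_add[of x "- y" b] vge_minus by simp

lemma vge_mono: "vge x b \<Longrightarrow> c \<le> b \<Longrightarrow> vge x c"
  unfolding vge_def by (meson ereal_less_eq(3) order_trans)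

lemma vge_of_int: "vge (of_int n) 0"
  using V_of_int_ge[of n] by (simp add: vge_def zero_ereal_def)

lemma vge_of_nat: "vge (of_nat n) 0"
  using V_of_nat_ge[of n] by (simp add: vge_def zero_ereal_def)

lemma vge_even: "even n \<Longrightarrow> vge (of_int n) 1"
  using V_even[of n] by (simp add: vge_def one_ereal_def)

lemma vge_2_power: "vge (2 ^ n) (real n)"
proof (induction n)
  case 0
  show ?case by (simp add: vge_def zero_ereal_def)
next
  case (Suc n)
  have "vge 2 1" by (simp add: vge_def one_ereal_def)
  from vge_mult[OF _ _ this Suc] show ?case by (simp add: add.commute)
qed

lemma Rats_sum: "(\<And>x. x \<in> A \<Longrightarrow> f x \<in> \<rat>) \<Longrightarrow> sum f A \<in> \<rat>"
  by (induction A rule: infinite_finite_induct) auto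

lemma Rats_prod: "(\<And>x. x \<in> A \<Longrightarrow> f x \<in> \<rat>) \<Longrightarrow> prod f A \<in> \<rat>"
  by (induction A rule: infinite_finite_induct) auto

lemma vge_sum: "(\<And>x. x \<in> A \<Longrightarrow> f x \<in> \<rat>) \<Longrightarrow> (\<And>x. x \<in> A \<Longrightarrow> vge (f x) b) \<Longrightarrow> vge (sum f A) b"
proof (induction A rule: infinite_finite_induct)
  case (insert x A)
  then show ?case by (simp add: vge_add Rats_sum)
qed (simp_all add: vge_def)

lemma vge_prod:
  assumes "finite A" "\<And>x. x \<in> A \<Longrightarrow> f x \<in> \<rat>" "\<And>x. x \<in> A \<Longrightarrow> vge (f x) b"
  shows "vge (prod f A) (real (card A) * b)"
  using assms
proof (induction A rule: finite_induct)
  case empty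
  show ?case by (simp add: vge_def zero_ereal_def)
next
  case (insert x A)
  then have "vge (f x * prod f A) (b + real (card A) * b)"
    by (intro vge_mult Rats_prod) auto
  then show ?case using insert by (simp add: algebra_simps)
qed

lemma V_prod:
  assumes "finite A" "\<And>x. x \<in> A \<Longrightarrow> f x \<in> \<rat>" "\<And>x. x \<in> A \<Longrightarrow> V (f x) = ereal b"
  shows "V (prod f A) = ereal (real (card A) * b)"
  using assms
proof (induction A rule: finite_induct)
  case empty
  show ?case by (simp add: zero_ereal_def)
next
  case (insert x A)
  then have "V (f x * prod f A) = ereal b + ereal (real (card A) * b)"
    by (subst V_mult) (auto intro: Rats_prod)
  then show ?case using insert by (simp add: algebra_simps)
qed

lemma V_add_eq:
  assumes x: "x \<in> \<rat>" and y: "y \<in> \<rat>" and "V x = ereal b" "vge y c" "c > b"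
  shows "V (x + y) = ereal b"
proof (rule antisym)
  have "vge (x + y) b"
    using assms by (intro vge_add) (auto simp: vge_def intro: order_trans[of _ "ereal c"])
  then show "ereal b \<le> V (x + y)" by (simp add: vge_def)
  have "min (V (x + y)) (V (- y)) \<le> V ((x + y) + - y)" using x y by (intro V_add_ge) auto
  then have "min (V (x + y)) (V y) \<le> ereal b" using assms by simp
  moreover have "V y > ereal b" using assms unfolding vge_def by (meson less_ereal.simps(1) less_le_trans)
  ultimately show "V (x + y) \<le> ereal b" by (auto simp: min_def split: if_splits)
qed

text \<open>The residue field of the rationals at 2 has two elements: a unit is a quotient of two
  odd integers, hence 1 modulo 2. This uses rationality, not just algebraicity.\<close>

lemma vge_unit_diff:
  assumes u: "u \<in> \<rat>" "V u = 0"
  shows "vge (u - 1) 1"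
proof -
  obtain r where r: "u = of_rat r" using u(1) by (auto elim: Rats_cases)
  obtain p q where pq: "r = Fract p q" "q > 0" "coprime p q" by (rule Rat_cases)
  have uq: "u * of_int q = of_int p" using pq by (simp add: r of_rat_rat)
  then have Vpq: "V (of_int p) = V (of_int q)" using V_mult[of u "of_int q"] u by simp
  have qo: "odd q"
  proof
    assume e: "even q"
    then have "odd p" using pq(3) by (metis coprime_common_divisor odd_one)
    then have "V (of_int q) = 0" using V_odd Vpq by simp
    then show False using V_even[OF e] by simp
  qed
  have po: "odd p"
  proof
    assume "even p"
    then have "V (of_int p) \<ge> 1" by (rule V_even)
    then show False using V_odd[OF qo] Vpq by simp
  qed
  have "V ((u - 1) * of_int q) = V (of_int (p - q))" using uq by (simp add: algebra_simps)
  also have "V ((u - 1) * of_int q) = V (u - 1)" using V_mult[of "u - 1" "of_int q"] V_odd[OF qo] u by simp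
  finally show ?thesis using vge_even[of "p - q"] po qo by (simp add: vge_def)
qed

text \<open>After division by one of the terms all of them are units, hence 1 modulo 2, and their
  sum is congruent to their number, which is odd.\<close>

lemma V_odd_sum:
  assumes A: "finite A" "odd (card A)" and f: "\<And>x. x \<in> A \<Longrightarrow> f x \<in> \<rat>" "\<And>x. x \<in> A \<Longrightarrow> V (f x) = ereal b"
  shows "V (sum f A) = ereal b"
proof -
  obtain x0 where x0: "x0 \<in> A" using A by (metis card.empty ex_in_conv even_zero)
  have nz: "f x0 \<noteq> 0" using f(2)[OF x0] by auto
  have u: "f x / f x0 \<in> \<rat>" "V (f x / f x0) = 0" if x: "x \<in> A" for x
  proof -
    show 1: "f x / f x0 \<in> \<rat>" using f(1) x x0 by auto
    have "V (f x / f x0 * f x0) = V (f x / f x0) + ereal b"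
      using V_mult[OF 1 f(1)[OF x0]] f(2)[OF x0] by simp
    then have "ereal b = V (f x / f x0) + ereal b" using nz f(2)[OF x] by simp
    then show "V (f x / f x0) = 0" by (cases "V (f x / f x0)") (auto simp: zero_ereal_def)
  qed
  define s where "s = (\<Sum>x\<in>A. f x / f x0 - 1)"
  have s: "s \<in> \<rat>" "vge s 1"
    unfolding s_def using u by (auto intro!: Rats_sum vge_sum vge_unit_diff)
  have "V (of_int (int (card A)) + s) = ereal 0"
    by (rule V_add_eq[of _ _ _ 1]) (use s A V_odd[of "int (card A)"] in \<open>auto simp: zero_ereal_def\<close>)
  moreover have "sum f A = f x0 * (of_int (int (card A)) + s)"
    using nz by (simp add: s_def sum_subtractf distrib_left sum_distrib_left algebra_simps)
  ultimately show ?thesis using V_mult[of "f x0" "of_int (int (card A)) + s"] f x0 s by simp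
qed

end

text \<open>The arithmetic of the recursion, separated from its analytic origin: \<open>t D\<close>
  is the normalized twisted value, \<open>\<gamma> D q\<close> stands for a_q - 2 chi_D(q), and
  \<open>sg\<close> for the parity of the character.\<close>

locale twist_recursion = valuation2 +
  fixes Q :: "nat set" and t :: "nat set \<Rightarrow> real" and \<gamma> :: "nat set \<Rightarrow> nat \<Rightarrow> real" and L :: real
    and sg :: "nat set \<Rightarrow> bool"
  assumes fin: "finite Q"
    and t_rat: "\<And>D. D \<subseteq> Q \<Longrightarrow> t D \<in> \<rat>"
    and t_empty: "t {} = L"
    and \<gamma>_rat: "\<And>D q. D \<subseteq> Q \<Longrightarrow> q \<in> Q - D \<Longrightarrow> \<gamma> D q \<in> \<rat>"
begin

lemma L_rat: "L \<in> \<rat>"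
  using t_rat[of "{}"] t_empty by simp

definition cc :: "nat set \<Rightarrow> nat set \<Rightarrow> real" where
  "cc D E = (\<Prod>q\<in>D - E. \<gamma> E q)"

text \<open>Only characters of equal parity interact, because the twisted sums of the two parities
  lie on the real and on the imaginary axis.\<close>

definition proper :: "nat set \<Rightarrow> nat set set" where
  "proper D = {E. E \<subset> D \<and> sg E = sg D}"

text \<open>The case \<open>e = 0\<close> covers arbitrary twists, \<open>e = 1\<close> the twists by primes congruent to 1 modulo 4.\<close>

definition rec :: "nat \<Rightarrow> bool" where
  "rec e \<longleftrightarrow> (\<forall>D. D \<subseteq> Q \<longrightarrow> D \<noteq> {} \<longrightarrow>
     (\<exists>h::nat. \<exists>n::int. t D = 2 ^ (card D + e) * (real h * L + of_int n) - (\<Sum>E\<in>proper D. cc D E * t E)))"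

lemma fin_sub: "D \<subseteq> Q \<Longrightarrow> finite D"
  using fin finite_subset by blast

lemma cc_rat: "D \<subseteq> Q \<Longrightarrow> E \<subseteq> D \<Longrightarrow> cc D E \<in> \<rat>"
  unfolding cc_def using \<gamma>_rat[of E] by (intro Rats_prod) blast

lemma properD: "E \<in> proper D \<Longrightarrow> E \<subset> D"
  by (simp add: proper_def)

lemma cc_t_rat: "D \<subseteq> Q \<Longrightarrow> E \<in> proper D \<Longrightarrow> cc D E * t E \<in> \<rat>"
  using properD[of E D] by (intro Rats_mult cc_rat t_rat) auto

text \<open>The integer n is only known to have valuation at least 0, so the bound for the bracket
  is taken to be at most 0.\<close>

lemma vge_leading_term:
  assumes "vge L \<mu>" "\<mu>' \<le> \<mu>" "\<mu>' \<le> 0"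
  shows "vge (2 ^ k * (real h * L + of_int n)) (real k + \<mu>')"
proof -
  have "vge (real h * L) (0 + \<mu>')"
    using assms L_rat by (intro vge_mult vge_of_nat) (auto intro: vge_mono)
  moreover have "vge (of_int n) \<mu>'" using vge_of_int assms(3) by (rule vge_mono)
  ultimately have "vge (real h * L + of_int n) \<mu>'" using L_rat by (intro vge_add) auto
  then show ?thesis using L_rat by (intro vge_mult vge_2_power) auto
qed

lemma rec_bound:
  assumes r: "rec e" and D: "D \<subseteq> Q" "D \<noteq> {}"
    and main: "\<And>h n. vge (2 ^ (card D + e) * (real h * L + of_int n)) b"
    and E: "\<And>E. E \<subset> D \<Longrightarrow> vge (cc D E * t E) b"
  shows "vge (t D) b"
proof -
  obtain h n where t: "t D = 2 ^ (card D + e) * (real h * L + of_int n) - (\<Sum>E\<in>proper D. cc D E * t E)"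
    using r D unfolding rec_def by blast
  show ?thesis unfolding t
    using D L_rat E properD by (intro vge_diff vge_sum Rats_sum main cc_t_rat) auto
qed

lemma vge_cc:
  assumes "D \<subseteq> Q" "E \<subseteq> D" "\<And>q. q \<in> D - E \<Longrightarrow> vge (\<gamma> E q) g"
  shows "vge (cc D E) (real (card (D - E)) * g)"
proof -
  have "E \<subseteq> Q" using assms(1,2) by blast
  then show ?thesis
    unfolding cc_def using assms \<gamma>_rat[of E] fin_sub[of D] by (intro vge_prod) auto
qed

text \<open>Induction over subsets: the factors contribute |D - E| and \<open>t E\<close>
  contributes |E| + mu, together |D| + mu. The condition mu <= e comes from the integer in the
  leading term, whose contribution is only known to have valuation at least |D| + e.\<close>

lemma bound_ge1:
  assumes r: "rec e" and \<gamma>: "\<And>D q. D \<subseteq> Q \<Longrightarrow> q \<in> Q - D \<Longrightarrow> vge (\<gamma> D q) 1"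
    and L: "vge L \<mu>" "\<mu> \<le> real e" and D: "D \<subseteq> Q" and e: "e \<le> 1"
  shows "vge (t D) (real (card D) + \<mu>)"
  using fin_sub[OF D] D
proof (induction D rule: finite_psubset_induct)
  case (psubset D)
  show ?case
  proof (cases "D = {}")
    case True
    then show ?thesis using L by (simp add: t_empty)
  next
    case False
    show ?thesis
    proof (rule rec_bound[OF r psubset.prems False])
      fix h n
      have "vge (2 ^ (card D + e) * (real h * L + of_int n)) (real (card D + e) + min 0 (\<mu> - real e))"
        by (rule vge_leading_term[OF L(1)]) auto
      then show "vge (2 ^ (card D + e) * (real h * L + of_int n)) (real (card D) + \<mu>)"
        by (rule vge_mono) (use L in auto)
    next
      fix E assume E: "E \<subset> D"
      have "vge (cc D E) (real (card (D - E)) * 1)"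
        using psubset.prems E by (intro vge_cc \<gamma>) auto
      moreover have "vge (t E) (real (card E) + \<mu>)" using psubset.IH[OF E] psubset.prems E by auto
      ultimately have "vge (cc D E * t E) (real (card (D - E)) * 1 + (real (card E) + \<mu>))"
        using psubset.prems E by (intro vge_mult cc_rat t_rat) auto
      moreover have "card D = card (D - E) + card E"
        using E psubset.hyps by (metis card_Diff_subset card_mono finite_subset le_add_diff_inverse2 psubset_imp_subset)
      ultimately show "vge (cc D E * t E) (real (card D) + \<mu>)" by (simp add: algebra_simps)
    qed
  qed
qed

text \<open>The factors gain nothing here, so the bound does not grow with \<open>D\<close>. The
  leading term has valuation at least |D| + e + min 0 mu with |D| >= 1, which admits mu up to e +
  1.\<close>

lemma bound_ge0:
  assumes r: "rec e" and \<gamma>: "\<And>D q. D \<subseteq> Q \<Longrightarrow> q \<in> Q - D \<Longrightarrow> vge (\<gamma> D q) 0"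
    and L: "vge L \<mu>" "\<mu> \<le> real e + 1" and D: "D \<subseteq> Q"
  shows "vge (t D) \<mu>"
  using fin_sub[OF D] D
proof (induction D rule: finite_psubset_induct)
  case (psubset D)
  show ?case
  proof (cases "D = {}")
    case True
    then show ?thesis using L by (simp add: t_empty)
  next
    case False
    then have c: "card D \<ge> 1" using psubset.hyps by (simp add: Suc_le_eq card_gt_0_iff)
    show ?thesis
    proof (rule rec_bound[OF r psubset.prems False])
      fix h n
      have "vge (2 ^ (card D + e) * (real h * L + of_int n)) (real (card D + e) + min 0 \<mu>)"
        by (rule vge_leading_term[OF L(1)]) auto
      then show "vge (2 ^ (card D + e) * (real h * L + of_int n)) \<mu>"
        by (rule vge_mono) (use L c in auto)
    next
      fix E assume E: "E \<subset> D"
      have "vge (cc D E) (real (card (D - E)) * 0)"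
        using psubset.prems E by (intro vge_cc \<gamma>) auto
      moreover have "vge (t E) \<mu>" using psubset.IH[OF E] psubset.prems E by auto
      ultimately have "vge (cc D E * t E) (real (card (D - E)) * 0 + \<mu>)"
        using psubset.prems E by (intro vge_mult cc_rat t_rat) auto
      then show "vge (cc D E * t E) \<mu>" by simp
    qed
  qed
qed

text \<open>The improvement by 1 has two sources: e = 1 in the leading term, and 2 |D| >= |D| + 1
  for the term of the empty set. The other terms inherit it by induction.\<close>

lemma bound_all_ge2:
  assumes r: "rec 1" and \<gamma>: "\<And>D q. D \<subseteq> Q \<Longrightarrow> q \<in> Q - D \<Longrightarrow> vge (\<gamma> D q) 1"
    and \<gamma>2: "\<And>q. q \<in> Q \<Longrightarrow> vge (\<gamma> {} q) 2"
    and L: "vge L \<mu>" "\<mu> \<le> 0" and D: "D \<subseteq> Q" "D \<noteq> {}"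
  shows "vge (t D) (real (card D) + \<mu> + 1)"
  using fin_sub[OF D(1)] D
proof (induction D rule: finite_psubset_induct)
  case (psubset D)
  then have c: "card D \<ge> 1" by (simp add: Suc_le_eq card_gt_0_iff)
  show ?case
  proof (rule rec_bound[OF r psubset.prems])
    fix h n
    have "vge (2 ^ (card D + 1) * (real h * L + of_int n)) (real (card D + 1) + \<mu>)"
      by (rule vge_leading_term[OF L(1)]) (use L in auto)
    then show "vge (2 ^ (card D + 1) * (real h * L + of_int n)) (real (card D) + \<mu> + 1)"
      by (rule vge_mono) auto
  next
    fix E assume E: "E \<subset> D"
    show "vge (cc D E * t E) (real (card D) + \<mu> + 1)"
    proof (cases "E = {}")
      case True
      have "vge (cc D {}) (real (card (D - {})) * 2)"
        using psubset.prems by (intro vge_cc \<gamma>2) auto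
      then have "vge (cc D {} * t {}) (real (card (D - {})) * 2 + \<mu>)"
        using psubset.prems L by (intro vge_mult cc_rat t_rat) (auto simp: t_empty)
      then show ?thesis unfolding True by (rule vge_mono) (use c in auto)
    next
      case False
      have "vge (cc D E) (real (card (D - E)) * 1)"
        using psubset.prems E by (intro vge_cc \<gamma>) auto
      moreover have "vge (t E) (real (card E) + \<mu> + 1)" using psubset.IH[OF E] psubset.prems E False by auto
      ultimately have "vge (cc D E * t E) (real (card (D - E)) * 1 + (real (card E) + \<mu> + 1))"
        using psubset.prems E by (intro vge_mult cc_rat t_rat) auto
      moreover have "card D = card (D - E) + card E"
        using E psubset.hyps by (metis card_Diff_subset card_mono finite_subset le_add_diff_inverse2 psubset_imp_subset)
      ultimately show ?thesis by (simp add: algebra_simps)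
    qed
  qed
qed

text \<open>As \<open>sg\<close> always holds, all 2^|D| - 1 proper subsets occur, and their terms
  share the valuation |D| g + mu. Their number being odd, this valuation survives in the sum, and
  the leading term has a strictly larger one.\<close>

lemma valuation_eq_of_odd_count:
  assumes r: "rec 1" and sg: "\<And>D. D \<subseteq> Q \<Longrightarrow> sg D"
    and \<gamma>: "\<And>D q. D \<subseteq> Q \<Longrightarrow> q \<in> Q - D \<Longrightarrow> V (\<gamma> D q) = ereal g"
    and L: "V L = ereal \<mu>" and g: "g = 0 \<and> \<mu> < 2 \<or> g = 1 \<and> \<mu> < 1"
    and D: "D \<subseteq> Q"
  shows "V (t D) = ereal (real (card D) * g + \<mu>)"
  using fin_sub[OF D] D
proof (induction D rule: finite_psubset_induct)
  case (psubset D)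
  show ?case
  proof (cases "D = {}")
    case True
    then show ?thesis using L by (simp add: t_empty)
  next
    case False
    then have c: "card D \<ge> 1" using psubset.hyps by (simp add: Suc_le_eq card_gt_0_iff)
    obtain h n where t: "t D = 2 ^ (card D + 1) * (real h * L + of_int n) - (\<Sum>E\<in>proper D. cc D E * t E)"
      using r psubset.prems False unfolding rec_def by blast
    have pow: "proper D = Pow D - {D}" using sg psubset.prems unfolding proper_def by auto
    have "card (proper D) = 2 ^ card D - 1"
      unfolding pow using psubset.hyps by (simp add: card_Pow)
    moreover have "even (2 ^ card D :: nat)" using c by simp
    ultimately have odd: "odd (card (proper D))" by simp
    have V: "V (\<Sum>E\<in>proper D. cc D E * t E) = ereal (real (card D) * g + \<mu>)"
    proof (rule V_odd_sum)
      show "finite (proper D)" unfolding pow using psubset.hyps by simp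
      show "odd (card (proper D))" by fact
      fix E assume E: "E \<in> proper D"
      then have E': "E \<subset> D" by (rule properD)
      show "cc D E * t E \<in> \<rat>" using psubset.prems E by (rule cc_t_rat)
      have "V (cc D E) = ereal (real (card (D - E)) * g)"
        unfolding cc_def using psubset.prems psubset.hyps E' by (intro V_prod \<gamma> \<gamma>_rat) auto
      moreover have "V (t E) = ereal (real (card E) * g + \<mu>)" using psubset.IH[OF E'] psubset.prems E' by auto
      moreover have "card D = card (D - E) + card E"
        using E' psubset.hyps by (metis card_Diff_subset card_mono finite_subset le_add_diff_inverse2 psubset_imp_subset)
      ultimately show "V (cc D E * t E) = ereal (real (card D) * g + \<mu>)"
        using psubset.prems E' V_mult[OF cc_rat t_rat, of D E E] by (simp add: algebra_simps)
    qed
    have rat: "(\<Sum>E\<in>proper D. cc D E * t E) \<in> \<rat>" "2 ^ (card D + 1) * (real h * L + of_int n) \<in> \<rat>"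
      using psubset.prems L_rat by (auto intro!: Rats_sum cc_t_rat)
    have "vge (2 ^ (card D + 1) * (real h * L + of_int n)) (real (card D + 1) + min 0 \<mu>)"
      by (rule vge_leading_term[of \<mu>]) (use L in \<open>auto simp: vge_def\<close>)
    \<comment> \<open>The conditions on g and mu ensure strictness: mu < |D| + 1 + min 0 mu in the
      first case, mu < 1 + min 0 mu in the second.\<close>
    moreover have "real (card D) * g + \<mu> < real (card D + 1) + min 0 \<mu>"
      using g c by (auto simp: min_def)
    ultimately have "V (- (\<Sum>E\<in>proper D. cc D E * t E) + 2 ^ (card D + 1) * (real h * L + of_int n)) =
        ereal (real (card D) * g + \<mu>)"
      using V rat by (intro V_add_eq) auto
    then show ?thesis unfolding t by (simp add: algebra_simps)
  qed
qed

end

section \<open>Rationality and the recursion over divisors of the twist\<close>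


text \<open>The divisor sum obeys the Hecke recursion with eigenvalue q + 1. The divisors of q n are
  those of n and their q-fold multiples; the overlap consists of the q-fold divisors of n/q.\<close>

lemma divisor_sum_prime_mult:
  fixes q n :: nat
  assumes q: "prime q" and n: "n > 0"
  shows "(\<Sum>d | d dvd q * n. d) + q * (if q dvd n then \<Sum>d | d dvd n div q. d else 0) =
    (q + 1) * (\<Sum>d | d dvd n. d)"
proof -
  define B where "B = {d. d dvd n}"
  have q0: "q > 0" using q prime_gt_0_nat by auto
  have fin: "finite B" using n by (simp add: B_def)
  have inj: "inj_on ((*) q) X" for X using q0 by (simp add: inj_on_def)
  have U: "{d. d dvd q * n} = B \<union> (*) q ` B"
  proof (intro equalityI subsetI)
    fix d assume "d \<in> {d. d dvd q * n}"
    then have d: "d dvd q * n" by simp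
    show "d \<in> B \<union> (*) q ` B"
    proof (cases "q dvd d")
      case True
      then obtain e where "d = q * e" by blast
      then show ?thesis using d q0 by (auto simp: B_def)
    next
      case False
      then have "coprime d q" using q by (metis coprime_commute prime_imp_coprime)
      then show ?thesis using d by (simp add: B_def coprime_dvd_mult_right_iff)
    qed
  qed (auto simp: B_def)
  have I: "(\<Sum>d\<in>B \<inter> (*) q ` B. d) = q * (if q dvd n then \<Sum>d | d dvd n div q. d else 0)"
  proof (cases "q dvd n")
    case True
    then obtain k where k: "n = q * k" by blast
    have "B \<inter> (*) q ` B = (*) q ` {d. d dvd n div q}"
      using q0 by (auto simp: B_def k intro: dvd_mult)
    then show ?thesis using True by (simp add: sum.reindex[OF inj] sum_distrib_left)
  next
    case False
    then have "B \<inter> (*) q ` B = {}" by (auto simp: B_def dest: dvd_mult_left)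
    then show ?thesis using False by simp
  qed
  have "(\<Sum>d\<in>B \<union> (*) q ` B. d) + (\<Sum>d\<in>B \<inter> (*) q ` B. d) = (\<Sum>d\<in>B. d) + (\<Sum>d\<in>(*) q ` B. d)"
    using fin by (intro sum.union_inter) auto
  also have "(\<Sum>d\<in>(*) q ` B. d) = q * (\<Sum>d\<in>B. d)"
    by (simp add: sum.reindex[OF inj] sum_distrib_left)
  finally show ?thesis unfolding U I[symmetric] by (simp add: B_def)
qed

context eigenform2
begin

text \<open>Eisenstein-like eigenvalues \<open>q + 1\<close> at all good primes would force \<open>a n = \<sigma>(n)\<close> for \<open>n\<close> prime to
  the level, contradicting the bound \<open>O(n)\<close>. This replaces the Manin--Drinfeld theorem.\<close>

lemma exists_non_Eisenstein_prime: "\<exists>q. prime q \<and> \<not> q dvd N \<and> a q \<noteq> of_nat q + 1"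
proof (rule ccontr)
  assume "\<not> ?thesis"
  then have eis: "a q = of_nat q + 1" if "prime q" "\<not> q dvd N" for q using that by blast
  \<comment> \<open>Strong induction: under the assumption the coefficients and the divisor sums
    obey the same Hecke recursion.\<close>
  have A_sigma: "A n = of_nat (\<Sum>d | d dvd n. d)" if "n > 0" "coprime n N" for n
    using that
  proof (induction n rule: less_induct)
    case (less n)
    show ?case
    proof (cases "n = 1")
      case True
      then show ?thesis using a_1 by (simp add: A_def)
    next
      case False
      then obtain q where q: "prime q" "q dvd n" using prime_factor_nat by blast
      then obtain k where k: "n = q * k" by blast
      have q1: "q > 1" using q(1) prime_gt_1_nat by blast
      have k0: "k > 0" using less.prems k by auto
      have cop: "coprime q N" "coprime k N" using less.prems k by auto
      have qN: "\<not> q dvd N" using cop(1) q1 by (metis coprime_absorb_left nat_neq_iff nat_dvd_1_iff_1)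
      have "k < n" using q1 k0 k by simp
      then have Ak: "A k = of_nat (\<Sum>d | d dvd k. d)" using less.IH k0 cop by blast
      have Akq: "A (k div q) = of_nat (\<Sum>d | d dvd k div q. d)" if "q dvd k"
      proof -
        obtain j where j: "k = q * j" using \<open>q dvd k\<close> by blast
        then have "j > 0" "coprime j N" "j < n" using k0 cop(2) q1 \<open>k < n\<close>
          by (auto intro: le_less_trans[of j "q * j"])
        then show ?thesis using less.IH[of j] q1 by (simp add: j)
      qed
      have "A (q * k) + of_nat q * (if q dvd k then A (k div q) else 0) = (of_nat q + 1) * A k"
        using hecke_eigenvalue(2)[OF q(1) qN, of \<i> k] eis[OF q(1) qN] by simp
      also have "\<dots> = of_nat ((q + 1) * (\<Sum>d | d dvd k. d))" by (simp add: Ak distrib_right)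
      also have "\<dots> = of_nat ((\<Sum>d | d dvd q * k. d) + q * (if q dvd k then \<Sum>d | d dvd k div q. d else 0))"
        by (simp only: divisor_sum_prime_mult[OF q(1) k0])
      also have "\<dots> = of_nat (\<Sum>d | d dvd q * k. d) + of_nat q * (if q dvd k then A (k div q) else 0)"
        using Akq by simp
      finally show ?thesis by (simp add: k)
    qed
  qed
  obtain C where C: "C > 0" "\<And>n. n \<ge> 1 \<Longrightarrow> norm (a n) \<le> C * real n" using a_bound by blast
  have harm_le: "harm M \<le> C * (real N + 1)" for M
  proof -
    \<comment> \<open>This n is prime to N and has the divisors n/(j N + 1) for j <= M, so
      sigma(n)/n is at least the sum of 1/(j N + 1), which is comparable to a harmonic sum.\<close>
    define n where "n = (\<Prod>j\<in>{1..M}. j * N + 1)"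
    have n0: "n > 0" by (simp add: n_def)
    have "coprime (j * N + 1) N" for j
      by (metis add.commute coprime_1_left coprime_iff_gcd_eq_1 gcd_add_mult mult.commute gcd.commute)
    then have cop: "coprime n N" unfolding n_def by (intro prod_coprime_left) auto
    have dvd: "(j * N + 1) dvd n" if "j \<in> {1..M}" for j unfolding n_def using that by (intro dvd_prodI) auto
    have div: "real (n div (j * N + 1)) = real n / real (j * N + 1)" if "j \<in> {1..M}" for j
      using dvd[OF that] by (rule real_of_nat_div)
    have inj: "inj_on (\<lambda>j. n div (j * N + 1)) {1..M}"
    proof (rule inj_onI)
      fix i j assume ij: "i \<in> {1..M}" "j \<in> {1..M}" "n div (i * N + 1) = n div (j * N + 1)"
      then have "real n / real (i * N + 1) = real n / real (j * N + 1)" using div by metis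
      then have "real (i * N + 1) = real (j * N + 1)" using n0 by (simp add: frac_eq_eq)
      then show "i = j" using N_pos by simp
    qed
    have "real n * (\<Sum>j\<in>{1..M}. 1 / real (j * N + 1)) = (\<Sum>j\<in>{1..M}. real (n div (j * N + 1)))"
      unfolding sum_distrib_left by (intro sum.cong refl) (simp only: div times_divide_eq_right mult_1_right)
    also have "\<dots> = real (\<Sum>j\<in>{1..M}. n div (j * N + 1))" by simp
    also have "(\<Sum>j\<in>{1..M}. n div (j * N + 1)) = (\<Sum>d\<in>(\<lambda>j. n div (j * N + 1)) ` {1..M}. d)"
      by (subst sum.reindex[OF inj]) (simp add: o_def)
    also have "\<dots> \<le> (\<Sum>d | d dvd n. d)"
      using n0 dvd by (intro sum_mono2) (auto intro: div_dvd_iff_mult[THEN iffD2])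
    finally have "real n * (\<Sum>j\<in>{1..M}. 1 / real (j * N + 1)) \<le> real (\<Sum>d | d dvd n. d)" by simp
    also have "\<dots> = norm (A n)" unfolding A_sigma[OF n0 cop] by (simp only: norm_of_nat)
    also have "\<dots> \<le> C * real n" using C(2)[of n] n0 by (simp add: A_def)
    finally have "(\<Sum>j\<in>{1..M}. 1 / real (j * N + 1)) \<le> C" using n0 by (simp add: mult.commute)
    have "harm M = (\<Sum>j\<in>{1..M}. 1 / real j)" by (simp add: harm_def divide_inverse)
    also have "\<dots> \<le> (\<Sum>j\<in>{1..M}. (real N + 1) * (1 / real (j * N + 1)))"
    proof (intro sum_mono)
      fix j assume "j \<in> {1..M}"
      then have j: "real j \<ge> 1" by simp
      have "real (j * N + 1) \<le> (real N + 1) * real j" using j by (simp add: algebra_simps)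
      then show "1 / real j \<le> (real N + 1) * (1 / real (j * N + 1))"
        using j by (simp add: divide_simps del: of_nat_mult of_nat_add)
    qed
    also have "\<dots> = (real N + 1) * (\<Sum>j\<in>{1..M}. 1 / real (j * N + 1))" by (simp only: sum_distrib_left)
    also have "\<dots> \<le> (real N + 1) * C"
      using \<open>(\<Sum>j\<in>{1..M}. 1 / real (j * N + 1)) \<le> C\<close> by (intro mult_left_mono) auto
    finally show ?thesis by (simp add: mult.commute)
  qed
  define K where "K = C * (real N + 1)"
  define M where "M = nat \<lceil>exp (K + 1)\<rceil>"
  have "exp (K + 1) \<le> real M + 1" unfolding M_def by linarith
  then have "K + 1 \<le> ln (real M + 1)" by (simp add: ln_ge_iff)
  also have "\<dots> \<le> harm M" by (rule ln_le_harm)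
  also have "\<dots> \<le> K" unfolding K_def by (rule harm_le)
  finally show False by simp
qed

end

section \<open>Boundary values modulo a rectangular period lattice\<close>

locale eigen_rect = eigenform2 +
  fixes \<Omega>p \<Omega>m :: real
  assumes \<Omega>p: "\<Omega>p > 0" and \<Omega>m: "\<Omega>m > 0"
    and rect: "period_lattice N f = rectangular_lattice \<Omega>p \<Omega>m"
begin

lemma Gc_lattice:
  assumes "coprime k (int M)" "coprime M N" "M \<noteq> 0"
  shows "\<exists>n l::int. Re (Gc (of_int k / real M)) = Re (Gc 0) + of_int n * \<Omega>p \<and>
    Im (Gc (of_int k / real M)) = Im (Gc 0) + of_int l * \<Omega>m"
proof -
  have "Gc (of_int k / real M) - Gc 0 \<in> rectangular_lattice \<Omega>p \<Omega>m"
    using Gc_diff_mem_lattice[OF assms] rect by simp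
  then obtain n l :: int where "Gc (of_int k / real M) - Gc 0 = of_int n * of_real \<Omega>p + of_int l * (\<i> * of_real \<Omega>m)"
    unfolding rectangular_lattice_def by blast
  then have "Gc (of_int k / real M) = Gc 0 + (of_int n * of_real \<Omega>p + of_int l * (\<i> * of_real \<Omega>m))"
    by (simp add: algebra_simps)
  then show ?thesis by (intro exI[of _ n] exI[of _ l]) simp
qed

lemma Im_Gc_0 [simp]: "Im (Gc 0) = 0"
  using Gc_uminus[of 0] by (simp add: complex_eq_iff)

text \<open>This is L(f,1)/Omega^+, since \<open>twisted_L_value\<close> for the trivial character
  gives L(f,1) = G(0).\<close>

definition L where "L = Re (Gc 0) / \<Omega>p"

lemma Re_Gc_0: "Re (Gc 0) = L * \<Omega>p"
  using \<Omega>p by (simp add: L_def)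

text \<open>The floor only makes the function total: by \<open>Gc_lattice\<close> its argument is an
  integer when M is prime to k and N. The same holds for \<open>eta\<close>.\<close>

definition xi :: "nat \<Rightarrow> int \<Rightarrow> int" where
  "xi M k = \<lfloor>(Re (Gc (of_int k / real M)) - Re (Gc 0)) / \<Omega>p\<rfloor>"

definition eta :: "nat \<Rightarrow> int \<Rightarrow> int" where
  "eta M k = \<lfloor>Im (Gc (of_int k / real M)) / \<Omega>m\<rfloor>"

lemma Gc_xi_eta:
  assumes "coprime k (int M)" "coprime M N" "M \<noteq> 0"
  shows "Re (Gc (of_int k / real M)) = (L + of_int (xi M k)) * \<Omega>p"
    and "Im (Gc (of_int k / real M)) = of_int (eta M k) * \<Omega>m"
proof -
  obtain n l :: int where nl: "Re (Gc (of_int k / real M)) = Re (Gc 0) + of_int n * \<Omega>p"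
    "Im (Gc (of_int k / real M)) = of_int l * \<Omega>m" using Gc_lattice[OF assms] by auto
  have "xi M k = n" "eta M k = l" using \<Omega>p \<Omega>m by (simp_all add: xi_def eta_def nl)
  then show "Re (Gc (of_int k / real M)) = (L + of_int (xi M k)) * \<Omega>p"
    "Im (Gc (of_int k / real M)) = of_int (eta M k) * \<Omega>m"
    by (simp_all add: nl Re_Gc_0 distrib_right)
qed

lemma Re_a_rat: "n \<ge> 1 \<Longrightarrow> Re (a n) \<in> \<rat> \<and> a n = of_real (Re (a n))"
proof -
  assume "n \<ge> 1"
  then obtain r where r: "a n = of_rat r" using a_rat by (auto elim: Rats_cases)
  obtain p q where "r = Fract p q" "q > 0" "coprime p q" by (rule Rat_cases)
  then have e: "a n = of_real (of_int p / of_int q)" by (simp add: r of_rat_rat)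
  then have "Re (a n) = of_int p / of_int q" by (simp only: Re_complex_of_real)
  then show ?thesis using e by simp
qed

text \<open>In the Hecke relation at x = 0 the q - 1 terms with b > 0 differ from G(0) by lattice
  points, so (a_q - q - 1) L is an integer. It remains to choose q with a_q different from q +
  1.\<close>

lemma L_rational: "L \<in> \<rat>"
proof -
  obtain q where q: "prime q" "\<not> q dvd N" "a q \<noteq> of_nat q + 1" using exists_non_Eisenstein_prime by blast
  have q1: "q \<ge> 1" "q > 0" using q prime_gt_0_nat[of q] by auto
  define \<alpha> where "\<alpha> = Re (a q)"
  have \<alpha>: "\<alpha> \<in> \<rat>" "a q = of_real \<alpha>" using Re_a_rat[OF q1(1)] by (auto simp: \<alpha>_def)
  have copN: "coprime q N" using q by (simp add: prime_imp_coprime)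
  have "Re (Gc (real b / real q)) = (L + of_int (xi q (int b))) * \<Omega>p" if "b \<in> {1..<q}" for b
  proof -
    have "\<not> q dvd b" using that by (auto dest: dvd_imp_le)
    then have "coprime b q" using q(1) by (metis coprime_commute prime_imp_coprime)
    then have "coprime (int b) (int q)" by simp
    from Gc_xi_eta(1)[OF this copN] q1 show ?thesis by simp
  qed
  then have "(\<Sum>b\<in>{1..<q}. Re (Gc (real b / real q))) = (\<Sum>b\<in>{1..<q}. (L + of_int (xi q (int b))) * \<Omega>p)"
    by (intro sum.cong) auto
  also have "\<dots> = (of_nat (q - 1) * L + of_int (\<Sum>b\<in>{1..<q}. xi q (int b))) * \<Omega>p"
    by (simp add: sum.distrib flip: sum_distrib_right)
  finally have s: "(\<Sum>b\<in>{1..<q}. Re (Gc (real b / real q))) =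
      (of_nat (q - 1) * L + of_int (\<Sum>b\<in>{1..<q}. xi q (int b))) * \<Omega>p" .
  have "{..<q} = insert 0 {1..<q}" using q1 by auto
  then have "(\<Sum>b<q. Re (Gc (real b / real q))) = L * \<Omega>p + (\<Sum>b\<in>{1..<q}. Re (Gc (real b / real q)))"
    by (simp add: Re_Gc_0)
  moreover have "(\<Sum>b<q. Re (Gc (real b / real q))) + L * \<Omega>p = \<alpha> * (L * \<Omega>p)"
    using arg_cong[OF Gc_hecke[OF q(1,2), of 0], of Re] by (simp add: \<alpha>(2) Re_Gc_0)
  ultimately have "L * \<Omega>p + (of_nat (q - 1) * L + of_int (\<Sum>b\<in>{1..<q}. xi q (int b))) * \<Omega>p + L * \<Omega>p = \<alpha> * L * \<Omega>p"
    using s by simp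
  then have "(L + (of_nat (q - 1) * L + of_int (\<Sum>b\<in>{1..<q}. xi q (int b))) + L) * \<Omega>p = (\<alpha> * L) * \<Omega>p"
    by (simp add: algebra_simps)
  then have "L + (of_nat (q - 1) * L + of_int (\<Sum>b\<in>{1..<q}. xi q (int b))) + L = \<alpha> * L" using \<Omega>p by simp
  moreover have "real (q - 1) = real q - 1" using q1 by simp
  ultimately have "(\<alpha> - (real q + 1)) * L = of_int (\<Sum>b\<in>{1..<q}. xi q (int b))" by (simp add: algebra_simps)
  moreover have "\<alpha> - (real q + 1) \<noteq> 0"
  proof
    assume "\<alpha> - (real q + 1) = 0"
    then have "\<alpha> = real q + 1" by simp
    then show False using q(3) \<alpha>(2) by simp
  qed
  ultimately have "L = of_int (\<Sum>b\<in>{1..<q}. xi q (int b)) / (\<alpha> - (real q + 1))" by (simp add: field_simps)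
  moreover have "of_int (\<Sum>b\<in>{1..<q}. xi q (int b)) / (\<alpha> - (real q + 1)) \<in> \<rat>"
    using \<alpha>(1) by (intro Rats_divide Rats_diff Rats_add) auto
  ultimately show ?thesis by simp
qed

definition even_set :: "nat set \<Rightarrow> bool" where
  "even_set D \<longleftrightarrow> chi D (- 1) = 1"

text \<open>The part that is dropped vanishes by \<open>T_parts\<close>, and the period is the one
  whose sign matches the character.\<close>

definition t :: "nat set \<Rightarrow> real" where
  "t D = (if even_set D then Re (T D) / \<Omega>p else Im (T D) / \<Omega>m)"

definition \<gamma> :: "nat set \<Rightarrow> nat \<Rightarrow> real" where
  "\<gamma> D q = Re (a q) - 2 * of_int (chi D (int q))"

lemma even_set_empty [simp]: "even_set {}"
  by (simp add: even_set_def chi_def)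

lemma t_empty: "t {} = L"
  by (simp add: t_def T_empty L_def)

end

section \<open>The recursion for normalized twisted values\<close>

locale eigen_rect_primes = eigen_rect + odd_primes +
  assumes Q_N: "\<And>q. q \<in> Q \<Longrightarrow> \<not> q dvd N"
begin

lemma coprime_prod_N: "D \<subseteq> Q \<Longrightarrow> coprime (\<Prod>D) N"
  using prime_Q Q_N by (intro prod_coprime_left) (metis prime_imp_coprime subsetD)

lemma T_parts:
  assumes "D \<subseteq> Q"
  shows "even_set D \<Longrightarrow> Im (T D) = 0" and "\<not> even_set D \<Longrightarrow> Re (T D) = 0"
proof -
  interpret D: odd_primes D by (rule odd_primes_subset[OF assms])
  have c: "cnj (T D) = of_int (chi D (- 1)) * T D" by (rule T_cnj) unfold_locales
  show "even_set D \<Longrightarrow> Im (T D) = 0" using c by (simp add: even_set_def complex_eq_iff)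
  show "\<not> even_set D \<Longrightarrow> Re (T D) = 0"
    using c D.chi_minus1 by (auto simp: even_set_def complex_eq_iff)
qed

text \<open>For nonempty \<open>D\<close> the value is even an integer: in the real part L is
  multiplied by a character sum that is 0, and the imaginary part does not contain L.\<close>

lemma t_rat:
  assumes D: "D \<subseteq> Q"
  shows "t D \<in> \<rat>"
proof (cases "D = {}")
  case True
  then show ?thesis using t_empty L_rational by simp
next
  case False
  interpret D: odd_primes D by (rule odd_primes_subset[OF D])
  have copN: "coprime D.m N" using coprime_prod_N[OF D] by (simp add: D.m_def)
  have m0: "D.m \<noteq> 0" using D.m_pos by simp
  have T: "T D = (\<Sum>k\<in>{0..<int D.m}. of_int (chi D k) * Gc (of_int k / real D.m))"
    by (simp add: T_def D.m_def)
  show ?thesis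
  proof (cases "even_set D")
    case True
    have "Re (T D) = (\<Sum>k\<in>{0..<int D.m}. of_int (chi D k) * ((L + of_int (xi D.m k)) * \<Omega>p))"
      unfolding T Re_sum
    proof (intro sum.cong refl)
      fix k
      show "Re (of_int (chi D k) * Gc (of_int k / real D.m)) = of_int (chi D k) * ((L + of_int (xi D.m k)) * \<Omega>p)"
        using Gc_xi_eta(1)[OF _ copN m0, of k] D.chi_nz_iff[of k] by (cases "coprime k (int D.m)") auto
    qed
    also have "\<dots> = (of_int (\<Sum>k\<in>{0..<int D.m}. chi D k) * L + of_int (\<Sum>k\<in>{0..<int D.m}. chi D k * xi D.m k)) * \<Omega>p"
      by (simp add: sum.distrib algebra_simps sum_distrib_left sum_distrib_right)
    also have "(\<Sum>k\<in>{0..<int D.m}. chi D k) = 0" by (rule D.sum_chi_0[OF False])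
    finally have "t D = of_int (\<Sum>k\<in>{0..<int D.m}. chi D k * xi D.m k)"
      using True \<Omega>p by (simp add: t_def)
    then show ?thesis by (simp only: Rats_of_int)
  next
    case False
    have "Im (T D) = (\<Sum>k\<in>{0..<int D.m}. of_int (chi D k) * (of_int (eta D.m k) * \<Omega>m))"
      unfolding T Im_sum
    proof (intro sum.cong refl)
      fix k
      show "Im (of_int (chi D k) * Gc (of_int k / real D.m)) = of_int (chi D k) * (of_int (eta D.m k) * \<Omega>m)"
        using Gc_xi_eta(2)[OF _ copN m0, of k] D.chi_nz_iff[of k] by (cases "coprime k (int D.m)") auto
    qed
    also have "\<dots> = of_int (\<Sum>k\<in>{0..<int D.m}. chi D k * eta D.m k) * \<Omega>m"
      by (simp add: sum_distrib_right mult.assoc)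
    finally have "t D = of_int (\<Sum>k\<in>{0..<int D.m}. chi D k * eta D.m k)"
      using False \<Omega>m by (simp add: t_def)
    then show ?thesis by (simp only: Rats_of_int)
  qed
qed

lemma q_ge1: "q \<in> Q \<Longrightarrow> q \<ge> 1"
  using prime_Q prime_ge_1_nat by blast

lemma \<gamma>_rat: "q \<in> Q \<Longrightarrow> \<gamma> D q \<in> \<rat>"
  unfolding \<gamma>_def using Re_a_rat[OF q_ge1] by (intro Rats_diff Rats_mult) auto

text \<open>The real or imaginary part of \<open>sum_twists_eq_sum_squares\<close>, according to the
  parity of \<open>D\<close>. Subsets of opposite parity drop out because their \<open>T E\<close>
  lies on the other axis.\<close>

lemma real_identity:
  assumes D: "D \<subseteq> Q"
  shows "(\<Sum>E | E \<subseteq> D \<and> even_set E = even_set D. (\<Prod>q\<in>D - E. \<gamma> E q) * t E) =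
    2 ^ card D * (if even_set D then of_nat (card (squares_mod D)) * L + of_int (\<Sum>k\<in>squares_mod D. xi (\<Prod>D) k)
      else of_int (\<Sum>k\<in>squares_mod D. eta (\<Prod>D) k))"
proof -
  interpret D: odd_primes D by (rule odd_primes_subset[OF D])
  have finP: "finite (Pow D)" using D.finite_Q by simp
  have copN: "coprime D.m N" using coprime_prod_N[OF D] by (simp add: D.m_def)
  have m0: "D.m \<noteq> 0" using D.m_pos by simp
  have sq_cop: "coprime k (int D.m)" if k: "k \<in> squares_mod D" for k
    unfolding D.coprime_m_iff
  proof
    fix q assume "q \<in> D"
    then have "Legendre k (int q) = 1" using k by (simp add: squares_mod_def)
    then show "\<not> int q dvd k" using Legendre_eq_0_iff[of k "int q"] by simp
  qed
  have prod: "(\<Prod>q\<in>D - E. a q - 2 * of_int (chi E (int q))) = of_real (\<Prod>q\<in>D - E. \<gamma> E q)" for E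
    unfolding of_real_prod
  proof (intro prod.cong refl)
    fix q assume "q \<in> D - E"
    then have "a q = of_real (Re (a q))" using Re_a_rat[OF q_ge1] D by auto
    then show "a q - 2 * of_int (chi E (int q)) = of_real (\<gamma> E q)" by (simp add: \<gamma>_def)
  qed
  have main: "(\<Sum>E\<in>Pow D. of_real (\<Prod>q\<in>D - E. \<gamma> E q) * T E) =
    2 ^ card D * (\<Sum>k\<in>squares_mod D. Gc (of_int k / real D.m))"
    using sum_twists_eq_sum_squares[of D] D Q_N odd_primes_subset[OF D] unfolding prod by (auto simp: D.m_def)
  have pow: "Re (2 ^ n * z) = 2 ^ n * Re z" "Im (2 ^ n * z) = 2 ^ n * Im z" for n z
  proof -
    have "2 ^ n * z = of_real (2 ^ n) * z" by simp
    then show "Re (2 ^ n * z) = 2 ^ n * Re z" "Im (2 ^ n * z) = 2 ^ n * Im z"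
      by (simp_all only: Re_complex_of_real Im_complex_of_real times_complex.simps)
  qed
  show ?thesis
  proof (cases "even_set D")
    case True
    have "(\<Sum>E | E \<subseteq> D \<and> even_set E = even_set D. (\<Prod>q\<in>D - E. \<gamma> E q) * t E) * \<Omega>p =
        (\<Sum>E\<in>Pow D. Re (of_real (\<Prod>q\<in>D - E. \<gamma> E q) * T E))"
      unfolding sum_distrib_right
    proof (rule sum.mono_neutral_cong_left[OF finP])
      show "\<forall>E\<in>Pow D - {E. E \<subseteq> D \<and> even_set E = even_set D}. Re (of_real (\<Prod>q\<in>D - E. \<gamma> E q) * T E) = 0"
        using True T_parts(2) D by (auto simp del: of_real_prod)
    qed (use True \<Omega>p in \<open>auto simp: t_def simp del: of_real_prod\<close>)
    also have "\<dots> = Re (2 ^ card D * (\<Sum>k\<in>squares_mod D. Gc (of_int k / real D.m)))"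
      by (simp only: main[symmetric] Re_sum)
    also have "\<dots> = 2 ^ card D * (\<Sum>k\<in>squares_mod D. (L + of_int (xi D.m k)) * \<Omega>p)"
      unfolding pow Re_sum using Gc_xi_eta(1)[OF sq_cop copN m0] by (simp cong: sum.cong)
    also have "\<dots> = (2 ^ card D * (of_nat (card (squares_mod D)) * L + of_int (\<Sum>k\<in>squares_mod D. xi D.m k))) * \<Omega>p"
      by (simp add: sum.distrib flip: sum_distrib_right)
    finally show ?thesis using \<Omega>p True by (simp add: D.m_def)
  next
    case False
    have "(\<Sum>E | E \<subseteq> D \<and> even_set E = even_set D. (\<Prod>q\<in>D - E. \<gamma> E q) * t E) * \<Omega>m =
        (\<Sum>E\<in>Pow D. Im (of_real (\<Prod>q\<in>D - E. \<gamma> E q) * T E))"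
      unfolding sum_distrib_right
    proof (rule sum.mono_neutral_cong_left[OF finP])
      show "\<forall>E\<in>Pow D - {E. E \<subseteq> D \<and> even_set E = even_set D}. Im (of_real (\<Prod>q\<in>D - E. \<gamma> E q) * T E) = 0"
        using False T_parts(1) D by (auto simp del: of_real_prod)
    qed (use False \<Omega>m in \<open>auto simp: t_def simp del: of_real_prod\<close>)
    also have "\<dots> = Im (2 ^ card D * (\<Sum>k\<in>squares_mod D. Gc (of_int k / real D.m)))"
      by (simp only: main[symmetric] Im_sum)
    also have "\<dots> = 2 ^ card D * (\<Sum>k\<in>squares_mod D. of_int (eta D.m k) * \<Omega>m)"
      unfolding pow Im_sum using Gc_xi_eta(2)[OF sq_cop copN m0] by (simp cong: sum.cong)
    also have "\<dots> = (2 ^ card D * of_int (\<Sum>k\<in>squares_mod D. eta D.m k)) * \<Omega>m"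
      by (simp flip: sum_distrib_right)
    finally show ?thesis using \<Omega>m False by (simp add: D.m_def)
  qed
qed

text \<open>Isolates the term E = D of \<open>real_identity\<close>, whose coefficient is an empty
  product.\<close>

lemma recursion_step:
  assumes D: "D \<subseteq> Q" "D \<noteq> {}"
    and e: "e = 0 \<or> e = 1 \<and> (\<forall>q\<in>Q. Legendre (- 1) (int q) = 1)"
  shows "\<exists>h::nat. \<exists>n::int. t D = 2 ^ (card D + e) * (real h * L + of_int n) -
    (\<Sum>E | E \<subset> D \<and> even_set E = even_set D. (\<Prod>q\<in>D - E. \<gamma> E q) * t E)"
proof -
  interpret D: odd_primes D by (rule odd_primes_subset[OF D(1)])
  define R where "R = (if even_set D then of_nat (card (squares_mod D)) * L + of_int (\<Sum>k\<in>squares_mod D. xi (\<Prod>D) k)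
      else of_int (\<Sum>k\<in>squares_mod D. eta (\<Prod>D) k))"
  have fin: "finite {E. E \<subset> D \<and> even_set E = even_set D}"
    by (rule finite_subset[of _ "Pow D"]) (use D.finite_Q in auto)
  have "{E. E \<subseteq> D \<and> even_set E = even_set D} = insert D {E. E \<subset> D \<and> even_set E = even_set D}" by auto
  then have "(\<Sum>E | E \<subseteq> D \<and> even_set E = even_set D. (\<Prod>q\<in>D - E. \<gamma> E q) * t E) =
      t D + (\<Sum>E | E \<subset> D \<and> even_set E = even_set D. (\<Prod>q\<in>D - E. \<gamma> E q) * t E)"
    using fin by simp
  then have t: "t D = 2 ^ card D * R - (\<Sum>E | E \<subset> D \<and> even_set E = even_set D. (\<Prod>q\<in>D - E. \<gamma> E q) * t E)"
    using real_identity[OF D(1)] by (simp add: R_def)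
  have "\<exists>h::nat. \<exists>n::int. R = 2 ^ e * (real h * L + of_int n)"
    using e
  proof
    assume e: "e = 0"
    show ?thesis
    proof (cases "even_set D")
      case True
      then show ?thesis using e by (auto simp: R_def simp del: of_int_sum)
    next
      case False
      then have "R = 2 ^ e * (real 0 * L + of_int (\<Sum>k\<in>squares_mod D. eta (\<Prod>D) k))"
        using e by (simp add: R_def)
      then show ?thesis by blast
    qed
  next
    assume e: "e = 1 \<and> (\<forall>q\<in>Q. Legendre (- 1) (int q) = 1)"
    then have neg: "Legendre (- 1) (int q) = 1" if "q \<in> D" for q using D(1) that by auto
    then have ev: "even_set D" by (simp add: even_set_def chi_def)
    have half: "(\<Sum>k\<in>squares_mod D. F k) = 2 * (\<Sum>k | k \<in> squares_mod D \<and> 2 * k < int D.m. F k)"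
      if "\<And>k. k \<in> squares_mod D \<Longrightarrow> F (int D.m - k) = F k" for F :: "int \<Rightarrow> int"
      by (rule D.sum_squares_mod_eq_twice_half[of F, OF D(2) neg that])
    \<comment> \<open>G(-x) is the conjugate of G(x), so the real parts at k and m - k agree and the
      sum is twice its lower half.\<close>
    have "xi D.m (int D.m - k) = xi D.m k" for k
    proof -
      have "Gc (of_int (int D.m - k) / real D.m) = Gc (- (of_int k / real D.m))"
        using Gc_cong[of "int D.m - k" "- k" D.m] D.m_pos by (simp add: cong_iff_dvd_diff)
      then have "Re (Gc (of_int (int D.m - k) / real D.m)) = Re (Gc (of_int k / real D.m))"
        using Gc_uminus[of "of_int k / real D.m"] by simp
      then show ?thesis by (simp add: xi_def)
    qed
    then have "(\<Sum>k\<in>squares_mod D. xi D.m k) = 2 * (\<Sum>k | k \<in> squares_mod D \<and> 2 * k < int D.m. xi D.m k)"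
      by (intro half)
    moreover have "int (card (squares_mod D)) = 2 * int (card {k. k \<in> squares_mod D \<and> 2 * k < int D.m})"
      using half[of "\<lambda>_. 1"] by simp
    then have "real (card (squares_mod D)) = 2 * real (card {k. k \<in> squares_mod D \<and> 2 * k < int D.m})"
      by linarith
    ultimately have "R = 2 ^ e * (real (card {k. k \<in> squares_mod D \<and> 2 * k < int D.m}) * L +
        of_int (\<Sum>k | k \<in> squares_mod D \<and> 2 * k < int D.m. xi D.m k))"
      using ev e by (simp add: R_def D.m_def[symmetric] distrib_left del: of_int_sum)
    then show ?thesis by blast
  qed
  then obtain h n where "R = 2 ^ e * (real h * L + of_int n)" by blast
  then have "t D = 2 ^ (card D + e) * (real h * L + of_int n) -
    (\<Sum>E | E \<subset> D \<and> even_set E = even_set D. (\<Prod>q\<in>D - E. \<gamma> E q) * t E)"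
    unfolding t by (simp add: power_add mult.assoc)
  then show ?thesis by blast
qed

sublocale eigen_twist N f a Q
  by unfold_locales

text \<open>u is 1/tau for an even and i/tau for an odd character; the i accounts for
  \<open>T Q\<close> being purely imaginary. As only u^2 m = 1 is recorded, the sign of the Gauss
  sum need not be determined.\<close>

lemma L_ratio_eq:
  obtains u where "L_ratio a \<Omega>p \<Omega>m m = of_real (t Q) * u" "u * u * of_nat m = 1"
proof -
  have tw: "twisted_L a (quad_char m) 1 = T Q / \<tau>"
    unfolding twisted_L_value by (simp add: T_def m_def)
  show thesis
  proof (cases "even_set Q")
    case True
    then have T: "T Q = of_real (t Q) * of_real \<Omega>p"
      using T_parts(1)[of Q] \<Omega>p by (simp add: t_def complex_eq_iff)
    show thesis
    proof (rule that[of "1 / \<tau>"])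
      show "L_ratio a \<Omega>p \<Omega>m m = of_real (t Q) * (1 / \<tau>)"
        using True \<Omega>p by (simp add: L_ratio_def tw T period_of_sign_def quad_char_m even_set_def)
      show "1 / \<tau> * (1 / \<tau>) * of_nat m = 1"
        using tau_sq tau_nz m_pos True by (simp add: even_set_def field_simps)
    qed
  next
    case False
    then have T: "T Q = of_real (t Q) * (\<i> * of_real \<Omega>m)"
      using T_parts(2)[of Q] \<Omega>m by (simp add: t_def complex_eq_iff)
    have chi: "chi Q (- 1) = - 1" using False chi_minus1 by (simp add: even_set_def)
    show thesis
    proof (rule that[of "\<i> / \<tau>"])
      show "L_ratio a \<Omega>p \<Omega>m m = of_real (t Q) * (\<i> / \<tau>)"
        using \<Omega>m by (simp add: L_ratio_def tw T period_of_sign_def quad_char_m chi)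
      have "\<tau> * \<tau> = - of_nat m" using tau_sq chi by (metis minus_minus mult_minus1 of_int_1 of_int_minus)
      then have "of_nat m = - (\<tau> * \<tau>)" by simp
      then show "\<i> / \<tau> * (\<i> / \<tau>) * of_nat m = 1"
        using tau_nz by (simp add: field_simps)
    qed
  qed
qed

text \<open>The factor u is a square root of 1/m with m odd, so it is algebraic of valuation
  0.\<close>

lemma v_L_ratio:
  assumes "valuation2 v"
  shows "v (L_ratio a \<Omega>p \<Omega>m m) = valuation2.V v (t Q)"
proof -
  interpret valuation2 v by fact
  obtain u where u: "L_ratio a \<Omega>p \<Omega>m m = of_real (t Q) * u" "u * u * of_nat m = 1"
    by (rule L_ratio_eq)
  have m0: "of_nat m \<noteq> (0::complex)" using m_pos by simp
  have alg_u: "algebraic u"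
    using u(2) m0 by (intro algebraicI[of "[:- 1, 0, of_nat m:]"])
      (auto simp: coeff_pCons algebra_simps split: nat.splits)
  have uu: "u * u = of_real (1 / real m)" using u(2) m0 by (simp add: field_simps)
  have Vm: "V (real m) = 0" using V_odd[of "int m"] odd_m by simp
  have "V (1 / real m * real m) = V (1 / real m) + V (real m)" by (rule V_mult) auto
  then have "V (1 / real m) = 0" using Vm m_pos by simp
  then have "v u + v u = 0"
    using val alg_u uu unfolding two_adic_valuation_def V_def by metis
  then have "v u = 0" by (cases "v u") (auto simp: zero_ereal_def)
  moreover have "v (of_real (t Q) * u) = v (of_real (t Q)) + v u"
    using val alg_u algebraic_of_rat_real[OF t_rat[of Q]] unfolding two_adic_valuation_def by blast
  ultimately show ?thesis by (simp add: u(1) V_def)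
qed

end

section \<open>The divisibility theorem\<close>


text \<open>If L(f,1) = 0 then \<open>V L\<close> is infinite, while the inductions work with real
  bounds. Truncation by a cap c produces a real one.\<close>

lemma min_ereal_finite:
  assumes "x \<noteq> - \<infinity>"
  obtains r where "min (ereal c) x = ereal r"
proof (cases x)
  case (real r)
  then show ?thesis by (intro that[of "min c r"]) simp
next
  case PInf
  then show ?thesis by (intro that[of c]) simp
qed (use assms in simp)

lemma (in eigen_rect) v_L_ratio_1:
  assumes "valuation2 v"
  shows "v (L_ratio a \<Omega>p \<Omega>m 1) = valuation2.V v L"
proof -
  interpret E: eigen_rect_primes N f a \<Omega>p \<Omega>m "{}" by unfold_locales auto
  show ?thesis using E.v_L_ratio[OF assms] by (simp add: E.m_def t_empty)
qed

locale eigen_rect_val = eigen_rect_primes + valuation2 +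
  assumes Q_ne: "Q \<noteq> {}"
begin

sublocale twist_recursion v Q t \<gamma> L even_set
  by unfold_locales (use finite_Q t_rat t_empty \<gamma>_rat in auto)

lemma rec_0: "rec 0"
  unfolding rec_def cc_def proper_def by (intro allI impI recursion_step) auto

lemma rec_1: "(\<And>q. q \<in> Q \<Longrightarrow> Legendre (- 1) (int q) = 1) \<Longrightarrow> rec 1"
  unfolding rec_def cc_def proper_def by (intro allI impI recursion_step) auto

definition \<nu> :: "nat \<Rightarrow> ereal" where
  "\<nu> q = v (a q - 2)"

lemma \<nu>_eq: "q \<in> Q \<Longrightarrow> \<nu> q = V (Re (a q) - 2)"
proof -
  assume q: "q \<in> Q"
  then have "a q - 2 = of_real (Re (a q) - 2)" using Re_a_rat[OF q_ge1[OF q]] by simp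
  then show ?thesis by (simp only: \<nu>_def V_def)
qed

text \<open>chi_D(q) is a sign because q is not in \<open>D\<close>; the two cases are a_q - 2 and
  a_q + 2.\<close>

lemma \<gamma>_cases:
  assumes D: "D \<subseteq> Q" and q: "q \<in> Q - D"
  shows "\<gamma> D q = Re (a q) - 2 \<or> \<gamma> D q = (Re (a q) - 2) + 4"
proof -
  interpret D: odd_primes D by (rule odd_primes_subset[OF D])
  have "coprime (int q) (int D.m)"
    unfolding D.coprime_m_iff
  proof
    fix p assume p: "p \<in> D"
    have "\<not> p dvd q"
      using primes_dvd_imp_eq[of p q] prime_Q p q D by blast
    then show "\<not> int p dvd int q" by simp
  qed
  then have "chi D (int q) = 1 \<or> chi D (int q) = - 1" by (rule D.chi_pm1)
  then show ?thesis by (auto simp: \<gamma>_def)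
qed

lemma Re_a_2_rat: "q \<in> Q \<Longrightarrow> Re (a q) - 2 \<in> \<rat>"
  using Re_a_rat[OF q_ge1] by auto

lemma vge_4: "vge 4 2"
  using vge_2_power[of 2] by simp

text \<open>Adding 4 does not affect lower bounds up to 2.\<close>

lemma vge_\<gamma>:
  assumes D: "D \<subseteq> Q" and q: "q \<in> Q - D" and r: "ereal r \<le> \<nu> q" "r \<le> 2"
  shows "vge (\<gamma> D q) r"
proof -
  have 1: "vge (Re (a q) - 2) r" using r \<nu>_eq q by (simp add: vge_def)
  have "vge (Re (a q) - 2 + 4) r"
    by (rule vge_add[OF _ _ 1 vge_mono[OF vge_4 r(2)]]) (use Re_a_2_rat q in auto)
  with 1 show ?thesis using \<gamma>_cases[OF D q] by auto
qed

lemma V_\<gamma>: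
  assumes D: "D \<subseteq> Q" and q: "q \<in> Q - D" and r: "\<nu> q = ereal r" "r < 2"
  shows "V (\<gamma> D q) = ereal r"
proof -
  have 1: "V (Re (a q) - 2) = ereal r" using r \<nu>_eq q by simp
  have "V (Re (a q) - 2 + 4) = ereal r"
    by (rule V_add_eq[OF _ _ 1 vge_4 r(2)]) (use Re_a_2_rat q in auto)
  with 1 show ?thesis using \<gamma>_cases[OF D q] by auto
qed

lemma v_min_eq: "v_min v a m = Min (\<nu> ` Q)"
  by (simp add: v_min_def prime_factors_m \<nu>_def)

lemma V_L_not_MInf: "V L \<noteq> - \<infinity>"
  using V_MInf L_rational by blast

lemma S_setD: "q \<in> S_set v N a \<epsilon> i \<Longrightarrow> \<nu> q = ereal (of_int i)"
  by (simp add: S_set_def \<nu>_def)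

lemma S_plusD:
  assumes "q \<in> S_plus v N a i"
  shows "Legendre (- 1) (int q) = 1"
proof -
  have "prime q" "quad_char q (- 1) = 1" using assms by (auto simp: S_set_def)
  then show ?thesis by (simp add: quad_char_def prime_factorization_prime)
qed

lemma bounds:
  assumes \<nu>: "\<And>q. q \<in> Q \<Longrightarrow> \<nu> q = 0 \<or> \<nu> q = 1 \<or> \<nu> q = 2"
  shows "V (t Q) \<ge> w_ind v a m * ereal (real (card Q)) + min (kronecker (v_min v a m) 0) (V L)"
    and "(\<And>q. q \<in> Q \<Longrightarrow> Legendre (- 1) (int q) = 1) \<Longrightarrow>
      V (t Q) \<ge> w_ind v a m * ereal (real (card Q)) +
        min (1 + kronecker (v_min v a m) 0) (V L + kronecker (v_min v a m) 2)"
proof -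
  have fin: "finite (\<nu> ` Q)" "\<nu> ` Q \<noteq> {}" using finite_Q Q_ne by auto
  have mem: "Min (\<nu> ` Q) \<in> \<nu> ` Q" by (rule Min_in[OF fin])
  have le: "Min (\<nu> ` Q) \<le> \<nu> q" if "q \<in> Q" for q using fin that by simp
  have val01: "Min (\<nu> ` Q) = 0 \<or> Min (\<nu> ` Q) = 1 \<or> Min (\<nu> ` Q) = 2" 
    using mem \<nu> by (metis imageE)
  have \<gamma>0: "vge (\<gamma> D q) 0" if "D \<subseteq> Q" "q \<in> Q - D" for D q
    by (rule vge_\<gamma>[OF that]) (use \<nu>[of q] that in \<open>auto simp: zero_ereal_def[symmetric]\<close>)
  have \<gamma>1: "vge (\<gamma> D q) 1" if "Min (\<nu> ` Q) \<ge> 1" "D \<subseteq> Q" "q \<in> Q - D" for D q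
    by (rule vge_\<gamma>[OF that(2,3)]) (use le[of q] that in \<open>auto simp: one_ereal_def[symmetric] intro: order_trans\<close>)
  have \<gamma>2: "vge (\<gamma> {} q) 2" if "Min (\<nu> ` Q) = 2" "q \<in> Q" for q
    by (rule vge_\<gamma>) (use le[of q] that in auto)
  have VLge: "vge L r" if "min (ereal c) (V L) = ereal r" for c r
    using that unfolding vge_def by (metis min.cobounded2)
  have rle: "r \<le> c" if "min (ereal c) (V L) = ereal r" for c r
    using that by (metis ereal_less_eq(3) min.cobounded1)
  show "V (t Q) \<ge> w_ind v a m * ereal (real (card Q)) + min (kronecker (v_min v a m) 0) (V L)"
  proof (cases "Min (\<nu> ` Q) = 0")
    case True
    \<comment> \<open>Each cap in this proof is the largest mu that the lemma applied admits: e + 1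
      for \<open>bound_ge0\<close>, e for \<open>bound_ge1\<close> and 0 for
      \<open>bound_all_ge2\<close>.\<close>
    obtain r where r: "min (ereal 1) (V L) = ereal r" using min_ereal_finite V_L_not_MInf by blast
    have "vge (t Q) r"
      by (rule bound_ge0[OF rec_0 \<gamma>0 VLge[OF r]]) (use rle[OF r] in auto)
    then show ?thesis using True r by (simp add: v_min_eq w_ind_def kronecker_def vge_def one_ereal_def[symmetric])
  next
    case False
    then have ge1: "Min (\<nu> ` Q) \<ge> 1" using val01 by auto
    obtain r where r: "min (ereal 0) (V L) = ereal r" using min_ereal_finite V_L_not_MInf by blast
    have "vge (t Q) (real (card Q) + r)"
      by (rule bound_ge1[OF rec_0 \<gamma>1[OF ge1] VLge[OF r]]) (use rle[OF r] in auto)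
    moreover have "min 0 (V L) = ereal r" using r by (simp add: zero_ereal_def)
    ultimately show ?thesis using False ge1 by (simp add: v_min_eq w_ind_def kronecker_def vge_def)
  qed
  assume neg: "\<And>q. q \<in> Q \<Longrightarrow> Legendre (- 1) (int q) = 1"
  have rec: "rec 1" using neg by (rule rec_1)
  show "V (t Q) \<ge> w_ind v a m * ereal (real (card Q)) +
        min (1 + kronecker (v_min v a m) 0) (V L + kronecker (v_min v a m) 2)"
  proof (cases "Min (\<nu> ` Q) = 0")
    case True
    obtain r where r: "min (ereal 2) (V L) = ereal r" using min_ereal_finite V_L_not_MInf by blast
    have "vge (t Q) r"
      by (rule bound_ge0[OF rec \<gamma>0 VLge[OF r]]) (use rle[OF r] in auto)
    moreover have "1 + 1 = ereal 2" by (simp add: one_ereal_def)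
    ultimately show ?thesis using True r by (simp add: v_min_eq w_ind_def kronecker_def vge_def)
  next
    case False
    then have ge1: "Min (\<nu> ` Q) \<ge> 1" using val01 by auto
    show ?thesis
    proof (cases "Min (\<nu> ` Q) = 2")
      case True
      obtain r where r: "min (ereal 0) (V L) = ereal r" using min_ereal_finite V_L_not_MInf by blast
      have "vge (t Q) (real (card Q) + r + 1)"
        by (rule bound_all_ge2[OF rec \<gamma>1[OF ge1] \<gamma>2[OF True] VLge[OF r]]) (use rle[OF r] Q_ne in auto)
      \<comment> \<open>The extra 1 from \<open>bound_all_ge2\<close> moves into both arguments of
        the minimum.\<close>
      moreover have "min 1 (V L + 1) = ereal (r + 1)"
        using r by (cases "V L") (auto simp: min_def one_ereal_def split: if_splits)
      ultimately show ?thesis using True False ge1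
        by (simp add: v_min_eq w_ind_def kronecker_def vge_def add.assoc)
    next
      case False2: False
      obtain r where r: "min (ereal 1) (V L) = ereal r" using min_ereal_finite V_L_not_MInf by blast
      have "vge (t Q) (real (card Q) + r)"
        by (rule bound_ge1[OF rec \<gamma>1[OF ge1] VLge[OF r]]) (use rle[OF r] in auto)
      then show ?thesis using False False2 ge1 r
        by (simp add: v_min_eq w_ind_def kronecker_def vge_def one_ereal_def[symmetric])
    qed
  qed
qed

text \<open>The two cases are g = 0, mu = 1 and g = 1, mu < 1 of
  \<open>valuation_eq_of_odd_count\<close>; in both the minimum is its second argument.\<close>

lemma equality_case:
  assumes neg: "\<And>q. q \<in> Q \<Longrightarrow> Legendre (- 1) (int q) = 1"
    and cases: "V L = 1 \<and> (\<forall>q\<in>Q. \<nu> q = 0) \<or> V L < 1 \<and> (\<forall>q\<in>Q. \<nu> q = 1)"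
  shows "V (t Q) = w_ind v a m * ereal (real (card Q)) +
    min (1 + kronecker (v_min v a m) 0) (V L + kronecker (v_min v a m) 2)"
proof -
  have rec: "rec 1" using neg by (rule rec_1)
  have ev: "even_set D" if "D \<subseteq> Q" for D
    unfolding even_set_def chi_def using neg that by (intro prod.neutral) blast
  have Min_const: "Min (\<nu> ` Q) = c" if "\<forall>q\<in>Q. \<nu> q = c" for c
  proof -
    have "\<nu> ` Q = {c}" using that Q_ne by auto
    then show ?thesis by simp
  qed
  from cases show ?thesis
  proof
    assume *: "V L = 1 \<and> (\<forall>q\<in>Q. \<nu> q = 0)"
    have "V (t Q) = ereal (real (card Q) * 0 + 1)"
    proof (rule valuation_eq_of_odd_count[OF rec ev])
      show "V (\<gamma> D q) = ereal 0" if "D \<subseteq> Q" "q \<in> Q - D" for D q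
        by (rule V_\<gamma>[OF that]) (use * that in \<open>auto simp: zero_ereal_def\<close>)
      show "V L = ereal 1" using * by (simp add: one_ereal_def)
    qed auto
    moreover have "(1::ereal) \<le> 1 + 1" by (simp add: one_ereal_def)
    ultimately show ?thesis using * Min_const[of 0]
      by (simp add: v_min_eq w_ind_def kronecker_def one_ereal_def[symmetric] min_def)
  next
    assume *: "V L < 1 \<and> (\<forall>q\<in>Q. \<nu> q = 1)"
    then obtain r where r: "V L = ereal r" "r < 1"
      using V_L_not_MInf by (cases "V L") (auto simp: one_ereal_def)
    have "V (t Q) = ereal (real (card Q) * 1 + r)"
    proof (rule valuation_eq_of_odd_count[OF rec ev])
      show "V (\<gamma> D q) = ereal 1" if "D \<subseteq> Q" "q \<in> Q - D" for D q
        by (rule V_\<gamma>[OF that]) (use * that in \<open>auto simp: one_ereal_def\<close>)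
    qed (use r in auto)
    moreover have "min 1 (ereal r) = ereal r" using r by (simp add: one_ereal_def min_def)
    ultimately show ?thesis using * Min_const[of 1] r
      by (simp add: v_min_eq w_ind_def kronecker_def)
  qed
qed

end

theorem theorem4p1:
  fixes N m :: nat
    and f :: "complex \<Rightarrow> complex"
    and a :: "nat \<Rightarrow> complex"
    and E :: weierstrass
    and \<Phi> :: parametrization
    and v :: "complex \<Rightarrow> ereal"
    and \<Omega>p \<Omega>m :: real
    and Q :: "nat set"
  assumes "N \<ge> 1"
    and "new_form_space N f"
    and "hecke_eigenform N f"
    and "q_expansion f a"
    and "a 1 = 1"
    and "\<forall>n\<ge>1. a n \<in> \<rat>"
    and "global_minimal_model E"
    and "optimal_parametrization N E \<Phi>"
    and "manin_constant_one N f E \<Phi>"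
    and "two_adic_valuation v"
    and "\<Omega>p > 0" and "\<Omega>m > 0"
    and rectangular: "period_lattice N f = rectangular_lattice \<Omega>p \<Omega>m"
    and "finite Q" and "Q \<noteq> {}" and "\<forall>q\<in>Q. prime q \<and> odd q"
    and "m = \<Prod>Q" and "coprime m N"
  shows
    "(Q \<subseteq> S_all v N a 0 \<union> S_all v N a 1 \<union> S_all v N a 2 \<longrightarrow>
        v (L_ratio a \<Omega>p \<Omega>m m) \<ge>
          w_ind v a m * ereal (real (card Q))
          + min (kronecker (v_min v a m) 0) (v (L_ratio a \<Omega>p \<Omega>m 1)))
     \<and>
     (Q \<subseteq> S_plus v N a 0 \<union> S_plus v N a 1 \<union> S_plus v N a 2 \<longrightarrow>
        v (L_ratio a \<Omega>p \<Omega>m m) \<ge>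
          w_ind v a m * ereal (real (card Q))
          + min (1 + kronecker (v_min v a m) 0)
                (v (L_ratio a \<Omega>p \<Omega>m 1) + kronecker (v_min v a m) 2))
     \<and>
     (v (L_ratio a \<Omega>p \<Omega>m 1) = 1 \<and> Q \<subseteq> S_plus v N a 0 \<or>
      v (L_ratio a \<Omega>p \<Omega>m 1) < 1 \<and> Q \<subseteq> S_plus v N a 1 \<longrightarrow>
        v (L_ratio a \<Omega>p \<Omega>m m) =
          w_ind v a m * ereal (real (card Q))
          + min (1 + kronecker (v_min v a m) 0)
                (v (L_ratio a \<Omega>p \<Omega>m 1) + kronecker (v_min v a m) 2))"
proof -
  have not_dvd: "\<not> q dvd N" if q: "q \<in> Q" for q
  proof
    assume "q dvd N"
    moreover have "q dvd m" using assms(14,17) q by (auto intro: dvd_prodI)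
    ultimately have "q dvd 1" using assms(18) by (metis coprime_common_divisor)
    then show False using assms(16) q by auto
  qed
  interpret P: eigen_rect_val N f a \<Omega>p \<Omega>m Q v
    by unfold_locales (use assms not_dvd in \<open>auto simp: new_form_space_def\<close>)
  have val: "valuation2 v" by unfold_locales
  have m: "P.m = m" using assms(17) by (simp add: P.m_def)
  have vm: "v (L_ratio a \<Omega>p \<Omega>m m) = P.V (P.t Q)" using P.v_L_ratio[OF val] m by simp
  have v1: "v (L_ratio a \<Omega>p \<Omega>m 1) = P.V P.L" by (rule P.v_L_ratio_1[OF val])
  show ?thesis
    unfolding vm v1
  proof (intro conjI impI)
    assume "Q \<subseteq> S_all v N a 0 \<union> S_all v N a 1 \<union> S_all v N a 2"
    then have "P.\<nu> q = 0 \<or> P.\<nu> q = 1 \<or> P.\<nu> q = 2" if "q \<in> Q" for q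
      using that by (auto simp: S_all_def dest!: subsetD P.S_setD simp: zero_ereal_def one_ereal_def)
    from P.bounds(1)[OF this]
    show "P.V (P.t Q) \<ge> w_ind v a m * ereal (real (card Q)) + min (kronecker (v_min v a m) 0) (P.V P.L)"
      by (simp add: m)
  next
    assume Q: "Q \<subseteq> S_plus v N a 0 \<union> S_plus v N a 1 \<union> S_plus v N a 2"
    then have "P.\<nu> q = 0 \<or> P.\<nu> q = 1 \<or> P.\<nu> q = 2" if "q \<in> Q" for q
      using that by (auto dest!: subsetD P.S_setD simp: zero_ereal_def one_ereal_def)
    from P.bounds(2)[OF this]
    show "P.V (P.t Q) \<ge> w_ind v a m * ereal (real (card Q)) +
        min (1 + kronecker (v_min v a m) 0) (P.V P.L + kronecker (v_min v a m) 2)"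
      using Q P.S_plusD by (auto simp: m)
  next
    assume H: "P.V P.L = 1 \<and> Q \<subseteq> S_plus v N a 0 \<or> P.V P.L < 1 \<and> Q \<subseteq> S_plus v N a 1"
    then have neg: "Legendre (- 1) (int q) = 1" if "q \<in> Q" for q
      using that P.S_plusD by blast
    have "P.V P.L = 1 \<and> (\<forall>q\<in>Q. P.\<nu> q = 0) \<or> P.V P.L < 1 \<and> (\<forall>q\<in>Q. P.\<nu> q = 1)"
    proof -
      have "P.\<nu> q = 0" if "Q \<subseteq> S_plus v N a 0" "q \<in> Q" for q
        using P.S_setD[of q 1 0] that by auto
      moreover have "P.\<nu> q = 1" if "Q \<subseteq> S_plus v N a 1" "q \<in> Q" for q
        using P.S_setD[of q 1 1] that by auto
      ultimately show ?thesis using H by blast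
    qed
    from P.equality_case[OF neg this]
    show "P.V (P.t Q) = w_ind v a m * ereal (real (card Q)) +
        min (1 + kronecker (v_min v a m) 0) (P.V P.L + kronecker (v_min v a m) 2)"
      by (simp add: m)
  qed
qed

end
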